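(* For each integer $n \geq 1$, $d^n X_{\theta} = \ell_{\phi_{\theta,n}}$ and the identity map $d^n X_{\theta} \to \ell_{\phi_{\theta, n}}$ is an isomorphism (of quasi-Banach spaces, i.e. the two quasinorms are equivalent). Here $d^nX_\theta$ is the $n$-th derived (Rochberg) space of the couple $\overline{X} = (\ell_{\phi_0}, \ell_{\phi_1})$ at $\theta\in(0,1)$, and $\ell_{\phi_{\theta,n}}$ is the Fenchel-Orlicz space of the quasi-Young function $\phi_{\theta,n}$; an $n$-tuple $(x_{n-1},\dots,x_0)$ of scalar sequences is identified with the sequence $k\mapsto (x_{n-1}(k),\dots,x_0(k))$ in $\mathbb{C}^n$.
   Context: **Young and quasi-Young functions.** A function $\phi:\mathbb{C}^n\to[0,\infty)$ is quasi-Young if $\phi(0)=0$, $\lim_{t\to\infty}\phi(tx)=\infty$ for every $x\neq 0$, $\phi(e^{is}x)=\phi(x)$ for all $x\in\mathbb{C}^n$, $s\in\mathbb{R}$, and there is $C>0$ with $\phi(tx+(1-t)y)\le C(t\phi(x)+(1-t)\phi(y))$ for all $x,y\in\mathbb{C}^n$, $t\in[0,1]$. It is a Young function if it is convex (and has the other three properties). The Fenchel-Orlicz space is $\ell_\phi=\{(x^k)_k\in(\mathbb{C}^n)^{\mathbb{N}}:\exists\rho>0,\ \sum_k\phi(x^k/\rho)<\infty\}$ with $\|(x^k)\|_\phi=\inf\{\rho>0:\sum_k\phi(x^k/\rho)\le 1\}$, which is a complete quasinorm. An Orlicz function is a Young function on $\mathbb{C}$; it satisfies $\phi(x)=\phi(|x|)$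 and so is determined by its values on $[0,\infty)$. It is nondegenerate if $\phi(t)>0$ for $t>0$; then $\phi^{-1}$ denotes the inverse of $\phi|_{[0,\infty)}$. $\phi$ satisfies $\Delta_2$ if there is $M>0$ with $\phi(2x)\le M\phi(x)$ for all $x$. **Setting.** $\phi_0,\phi_1$ are nondegenerate Orlicz functions satisfying $\Delta_2$; it is also allowed that the space $\ell_{\phi_0}$ is replaced by $\ell_\infty$ or $c_0$, in which case $\phi_0^{-1}$ is taken to be the constant function $1$. $\theta\in(0,1)$ is fixed and $\phi_\theta$ is the Orlicz function given by $\phi_\theta^{-1}=(\phi_0^{-1})^{1-\theta}(\phi_1^{-1})^{\theta}$ on $[0,\infty)$. **The functions $\phi_{\theta,n}$.** Let $\mathbb{S}=\{z\in\mathbb{C}:0\le \mathrm{Re}(z)\le 1\}$ with interior $\mathbb{S}^{\mathrm o}$, and let $\varphi:\mathbb{S}\to\overline{\mathbb{D}}$ be a conformal map (continuous on $\mathbb{S}$, conformal from $\mathbb{S}^{\mathrm o}$ onto the open unit disk $\mathbb{D}$) with $\varphi(\theta)=0$. For a function $f$, $\hat f[j;z]=f^{(j)}(z)/j!$. Let $\mathrm{sgn}(z)=z/|z|$ for $z\ne0$, $\mathrm{sgn}(0)=0$. For $x\in\mathbb{C}$ put $g_x(z)=\phi_0^{-1}(\phi_\theta(|x|))^{1-z}\,\phi_1^{-1}(\phi_\theta(|x|))^{z}\,\mathrm{sgn}(x)$, $z\in\mathbb{S}$ (so $g_0\equiv 0$). For $n\ge2$ and $x=(x_{n-1},\dots,x_0)\in\mathbb{C}^n$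 put $$g_x(z)=g_{(x_{n-2},\dots,x_0)}(z)+\frac{\varphi(z)^{n-1}}{k_n}\,g_{\,n!\,(x_{n-1}-\hat g_{(x_{n-2},\dots,x_0)}[n-1;\theta])}(z),\qquad k_n=n!\,\varphi'(\theta)^{n-1},$$ so that $\hat g_x[j;\theta]=x_j$ for $0\le j\le n-1$. Let $\phi_{\theta,1}=\phi_\theta$ and, for $n\ge2$, $$\phi_{\theta,n}(x_{n-1},\dots,x_0)=\phi_{\theta,n-1}(x_{n-2},\dots,x_0)+\phi_\theta\big(x_{n-1}-\hat g_{(x_{n-2},\dots,x_0)}[n-1;\theta]\big).$$ **Derived spaces.** Let $\overline{X}=(X_0,X_1)=(\ell_{\phi_0},\ell_{\phi_1})$, both spaces viewed inside $\mathbb{C}^{\mathbb{N}}$, and $\Sigma(\overline X)=X_0+X_1$ with norm $\|x\|=\inf\{\|x_0\|_{X_0}+\|x_1\|_{X_1}:x=x_0+x_1\}$. $\mathcal F(\overline X)$ is the Banach space of bounded continuous $f:\mathbb{S}\to\Sigma(\overline X)$, analytic on $\mathbb{S}^{\mathrm o}$, such that $t\mapsto f(j+it)$ is continuous and bounded from $\mathbb{R}$ into $X_j$, $j=0,1$, with norm $\|f\|=\sup_{j=0,1;\,t\in\mathbb{R}}\|f(j+it)\|_{X_j}$. $X_\theta=\{f(\theta):f\in\mathcal F(\overline X)\}$ with the quotient norm. Put $d^1X_\theta=X_\theta$. Given $d^nX_\theta$, there is a homogeneous map $B^n_\theta:d^nX_\theta\to\mathcal F(\overline X)$ and a constant $C_n>0$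 with $\widehat{B^n_\theta(x)}[j;\theta]=x_j$ for every $x=(x_{n-1},\dots,x_0)\in d^nX_\theta$, $0\le j\le n-1$, and $\|B^n_\theta(x)\|\le C_n\|x\|$. Put $\Omega^n_\theta(x)=\widehat{B^n_\theta(x)}[n;\theta]\in\Sigma(\overline X)$ and $d^{n+1}X_\theta=\{(w,x):x\in d^nX_\theta,\ w-\Omega^n_\theta(x)\in X_\theta\}\subset\Sigma(\overline X)\times d^nX_\theta$, with quasinorm $\|(w,x)\|=\|w-\Omega^n_\theta(x)\|_{X_\theta}+\|x\|_{d^nX_\theta}$. Up to equivalence of quasinorms $d^nX_\theta$ does not depend on the choice of the maps $B^n_\theta$. *)

theory Defs
  imports "HOL-Complex_Analysis.Complex_Analysis"
begin

section \<open>Orlicz functions and Fenchel-Orlicz spaces\<close>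

type_synonym cseq = "nat \<Rightarrow> complex"

definition orlicz :: "(complex \<Rightarrow> real) \<Rightarrow> bool" where
  "orlicz \<phi> \<longleftrightarrow> (\<forall>x. 0 \<le> \<phi> x) \<and> \<phi> 0 = 0 \<and>
     (\<forall>x. x \<noteq> 0 \<longrightarrow> filterlim (\<lambda>t::real. \<phi> (of_real t * x)) at_top at_top) \<and>
     (\<forall>x s. \<phi> (exp (\<i> * of_real s) * x) = \<phi> x) \<and>
     convex_on UNIV \<phi>"

definition nondegenerate :: "(complex \<Rightarrow> real) \<Rightarrow> bool" where
  "nondegenerate \<phi> \<longleftrightarrow> (\<forall>t::real. 0 < t \<longrightarrow> 0 < \<phi> (of_real t))"

definition delta2 :: "(complex \<Rightarrow> real) \<Rightarrow> bool" where
  "delta2 \<phi> \<longleftrightarrow> (\<exists>M>0. \<forall>x. \<phi> (2 * x) \<le> M * \<phi> x)"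

definition orlicz_inv :: "(complex \<Rightarrow> real) \<Rightarrow> real \<Rightarrow> real" where
  "orlicz_inv \<phi> = the_inv_into {0..} (\<lambda>t. \<phi> (of_real t))"

text \<open>A point \<open>(x\<^sub>n\<^sub>-\<^sub>1, \<dots>, x\<^sub>0)\<close> of complex \<open>n\<close>-space is the list of its \<open>n\<close> coordinates in this
  order, so that consing adds a coordinate of higher index. For a nonnegative \<open>\<phi>\<close>,
  finiteness of the sum in the usual definition is summability.\<close>

definition fo_space :: "nat \<Rightarrow> (complex list \<Rightarrow> real) \<Rightarrow> (nat \<Rightarrow> complex list) set" where
  "fo_space n \<phi> = {x. (\<forall>k. length (x k) = n) \<and>
     (\<exists>\<rho>::real. 0 < \<rho> \<and> summable (\<lambda>k. \<phi> (map (\<lambda>c. c / of_real \<rho>) (x k))))}"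

definition fo_norm :: "(complex list \<Rightarrow> real) \<Rightarrow> (nat \<Rightarrow> complex list) \<Rightarrow> real" where
  "fo_norm \<phi> x = Inf {\<rho>::real. 0 < \<rho> \<and>
     summable (\<lambda>k. \<phi> (map (\<lambda>c. c / of_real \<rho>) (x k))) \<and>
     (\<Sum>k. \<phi> (map (\<lambda>c. c / of_real \<rho>) (x k))) \<le> 1}"

section \<open>The couple\<close>

text \<open>A normed space of sequences; the norm is only meaningful on the carrier.\<close>

datatype seq_space = Seq_Space (carr: "cseq set") (nrm: "cseq \<Rightarrow> real")

definition ell_orlicz :: "(complex \<Rightarrow> real) \<Rightarrow> seq_space" where
  "ell_orlicz \<phi> = Seq_Space
     {x. (\<lambda>k. [x k]) \<in> fo_space 1 (\<lambda>v. \<phi> (hd v))}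
     (\<lambda>x. fo_norm (\<lambda>v. \<phi> (hd v)) (\<lambda>k. [x k]))"

definition ell_infty :: seq_space where
  "ell_infty = Seq_Space {x. bounded (range x)} (\<lambda>x. SUP k. cmod (x k))"

definition c_zero :: seq_space where
  "c_zero = Seq_Space {x. x \<longlonglongrightarrow> 0} (\<lambda>x. SUP k. cmod (x k))"

text \<open>The left endpoint of the couple is either an Orlicz space or one of the two
  sup-norm spaces, for which \<open>1\<close> plays the role of the inverse function.\<close>

datatype endpoint = Orlicz_Space "complex \<Rightarrow> real" | Ell_Infty | C_Zero

fun endpoint_ok :: "endpoint \<Rightarrow> bool" where
  "endpoint_ok (Orlicz_Space \<phi>) \<longleftrightarrow> orlicz \<phi> \<and> nondegenerate \<phi> \<and> delta2 \<phi>"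
| "endpoint_ok Ell_Infty \<longleftrightarrow> True"
| "endpoint_ok C_Zero \<longleftrightarrow> True"

fun endpoint_space :: "endpoint \<Rightarrow> seq_space" where
  "endpoint_space (Orlicz_Space \<phi>) = ell_orlicz \<phi>"
| "endpoint_space Ell_Infty = ell_infty"
| "endpoint_space C_Zero = c_zero"

fun endpoint_inv :: "endpoint \<Rightarrow> real \<Rightarrow> real" where
  "endpoint_inv (Orlicz_Space \<phi>) = orlicz_inv \<phi>"
| "endpoint_inv Ell_Infty = (\<lambda>_. 1)"
| "endpoint_inv C_Zero = (\<lambda>_. 1)"

section \<open>The functions \<open>\<phi>\<^sub>\<theta>\<^sub>,\<^sub>n\<close>\<close>

definition strip :: "complex set" where
  "strip = {z. 0 \<le> Re z \<and> Re z \<le> 1}"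

definition strip_conformal :: "real \<Rightarrow> (complex \<Rightarrow> complex) \<Rightarrow> bool" where
  "strip_conformal \<theta> h \<longleftrightarrow> continuous_on strip h \<and> h ` strip \<subseteq> cball 0 1 \<and>
     h holomorphic_on interior strip \<and> bij_betw h (interior strip) (ball 0 1) \<and>
     h (of_real \<theta>) = 0"

text \<open>In the remainder of this section \<open>i0\<close> and \<open>i1\<close> stand for the inverses
  of \<open>\<phi>\<^sub>0\<close> and \<open>\<phi>\<^sub>1\<close>, and \<open>h\<close> for the conformal map.\<close>

definition phi_theta :: "(real \<Rightarrow> real) \<Rightarrow> (real \<Rightarrow> real) \<Rightarrow> real \<Rightarrow> complex \<Rightarrow> real" where
  "phi_theta i0 i1 \<theta> x =
     the_inv_into {0..} (\<lambda>t. i0 t powr (1 - \<theta>) * i1 t powr \<theta>) (cmod x)"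

definition g_scalar ::
  "(real \<Rightarrow> real) \<Rightarrow> (real \<Rightarrow> real) \<Rightarrow> real \<Rightarrow> complex \<Rightarrow> complex \<Rightarrow> complex" where
  "g_scalar i0 i1 \<theta> x z =
     of_real (i0 (phi_theta i0 i1 \<theta> (of_real (cmod x)))) powr (1 - z) *
     of_real (i1 (phi_theta i0 i1 \<theta> (of_real (cmod x)))) powr z * sgn x"

definition taylor_coeff :: "(complex \<Rightarrow> complex) \<Rightarrow> nat \<Rightarrow> complex \<Rightarrow> complex" where
  "taylor_coeff f j z = (deriv ^^ j) f z / fact j"

text \<open>With \<open>n = length (x # y # ys)\<close>, the tail \<open>y # ys\<close> has length \<open>n - 1\<close>. The value on
  the empty list is a dummy.\<close>

fun g_tuple ::
  "(real \<Rightarrow> real) \<Rightarrow> (real \<Rightarrow> real) \<Rightarrow> real \<Rightarrow> (complex \<Rightarrow> complex) \<Rightarrow>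
   complex list \<Rightarrow> complex \<Rightarrow> complex" where
  "g_tuple i0 i1 \<theta> h [] = (\<lambda>z. 0)"
| "g_tuple i0 i1 \<theta> h [x] = g_scalar i0 i1 \<theta> x"
| "g_tuple i0 i1 \<theta> h (x # y # ys) =
    (let n = length (x # y # ys);
         G = g_tuple i0 i1 \<theta> h (y # ys);
         k\<^sub>n = fact n * deriv h (of_real \<theta>) ^ (n - 1)
     in (\<lambda>z. G z + h z ^ (n - 1) / k\<^sub>n *
              g_scalar i0 i1 \<theta> (fact n * (x - taylor_coeff G (n - 1) (of_real \<theta>))) z))"

fun phi_theta_tuple ::
  "(real \<Rightarrow> real) \<Rightarrow> (real \<Rightarrow> real) \<Rightarrow> real \<Rightarrow> (complex \<Rightarrow> complex) \<Rightarrow>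
   complex list \<Rightarrow> real" where
  "phi_theta_tuple i0 i1 \<theta> h [] = 0"
| "phi_theta_tuple i0 i1 \<theta> h [x] = phi_theta i0 i1 \<theta> x"
| "phi_theta_tuple i0 i1 \<theta> h (x # y # ys) =
    (let n = length (x # y # ys) in
     phi_theta_tuple i0 i1 \<theta> h (y # ys) +
     phi_theta i0 i1 \<theta>
       (x - taylor_coeff (g_tuple i0 i1 \<theta> h (y # ys)) (n - 1) (of_real \<theta>)))"

section \<open>Complex interpolation of couples of sequence spaces\<close>

definition sum_space :: "seq_space \<Rightarrow> seq_space \<Rightarrow> seq_space" where
  "sum_space X0 X1 = Seq_Space
     {x. \<exists>a\<in>carr X0. \<exists>b\<in>carr X1. x = (\<lambda>k. a k + b k)}
     (\<lambda>x. Inf {nrm X0 a + nrm X1 b | a b.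
                a \<in> carr X0 \<and> b \<in> carr X1 \<and> x = (\<lambda>k. a k + b k)})"

definition bdd_continuous_into ::
  "seq_space \<Rightarrow> 'a::topological_space set \<Rightarrow> ('a \<Rightarrow> cseq) \<Rightarrow> bool" where
  "bdd_continuous_into Y S f \<longleftrightarrow> (\<forall>z\<in>S. f z \<in> carr Y) \<and>
     (\<exists>M. \<forall>z\<in>S. nrm Y (f z) \<le> M) \<and>
     (\<forall>z\<in>S. ((\<lambda>w. nrm Y (\<lambda>k. f w k - f z k)) \<longlongrightarrow> 0) (at z within S))"

definition has_deriv_in ::
  "seq_space \<Rightarrow> (complex \<Rightarrow> cseq) \<Rightarrow> cseq \<Rightarrow> complex \<Rightarrow> bool" where
  "has_deriv_in Y f d z \<longleftrightarrow> d \<in> carr Y \<and>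
     ((\<lambda>w. nrm Y (\<lambda>k. (f w k - f z k) / (w - z) - d k)) \<longlongrightarrow> 0) (at z)"

definition deriv_in :: "seq_space \<Rightarrow> (complex \<Rightarrow> cseq) \<Rightarrow> complex \<Rightarrow> cseq" where
  "deriv_in Y f z = (THE d. has_deriv_in Y f d z)"

definition taylor_coeff_in ::
  "seq_space \<Rightarrow> (complex \<Rightarrow> cseq) \<Rightarrow> nat \<Rightarrow> complex \<Rightarrow> cseq" where
  "taylor_coeff_in Y f j z = (\<lambda>k. (deriv_in Y ^^ j) f z k / fact j)"

text \<open>Only the values on the strip matter; elements of the function space are
  identified when they agree there.\<close>

definition calderon :: "seq_space \<Rightarrow> seq_space \<Rightarrow> (complex \<Rightarrow> cseq) set" where
  "calderon X0 X1 = {f.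
     bdd_continuous_into (sum_space X0 X1) strip f \<and>
     (\<forall>z\<in>interior strip. \<exists>d. has_deriv_in (sum_space X0 X1) f d z) \<and>
     bdd_continuous_into X0 UNIV (\<lambda>t::real. f (Complex 0 t)) \<and>
     bdd_continuous_into X1 UNIV (\<lambda>t::real. f (Complex 1 t))}"

definition calderon_norm :: "seq_space \<Rightarrow> seq_space \<Rightarrow> (complex \<Rightarrow> cseq) \<Rightarrow> real" where
  "calderon_norm X0 X1 f =
     Sup (range (\<lambda>t. nrm X0 (f (Complex 0 t))) \<union> range (\<lambda>t. nrm X1 (f (Complex 1 t))))"

definition interp_space :: "seq_space \<Rightarrow> seq_space \<Rightarrow> real \<Rightarrow> seq_space" where
  "interp_space X0 X1 \<theta> = Seq_Space
     {f (of_real \<theta>) | f. f \<in> calderon X0 X1}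
     (\<lambda>x. Inf {calderon_norm X0 X1 f | f. f \<in> calderon X0 X1 \<and> f (of_real \<theta>) = x})"

section \<open>Derived spaces\<close>

text \<open>Elements of the \<open>n\<close>-th derived space are lists \<open>[x\<^sub>n\<^sub>-\<^sub>1, \<dots>, x\<^sub>0]\<close> of \<open>n\<close> sequences.
  \<open>B n\<close> is the chosen lifting of the \<open>n\<close>-th derived space to the function space.
  The clauses for \<open>0\<close> and the empty list are dummies.\<close>

type_synonym lifting = "nat \<Rightarrow> cseq list \<Rightarrow> complex \<Rightarrow> cseq"

definition Omega ::
  "seq_space \<Rightarrow> seq_space \<Rightarrow> real \<Rightarrow> lifting \<Rightarrow> nat \<Rightarrow> cseq list \<Rightarrow> cseq" where
  "Omega X0 X1 \<theta> B n x = taylor_coeff_in (sum_space X0 X1) (B n x) n (of_real \<theta>)"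

fun derived_space ::
  "seq_space \<Rightarrow> seq_space \<Rightarrow> real \<Rightarrow> lifting \<Rightarrow> nat \<Rightarrow> cseq list set" where
  "derived_space X0 X1 \<theta> B 0 = {[]}"
| "derived_space X0 X1 \<theta> B (Suc 0) = {[x] | x. x \<in> carr (interp_space X0 X1 \<theta>)}"
| "derived_space X0 X1 \<theta> B (Suc (Suc m)) =
    {w # x | w x. w \<in> carr (sum_space X0 X1) \<and> x \<in> derived_space X0 X1 \<theta> B (Suc m) \<and>
       (\<lambda>k. w k - Omega X0 X1 \<theta> B (Suc m) x k) \<in> carr (interp_space X0 X1 \<theta>)}"

fun derived_norm ::
  "seq_space \<Rightarrow> seq_space \<Rightarrow> real \<Rightarrow> lifting \<Rightarrow> cseq list \<Rightarrow> real" where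
  "derived_norm X0 X1 \<theta> B [] = 0"
| "derived_norm X0 X1 \<theta> B [x] = nrm (interp_space X0 X1 \<theta>) x"
| "derived_norm X0 X1 \<theta> B (w # y # ys) =
     nrm (interp_space X0 X1 \<theta>)
       (\<lambda>k. w k - Omega X0 X1 \<theta> B (length (y # ys)) (y # ys) k) +
     derived_norm X0 X1 \<theta> B (y # ys)"

text \<open>As coordinates are listed from index \<open>n - 1\<close> down to \<open>0\<close>, the sequence \<open>x\<^sub>j\<close> is
  \<open>rev x ! j\<close>.\<close>

definition admissible_lifting ::
  "seq_space \<Rightarrow> seq_space \<Rightarrow> real \<Rightarrow> lifting \<Rightarrow> bool" where
  "admissible_lifting X0 X1 \<theta> B \<longleftrightarrow> (\<forall>n\<ge>1.
     (\<forall>x\<in>derived_space X0 X1 \<theta> B n. B n x \<in> calderon X0 X1) \<and>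
     (\<forall>x\<in>derived_space X0 X1 \<theta> B n. \<forall>c. \<forall>z\<in>strip.
        B n (map (\<lambda>s k. c * s k) x) z = (\<lambda>k. c * B n x z k)) \<and>
     (\<forall>x\<in>derived_space X0 X1 \<theta> B n. \<forall>j<n.
        taylor_coeff_in (sum_space X0 X1) (B n x) j (of_real \<theta>) = rev x ! j) \<and>
     (\<exists>C>0. \<forall>x\<in>derived_space X0 X1 \<theta> B n.
        calderon_norm X0 X1 (B n x) \<le> C * derived_norm X0 X1 \<theta> B x))"

text \<open>The identification of an \<open>n\<close>-tuple of sequences with a sequence of \<open>n\<close>-tuples.\<close>

definition seq_of_tuples :: "cseq list \<Rightarrow> nat \<Rightarrow> complex list" where
  "seq_of_tuples x = (\<lambda>k. map (\<lambda>s. s k) x)"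

end

theory Submission
  imports Defs
begin

text \<open>
  The maps \<open>B\<^sub>n\<close> are compared with the explicit lifting \<open>x \<mapsto> g\<^sub>x\<close> applied coordinatewise: if both lift the
  same \<open>x\<close>, the difference of their \<open>n\<close>-th coefficients is, up to the constant \<open>h'(\<theta>)\<^sup>n\<close>, the value at
  \<open>\<theta>\<close> of \<open>(B\<^sub>n x - g\<^sub>x) / h\<^sup>n\<close>, which has the same modulus as \<open>B\<^sub>n x - g\<^sub>x\<close> on the boundary of the strip.
  So everything reduces to one scalar fact: if finitely many bounded analytic \<open>q\<^sub>k\<close> have modulars bounded by
  \<open>R\<close> on the two boundary lines, then \<open>\<Sum> \<phi>\<^sub>\<theta> (q\<^sub>k(\<theta>) / 2) \<le> R\<close>. With \<open>s\<^sub>k\<close> the terms of that sum, this is the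
  maximum principle for \<open>\<Sum> s\<^sub>k q\<^sub>k / g\<^sub>k\<close>, where \<open>g\<^sub>k\<close> is the extremal function through \<open>q\<^sub>k(\<theta>)\<close>, together with
  a Young inequality on each line. Only finitely many coordinates enter at a time, so \<open>g\<^sub>x\<close> need
  not itself belong to the Calderon space, which it does not for \<open>\<ell>\<^sub>\<infinity>\<close> and \<open>c\<^sub>0\<close>. Modulars rather than norms are
  propagated by induction on \<open>n\<close>; norms enter only through the homogeneity of \<open>B\<^sub>n\<close>.
\<close>

section \<open>The strip and the conformal map\<close>

text \<open>Modulars suit the recursion because \<open>P_Cons\<close> is additive: the modular of a
  tuple is that of its tail plus that of its corrected head, whereas a quasinorm does not split in
  this way. Two one-sided statements survive the induction: a bounded modular bounds the derived
  quasinorm, and a small derived quasinorm makes the modular small. Since both quasinorms react to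
  dilations in the same way, rescaling by \<rho> turns these two statements into the equivalence.
  The obstacle on the way from a modular to a norm is continuity: the extremal family through a
  sequence of finite modular is bounded, but it may fail to be norm continuous. The growth of
  \<phi>_\<theta> under dilations leaves room for divergent weights, and these repair it. The spaces
  are sets of sequences with a norm function on them, so norm statements about analytic functions
  are recovered from the coordinates by explicit limits.\<close>

lemma strip_eq_halfspaces: "strip = {z. (1::complex) \<bullet> z \<ge> 0} \<inter> {z. (1::complex) \<bullet> z \<le> 1}"
  by (auto simp: strip_def)

lemma interior_strip: "interior strip = {z. 0 < Re z \<and> Re z < 1}"
  unfolding strip_eq_halfspaces interior_Int
    interior_halfspace_ge[OF one_neq_zero] interior_halfspace_le[OF one_neq_zero]
  by auto

lemma interior_strip_subset: "z \<in> interior strip \<Longrightarrow> z \<in> strip"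
  by (rule subsetD[OF interior_subset])

lemma boundary_strip:
  "z \<in> strip \<Longrightarrow> z \<notin> interior strip \<longleftrightarrow> Re z = 0 \<or> Re z = 1"
  by (auto simp: interior_strip) (auto simp: strip_def)

lemma of_real_interior_strip: "0 < \<theta> \<Longrightarrow> \<theta> < 1 \<Longrightarrow> complex_of_real \<theta> \<in> interior strip"
  by (simp add: interior_strip)

text \<open>Phragmen--Lindelof: the factor \<open>exp (\<epsilon> (z\<^sup>2 - 1))\<close> decays at both ends of the strip.\<close>

lemma strip_maximum_principle:
  assumes cont: "continuous_on strip f" and holo: "f holomorphic_on interior strip"
    and bdd: "bounded (f ` strip)"
    and bd: "\<And>z. z \<in> strip \<Longrightarrow> Re z = 0 \<or> Re z = 1 \<Longrightarrow> norm (f z) \<le> B"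
    and z: "z \<in> strip"
  shows "norm (f z) \<le> B"
proof (rule field_le_epsilon)
  fix e :: real assume e: "0 < e"
  obtain M where M: "M > 0" "\<And>w. w \<in> strip \<Longrightarrow> norm (f w) \<le> M"
    using bdd by (auto simp: bounded_pos)
  have "norm (f 0) \<le> B" by (rule bd) (auto simp: strip_def)
  then have B0: "B \<ge> 0" using norm_ge_zero order_trans by blast
  \<comment> \<open>\<open>e\<close> pays for the horizontal sides of a rectangle. It stays fixed
    while \<epsilon> tends to 0 and is arbitrary in the end.\<close>
  have key: "norm (f z) * exp (\<epsilon> * ((Re z)\<^sup>2 - (Im z)\<^sup>2 - 1)) \<le> B + e" if \<epsilon>: "\<epsilon> > 0" for \<epsilon> :: real
  proof -
    define g where "g = (\<lambda>w. f w * exp (of_real \<epsilon> * (w\<^sup>2 - 1)))"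
    have ng: "norm (g w) = norm (f w) * exp (\<epsilon> * ((Re w)\<^sup>2 - (Im w)\<^sup>2 - 1))" for w
      by (simp add: g_def norm_mult power2_eq_square)
    \<comment> \<open>The rectangle has to be so high that
      \<open>exp (- (\<epsilon> * R\<^sup>2))\<close> beats the global bound \<open>M\<close> of
      \<open>f\<close>; its height depends on \<epsilon>.\<close>
    have "filterlim (\<lambda>R::real. \<epsilon> * R\<^sup>2) at_top at_top"
      using \<epsilon> by (intro filterlim_tendsto_pos_mult_at_top[OF tendsto_const] filterlim_pow_at_top filterlim_ident) auto
    then have "((\<lambda>R::real. M * exp (- (\<epsilon> * R\<^sup>2))) \<longlongrightarrow> M * 0) at_top"
      by (intro tendsto_mult tendsto_const filterlim_compose[OF exp_at_bot])
         (simp add: filterlim_uminus_at_bot)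
    then have "eventually (\<lambda>R::real. M * exp (- (\<epsilon> * R\<^sup>2)) < e) at_top"
      using e by (auto dest!: order_tendstoD(2))
    then have "eventually (\<lambda>R::real. M * exp (- (\<epsilon> * R\<^sup>2)) < e \<and> R > \<bar>Im z\<bar>) at_top"
      by (intro eventually_conj eventually_gt_at_top)
    then obtain R where R: "M * exp (- (\<epsilon> * R\<^sup>2)) < e" "R > \<bar>Im z\<bar>"
      by (auto simp: eventually_at_top_linorder)
    define S where "S = cbox (Complex 0 (-R)) (Complex 1 R)"
    have memS: "w \<in> S \<longleftrightarrow> 0 \<le> Re w \<and> Re w \<le> 1 \<and> \<bar>Im w\<bar> \<le> R" for w
      by (auto simp: S_def in_cbox_complex_iff)
    have Sstrip: "S \<subseteq> strip" by (auto simp: memS strip_def)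
    have "norm (g z) \<le> B + e"
    proof (rule maximum_modulus_frontier[where S=S and f=g])
      show "g holomorphic_on interior S"
        unfolding g_def
        by (intro holomorphic_intros holomorphic_on_subset[OF holo] interior_mono Sstrip)
      have "continuous_on S g"
        unfolding g_def by (intro continuous_intros continuous_on_subset[OF cont Sstrip])
      then show "continuous_on (closure S) g" by (simp add: S_def)
      show "bounded S" by (simp add: S_def bounded_cbox)
      show "z \<in> S" using z R(2) by (auto simp: memS strip_def)
      fix w assume w: "w \<in> frontier S"
      have "w \<in> S" using w by (simp add: S_def frontier_def)
      have *: "Re w = 0 \<or> Re w = 1 \<or> \<bar>Im w\<bar> = R"
      proof (rule ccontr)
        assume c: "\<not> ?thesis"
        have "w \<in> box (Complex 0 (-R)) (Complex 1 R)"
          using c \<open>w \<in> S\<close> by (auto simp: memS in_box_complex_iff abs_le_iff)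
        then show False using w by (simp add: S_def frontier_def interior_cbox)
      qed
      have re: "(Re w)\<^sup>2 \<le> 1" using \<open>w \<in> S\<close> by (auto simp: memS abs_square_le_1)
      then have e1: "exp (\<epsilon> * ((Re w)\<^sup>2 - (Im w)\<^sup>2 - 1)) \<le> exp (- (\<epsilon> * (Im w)\<^sup>2))"
        using \<epsilon> by (auto simp: algebra_simps)
      have ws: "w \<in> strip" using \<open>w \<in> S\<close> Sstrip by auto
      show "norm (g w) \<le> B + e"
      proof (cases "\<bar>Im w\<bar> = R")
        case True
        then have "(Im w)\<^sup>2 = R\<^sup>2" by (metis power2_abs)
        then have "norm (g w) \<le> M * exp (- (\<epsilon> * R\<^sup>2))"
          unfolding ng using e1 M(2)[OF ws] M(1) by (intro mult_mono) auto
        then show ?thesis using R(1) B0 by linarith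
      next
        case False
        then have "norm (f w) \<le> B" using * bd ws by blast
        moreover have "exp (\<epsilon> * ((Re w)\<^sup>2 - (Im w)\<^sup>2 - 1)) \<le> 1"
          by (rule order_trans[OF e1]) (use \<epsilon> in simp)
        ultimately have "norm (g w) \<le> B * 1" unfolding ng using B0 by (intro mult_mono) auto
        then show ?thesis using e by simp
      qed
    qed
    then show ?thesis by (simp add: ng)
  qed
  have "((\<lambda>\<epsilon>. norm (f z) * exp (\<epsilon> * ((Re z)\<^sup>2 - (Im z)\<^sup>2 - 1))) \<longlongrightarrow>
     norm (f z) * exp (0 * ((Re z)\<^sup>2 - (Im z)\<^sup>2 - 1))) (at_right 0)"
    by (intro tendsto_intros)
  then have "norm (f z) * exp (0 * ((Re z)\<^sup>2 - (Im z)\<^sup>2 - 1)) \<le> B + e"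
  proof (rule tendsto_upperbound)
    show "\<forall>\<^sub>F \<epsilon> in at_right 0. norm (f z) * exp (\<epsilon> * ((Re z)\<^sup>2 - (Im z)\<^sup>2 - 1)) \<le> B + e"
      using eventually_at_right_less[of "0::real"] by eventually_elim (rule key)
  qed simp
  then show "norm (f z) \<le> B + e" by simp
qed

section \<open>Zeros of finite order\<close>

lemma higher_deriv_linear_at: "(deriv ^^ i) (\<lambda>w::complex. w - a) a = (if i = 1 then 1 else 0)"
proof -
  have c: "(deriv ^^ j) (\<lambda>w::complex. c) = (\<lambda>w. if j = 0 then c else 0)" for j c
    by (induction j) auto
  have d: "deriv (\<lambda>w::complex. w - a) = (\<lambda>w. 1)" by (simp add: fun_eq_iff)
  show ?thesis
    by (cases i) (auto simp: funpow_swap1 d c simp del: funpow.simps simp: funpow_Suc_right)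
qed

text \<open>In the Leibniz expansion only the term that differentiates \<open>z - a\<close> exactly
  once survives at \<open>a\<close>; its factor \<open>Suc j\<close> is absorbed by the
  factorial.\<close>

lemma taylor_coeff_linear_mult:
  assumes F: "F holomorphic_on S" and S: "open S" "a \<in> S"
  shows "taylor_coeff (\<lambda>z. (z - a) * F z) (Suc j) a = taylor_coeff F j a"
proof -
  have "(deriv ^^ Suc j) (\<lambda>z. (z - a) * F z) a =
      (\<Sum>i = 0..Suc j. of_nat (Suc j choose i) * (deriv ^^ i) (\<lambda>w. w - a) a * (deriv ^^ (Suc j - i)) F a)"
    by (rule higher_deriv_mult[OF _ F S]) (intro holomorphic_intros)
  also have "\<dots> = (\<Sum>i = 0..Suc j. if i = 1 then of_nat (Suc j) * (deriv ^^ j) F a else 0)"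
    by (intro sum.cong) (auto simp: higher_deriv_linear_at simp del: funpow.simps)
  also have "\<dots> = of_nat (Suc j) * (deriv ^^ j) F a" by simp
  finally show ?thesis
    by (simp add: taylor_coeff_def field_simps del: funpow.simps of_nat_Suc)
qed

text \<open>The zero is removed one order at a time. The difference quotient is again holomorphic,
  and its coefficients are those of \<open>f\<close> moved down by one, so that \<open>F a\<close>
  ends up as the first coefficient not assumed to vanish.\<close>

lemma factor_zero_of_order:
  assumes "f holomorphic_on S" "open S" "a \<in> S" "\<And>j. j < n \<Longrightarrow> taylor_coeff f j a = 0"
  obtains F where "F holomorphic_on S" "\<And>z. z \<in> S \<Longrightarrow> f z = (z - a) ^ n * F z"
    "F a = taylor_coeff f n a"
proof -
  have "\<exists>F. F holomorphic_on S \<and> (\<forall>z\<in>S. f z = (z - a) ^ n * F z) \<and> F a = taylor_coeff f n a"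
    using assms(1,4)
  proof (induction n arbitrary: f)
    case 0
    then show ?case by (intro exI[of _ f]) (auto simp: taylor_coeff_def)
  next
    case (Suc n)
    define G where "G = (\<lambda>z. if z = a then deriv f a else (f z - f a) / (z - a))"
    have G: "G holomorphic_on S"
      unfolding G_def by (rule pole_lemma_open) (use Suc assms in auto)
    have "f a = 0" using Suc.prems(2)[of 0] by (simp add: taylor_coeff_def)
    then have fG: "f z = (z - a) * G z" for z by (simp add: G_def)
    then have f: "f = (\<lambda>z. (z - a) * G z)" by blast
    have tc: "taylor_coeff f (Suc j) a = taylor_coeff G j a" for j
      by (subst f) (rule taylor_coeff_linear_mult[OF G assms(2,3)])
    obtain F where F: "F holomorphic_on S" "\<forall>z\<in>S. G z = (z - a) ^ n * F z" "F a = taylor_coeff G n a"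
      using Suc.IH[OF G] Suc.prems(2) tc by (metis Suc_less_eq)
    show ?case
      by (intro exI[of _ F]) (use F fG tc[of n] in \<open>auto simp: mult.assoc simp flip: f\<close>)
  qed
  then show ?thesis using that by blast
qed

section \<open>Boundary values of the conformal map and division by its powers\<close>

text \<open>A value inside the disk is already taken at an interior point \<open>z'\<close>.
  Interior points tending to \<open>z\<close> then have images tending to \<open>h z'\<close>, and
  continuity of the inverse on the disk forces \<open>z = z'\<close>.\<close>

lemma strip_conformal_boundary:
  assumes h: "strip_conformal \<theta> h" and z: "z \<in> strip" "Re z = 0 \<or> Re z = 1"
  shows "norm (h z) = 1"
proof (rule ccontr)
  assume "norm (h z) \<noteq> 1"
  moreover have "norm (h z) \<le> 1" using h z by (auto simp: strip_conformal_def)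
  ultimately have hz: "h z \<in> ball 0 1" by simp
  have cont: "continuous_on strip h" and holo: "h holomorphic_on interior strip"
    and bij: "bij_betw h (interior strip) (ball 0 1)" using h by (auto simp: strip_conformal_def)
  obtain p where p: "p holomorphic_on h ` interior strip" "\<And>w. w \<in> interior strip \<Longrightarrow> p (h w) = w"
    by (rule holomorphic_has_inverse[OF holo open_interior bij_betw_imp_inj_on[OF bij]]) (blast intro: that)
  have im: "h ` interior strip = ball 0 1" using bij by (simp add: bij_betw_def)
  then have "h z \<in> h ` interior strip" using hz by simp
  then obtain z' where z': "h z = h z'" "z' \<in> interior strip" by (rule imageE)
  \<comment> \<open>The approach is horizontal, from the middle line of the strip
    (\<open>n = 0\<close>) towards \<open>z\<close>.\<close>
  define u where "u = (\<lambda>n::nat. z + of_real ((1/2 - Re z) / (real n + 1)))"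
  have "(\<lambda>n::nat. (1/2 - Re z) / (real n + 1)) \<longlonglongrightarrow> 0"
    using LIMSEQ_Suc[OF lim_const_over_n[of "1/2 - Re z"]] by (simp add: add.commute)
  then have "u \<longlonglongrightarrow> z + of_real 0"
    unfolding u_def by (intro tendsto_add tendsto_const tendsto_of_real)
  then have u: "u \<longlonglongrightarrow> z" by simp
  have ui: "u n \<in> interior strip" for n
    using z(2) by (auto simp: u_def interior_strip field_simps)
  have "(\<lambda>n. h (u n)) \<longlonglongrightarrow> h z"
    by (rule continuous_on_tendsto_compose[OF cont u z(1)]) (use ui interior_strip_subset in auto)
  moreover have "isCont p (h z)"
    using continuous_on_interior[OF holomorphic_on_imp_continuous_on[OF p(1)]] hz by (simp add: im)
  ultimately have "(\<lambda>n. p (h (u n))) \<longlonglongrightarrow> p (h z)" by (rule isCont_tendsto_compose[rotated])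
  then have "u \<longlonglongrightarrow> p (h z)" using p(2) ui by simp
  then have "u \<longlonglongrightarrow> z'" using p(2)[OF z'(2)] z'(1) by simp
  then have "z = z'" by (rule LIMSEQ_unique[OF u])
  then show False using z'(2) z(2) boundary_strip[OF z(1)] by simp
qed

lemma strip_conformal_deriv_nonzero:
  assumes "strip_conformal \<theta> h" "0 < \<theta>" "\<theta> < 1"
  shows "deriv h (of_real \<theta>) \<noteq> 0"
  by (rule holomorphic_injective_imp_regular[of _ "interior strip"])
     (use assms of_real_interior_strip in \<open>auto simp: strip_conformal_def bij_betw_def\<close>)

lemma strip_conformal_nonzero:
  assumes h: "strip_conformal \<theta> h" "0 < \<theta>" "\<theta> < 1" and z: "z \<in> strip" "z \<noteq> of_real \<theta>"
  shows "h z \<noteq> 0"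
proof (cases "z \<in> interior strip")
  case True
  then show ?thesis
    using h z of_real_interior_strip[OF h(2,3)]
    by (metis bij_betw_def inj_onD strip_conformal_def)
next
  case False
  then show ?thesis using strip_conformal_boundary[OF h(1) z(1)] boundary_strip[OF z(1)] by force
qed

text \<open>Both \<open>f\<close> and \<open>h ^ n\<close> contain the factor
  \<open>(z - \<theta>) ^ n\<close>. After cancelling it, the denominator is \<open>H ^ n\<close>
  with \<open>H\<close> free of zeros in the interior and equal to the derivative of
  \<open>h\<close> at \<theta>. On the boundary \<open>h\<close> is unimodular, so the modulus of
  \<open>f\<close> is unchanged there.\<close>

lemma divide_by_conformal_power:
  assumes h: "strip_conformal \<theta> h" "0 < \<theta>" "\<theta> < 1"
    and cont: "continuous_on strip f" and holo: "f holomorphic_on interior strip"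
    and bdd: "bounded (f ` strip)" and van: "\<And>j. j < n \<Longrightarrow> taylor_coeff f j (of_real \<theta>) = 0"
  obtains q where "continuous_on strip q" "q holomorphic_on interior strip" "bounded (q ` strip)"
    "\<And>z. z \<in> strip \<Longrightarrow> Re z = 0 \<or> Re z = 1 \<Longrightarrow> norm (q z) = norm (f z)"
    "q (of_real \<theta>) = taylor_coeff f n (of_real \<theta>) / deriv h (of_real \<theta>) ^ n"
proof -
  let ?\<theta> = "complex_of_real \<theta>"
  have \<theta>: "?\<theta> \<in> interior strip" using of_real_interior_strip h by blast
  have conth: "continuous_on strip h" and holoh: "h holomorphic_on interior strip"
    and bij: "bij_betw h (interior strip) (ball 0 1)" and h0: "h ?\<theta> = 0"
    using h by (auto simp: strip_conformal_def)
  obtain F where F: "F holomorphic_on interior strip"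
    "\<And>z. z \<in> interior strip \<Longrightarrow> f z = (z - ?\<theta>) ^ n * F z" "F ?\<theta> = taylor_coeff f n ?\<theta>"
    using factor_zero_of_order[OF holo open_interior \<theta> van] by blast
  have "taylor_coeff h j ?\<theta> = 0" if "j < 1" for j using that h0 by (simp add: taylor_coeff_def)
  then obtain H where H: "H holomorphic_on interior strip"
    "\<And>z. z \<in> interior strip \<Longrightarrow> h z = (z - ?\<theta>) ^ 1 * H z" "H ?\<theta> = taylor_coeff h 1 ?\<theta>"
    using factor_zero_of_order[OF holoh open_interior \<theta>, of 1] by blast
  have H\<theta>: "H ?\<theta> = deriv h ?\<theta>" using H(3) by (simp add: taylor_coeff_def)
  have Hnz: "H z \<noteq> 0" if "z \<in> interior strip" for z
  proof (cases "z = ?\<theta>")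
    case True then show ?thesis using H\<theta> strip_conformal_deriv_nonzero[OF h] by simp
  next
    case False
    then show ?thesis
      using strip_conformal_nonzero[OF h interior_strip_subset[OF that]] H(2)[OF that] by auto
  qed
  define q where "q = (\<lambda>z. if z = ?\<theta> then F z / H z ^ n else f z / h z ^ n)"
  have qFH: "q z = F z / H z ^ n" if "z \<in> interior strip" for z
    using F(2)[OF that] H(2)[OF that] by (auto simp: q_def power_mult_distrib)
  have holoq: "q holomorphic_on interior strip"
  proof (rule holomorphic_transform)
    show "(\<lambda>z. F z / H z ^ n) holomorphic_on interior strip"
      by (intro holomorphic_intros F H) (use Hnz in auto)
  qed (use qFH in auto)
  have contq: "continuous_on strip q"
    unfolding continuous_on_eq_continuous_within
  proof
    fix z assume z: "z \<in> strip"
    show "continuous (at z within strip) q"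
    proof (cases "z \<in> interior strip")
      case True
      have "isCont q z"
        by (rule continuous_on_interior[OF holomorphic_on_imp_continuous_on[OF holoq]]) (use True in simp)
      then show ?thesis by (rule continuous_at_imp_continuous_at_within)
    next
      case False
      then have nz: "z \<noteq> ?\<theta>" using \<theta> by blast
      have "continuous (at z within strip) (\<lambda>w. f w / h w ^ n)"
        using cont conth z strip_conformal_nonzero[OF h z nz]
        by (intro continuous_intros) (auto simp: continuous_on_eq_continuous_within)
      then show ?thesis
      proof (rule continuous_transform_within[where \<delta> = "dist z ?\<theta>"])
        show "0 < dist z ?\<theta>" using nz by simp
        show "f w / h w ^ n = q w" if "dist w z < dist z ?\<theta>" for w
          using that by (auto simp: q_def dist_commute)
      qed (rule z)
    qed
  qed
  have bddq: "bounded (q ` strip)"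
  proof -
    obtain p where p: "p holomorphic_on h ` interior strip" "\<And>w. w \<in> interior strip \<Longrightarrow> p (h w) = w"
      by (rule holomorphic_has_inverse[OF holoh open_interior bij_betw_imp_inj_on[OF bij]]) (blast intro: that)
    have im: "h ` interior strip = ball 0 1" using bij by (simp add: bij_betw_def)
    \<comment> \<open>\<open>K\<close> contains all points of the strip where \<open>h\<close> has
      modulus at most 1/2. It is compact as an image under the inverse of \<open>h\<close>, so
      \<open>q\<close> is bounded on it by continuity; elsewhere division by \<open>h ^ n\<close>
      costs at most \<open>2 ^ n\<close>.\<close>
    define K where "K = p ` cball 0 (1/2)"
    have sub: "cball (0::complex) (1/2) \<subseteq> ball 0 1" by auto
    have "continuous_on (cball 0 (1/2)) p"
      using holomorphic_on_imp_continuous_on[OF p(1)] sub unfolding im by (rule continuous_on_subset)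
    then have "compact K" unfolding K_def by (intro compact_continuous_image compact_cball)
    moreover have K: "K \<subseteq> interior strip"
    proof
      fix z assume "z \<in> K"
      then obtain y where "y \<in> cball 0 (1/2)" "z = p y" by (auto simp: K_def)
      moreover from this obtain w where "w \<in> interior strip" "y = h w" using sub im by blast
      ultimately show "z \<in> interior strip" using p(2) by simp
    qed
    ultimately have "bounded (q ` K)"
      using continuous_on_subset[OF contq] interior_strip_subset
      by (intro compact_imp_bounded compact_continuous_image) auto
    then obtain M1 where M1: "\<And>z. z \<in> K \<Longrightarrow> norm (q z) \<le> M1" by (auto simp: bounded_iff)
    obtain M where M: "\<And>w. w \<in> strip \<Longrightarrow> norm (f w) \<le> M"
      using bdd by (auto simp: bounded_iff)
    have "norm (q z) \<le> max M1 (M * 2 ^ n)" if z: "z \<in> strip" for z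
    proof (cases "norm (h z) \<le> 1/2")
      case True
      then have "z \<in> interior strip"
        using strip_conformal_boundary[OF h(1) z] boundary_strip[OF z] by force
      then have "z \<in> K" using p(2) True by (force simp: K_def)
      then show ?thesis using M1 by fastforce
    next
      case False
      then have "z \<noteq> ?\<theta>" using h0 by auto
      have "(1/2) ^ n \<le> norm (h z) ^ n" using False by (intro power_mono) linarith+
      then have "norm (f z) / norm (h z) ^ n \<le> M / (1/2) ^ n"
        by (intro frac_le order_trans[OF norm_ge_zero M[OF z]] M[OF z]) simp_all
      then have "norm (q z) \<le> M * 2 ^ n"
        using \<open>z \<noteq> ?\<theta>\<close> by (simp add: q_def norm_divide norm_power power_divide)
      then show ?thesis by simp
    qed
    then show ?thesis by (auto simp: bounded_iff)
  qed
  show ?thesis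
  proof (rule that[OF contq holoq bddq])
    show "norm (q z) = norm (f z)" if "z \<in> strip" "Re z = 0 \<or> Re z = 1" for z
      using that strip_conformal_boundary[OF h(1) that] h(2,3)
      by (auto simp: q_def norm_divide norm_power)
    show "q ?\<theta> = taylor_coeff f n ?\<theta> / deriv h ?\<theta> ^ n" by (simp add: q_def F(3) H\<theta>)
  qed
qed

section \<open>Holomorphic functions with values in a sequence space\<close>

text \<open>Completeness is encoded by absolutely convergent series, summed coordinatewise;
  \<open>coord_bound\<close> guarantees that the coordinate series converge. Applied to a series
  with two nonzero terms, the same axioms give closure under addition and the triangle
  inequality.\<close>

locale banach_seq =
  fixes Y :: seq_space
  assumes zero_mem: "(\<lambda>_. 0) \<in> carr Y"
    and nrm_nonneg: "x \<in> carr Y \<Longrightarrow> 0 \<le> nrm Y x"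
    and scale_mem: "x \<in> carr Y \<Longrightarrow> (\<lambda>k. c * x k) \<in> carr Y"
    and nrm_scale_le: "x \<in> carr Y \<Longrightarrow> nrm Y (\<lambda>k. c * x k) \<le> cmod c * nrm Y x"
    and coord_bound: "\<exists>C. \<forall>x\<in>carr Y. cmod (x k) \<le> C * nrm Y x"
    and series_mem: "(\<And>n. u n \<in> carr Y) \<Longrightarrow> summable (\<lambda>n. nrm Y (u n)) \<Longrightarrow>
      (\<lambda>k. \<Sum>n. u n k) \<in> carr Y"
    and nrm_series_le: "(\<And>n. u n \<in> carr Y) \<Longrightarrow> summable (\<lambda>n. nrm Y (u n)) \<Longrightarrow>
      nrm Y (\<lambda>k. \<Sum>n. u n k) \<le> (\<Sum>n. nrm Y (u n))"
begin

lemma nrm_zero: "nrm Y (\<lambda>_. 0) = 0"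
  using nrm_scale_le[OF zero_mem, of 0] nrm_nonneg[OF zero_mem] by simp

lemma
  assumes "x \<in> carr Y" "y \<in> carr Y"
  shows add_mem: "(\<lambda>k. x k + y k) \<in> carr Y"
    and nrm_triangle: "nrm Y (\<lambda>k. x k + y k) \<le> nrm Y x + nrm Y y"
proof -
  define u where "u = (\<lambda>n::nat. if n = 0 then x else if n = 1 then y else (\<lambda>_. 0))"
  have u: "u n \<in> carr Y" for n using assms zero_mem by (auto simp: u_def)
  have s1: "(\<lambda>n. nrm Y (u n)) sums (nrm Y x + nrm Y y)"
    using sums_finite[of "{0, 1}" "\<lambda>n. nrm Y (u n)"] by (auto simp: u_def nrm_zero)
  have s2: "(\<Sum>n. u n k) = x k + y k" for k
    using sums_finite[of "{0, 1}" "\<lambda>n. u n k"] by (auto simp: u_def sums_iff)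
  show "(\<lambda>k. x k + y k) \<in> carr Y" "nrm Y (\<lambda>k. x k + y k) \<le> nrm Y x + nrm Y y"
    using series_mem[of u, OF u] nrm_series_le[of u, OF u] s1 by (simp_all add: s2 sums_iff)
qed

lemma nrm_scale:
  assumes "x \<in> carr Y"
  shows "nrm Y (\<lambda>k. c * x k) = cmod c * nrm Y x"
proof (cases "c = 0")
  case True then show ?thesis by (simp add: nrm_zero)
next
  case False
  have "nrm Y (\<lambda>k. inverse c * (c * x k)) \<le> cmod (inverse c) * nrm Y (\<lambda>k. c * x k)"
    by (rule nrm_scale_le[OF scale_mem[OF assms]])
  moreover have "(\<lambda>k. inverse c * (c * x k)) = x" using False by (auto simp: fun_eq_iff)
  ultimately have "cmod c * nrm Y x \<le> nrm Y (\<lambda>k. c * x k)"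
    using False by (simp add: norm_divide field_simps)
  then show ?thesis using nrm_scale_le[OF assms, of c] by simp
qed

lemma minus_mem: "x \<in> carr Y \<Longrightarrow> (\<lambda>k. - x k) \<in> carr Y"
  using scale_mem[of x "-1"] by simp

lemma nrm_minus: "x \<in> carr Y \<Longrightarrow> nrm Y (\<lambda>k. - x k) = nrm Y x"
  using nrm_scale[of x "-1"] by simp

lemma diff_mem: "x \<in> carr Y \<Longrightarrow> y \<in> carr Y \<Longrightarrow> (\<lambda>k. x k - y k) \<in> carr Y"
  using add_mem[OF _ minus_mem, of x y] by simp

lemma nrm_diff_commute:
  "x \<in> carr Y \<Longrightarrow> y \<in> carr Y \<Longrightarrow> nrm Y (\<lambda>k. x k - y k) = nrm Y (\<lambda>k. y k - x k)"
  using nrm_minus[OF diff_mem, of x y] by simp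

lemma nrm_triangle_via:
  assumes "x \<in> carr Y" "y \<in> carr Y" "z \<in> carr Y"
  shows "nrm Y (\<lambda>k. x k - z k) \<le> nrm Y (\<lambda>k. x k - y k) + nrm Y (\<lambda>k. y k - z k)"
  using nrm_triangle[OF diff_mem diff_mem, of x y y z] assms by simp

lemma
  assumes "\<And>i. i \<in> I \<Longrightarrow> u i \<in> carr Y"
  shows sum_mem: "(\<lambda>k. \<Sum>i\<in>I. u i k) \<in> carr Y"
    and nrm_sum: "nrm Y (\<lambda>k. \<Sum>i\<in>I. u i k) \<le> (\<Sum>i\<in>I. nrm Y (u i))"
  using assms
proof (induction I rule: infinite_finite_induct)
  case (insert j I)
  {
    case 1 then show ?case using add_mem[of "u j" "\<lambda>k. \<Sum>i\<in>I. u i k"] insert by auto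
  next
    case 2 then show ?case using nrm_triangle[of "u j" "\<lambda>k. \<Sum>i\<in>I. u i k"] insert
      by (auto intro: order_trans)
  }
qed (auto simp: zero_mem nrm_zero)

lemma coord_continuous:
  assumes mem: "eventually (\<lambda>w. v w \<in> carr Y) F" and lim: "((\<lambda>w. nrm Y (v w)) \<longlongrightarrow> 0) F"
  shows "((\<lambda>w. v w k) \<longlongrightarrow> 0) F"
proof -
  obtain C where C: "\<And>x. x \<in> carr Y \<Longrightarrow> cmod (x k) \<le> C * nrm Y x" using coord_bound by blast
  show ?thesis
  proof (rule Lim_null_comparison)
    show "\<forall>\<^sub>F w in F. norm (v w k) \<le> C * nrm Y (v w)" using mem by eventually_elim (rule C)
    show "((\<lambda>w. C * nrm Y (v w)) \<longlongrightarrow> 0) F" using tendsto_mult_right_zero[OF lim] .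
  qed
qed

text \<open>Along a subsequence with increments below \<open>(1/2) ^ p\<close> the differences form
  an absolutely convergent telescoping series. Its coordinatewise sum identifies the coordinatewise
  limit \<open>a\<close> as the norm limit.\<close>

lemma limit_of_Cauchy:
  assumes mem: "\<And>n. u n \<in> carr Y"
    and Cauchy: "\<And>e. e > 0 \<Longrightarrow> \<exists>N. \<forall>m\<ge>N. \<forall>n\<ge>N. nrm Y (\<lambda>k. u m k - u n k) \<le> e"
    and lim: "\<And>k. (\<lambda>n. u n k) \<longlonglongrightarrow> a k"
    and bd: "\<And>n. nrm Y (u n) \<le> M"
  shows "a \<in> carr Y" "nrm Y a \<le> M"
proof -
  have "\<exists>N. \<forall>m\<ge>N. \<forall>n\<ge>N. nrm Y (\<lambda>k. u m k - u n k) \<le> (1/2) ^ p" for p :: nat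
    by (rule Cauchy) simp
  then obtain N where N: "\<And>p m n. N p \<le> m \<Longrightarrow> N p \<le> n \<Longrightarrow> nrm Y (\<lambda>k. u m k - u n k) \<le> (1/2) ^ p"
    by metis
  \<comment> \<open>Summing all thresholds up to \<open>p\<close> makes \<open>r\<close> dominate
    \<open>N\<close>; the extra summand \<open>p\<close> makes it strictly increasing.\<close>
  define r where "r = (\<lambda>p. p + (\<Sum>i\<le>p. N i))"
  have rN: "N p \<le> r p" for p using member_le_sum[of p "{..p}" N] by (simp add: r_def)
  have "strict_mono r" by (rule strict_monoI_Suc) (simp add: r_def)
  define d where "d = (\<lambda>q p k. u (r (Suc (p + q))) k - u (r (p + q)) k)"
  have d: "d q p \<in> carr Y" for q p using mem diff_mem by (simp add: d_def)
  have dle: "nrm Y (d q p) \<le> (1/2) ^ q * (1/2) ^ p" for q p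
  proof -
    have "nrm Y (d q p) \<le> (1/2) ^ (p + q)" unfolding d_def
      using rN[of "p + q"] by (intro N) (auto simp: r_def)
    then show ?thesis by (simp add: power_add mult.commute)
  qed
  have gs: "(\<lambda>p. (1/2) ^ q * (1/2) ^ p) sums ((1/2) ^ q * 2 :: real)" for q :: nat
    using sums_mult[OF geometric_sums[of "1/2::real"]] by simp
  have sd: "summable (\<lambda>p. nrm Y (d q p))" for q
    by (rule summable_comparison_test'[OF sums_summable[OF gs[of q]], of 0]) (use dle nrm_nonneg[OF d] in auto)
  have nd: "(\<Sum>p. nrm Y (d q p)) \<le> (1/2) ^ q * 2" for q
    using suminf_le[OF dle sd sums_summable[OF gs]] sums_unique[OF gs[of q]] by simp
  have dk: "(\<Sum>p. d q p k) = a k - u (r q) k" for q k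
  proof -
    have "(\<lambda>n. u (r n) k) \<longlonglongrightarrow> a k"
      using LIMSEQ_subseq_LIMSEQ[OF lim \<open>strict_mono r\<close>] by (simp add: o_def)
    then have "(\<lambda>p. u (r (p + q)) k) \<longlonglongrightarrow> a k" by (rule LIMSEQ_ignore_initial_segment)
    from telescope_sums[OF this] show ?thesis by (simp add: d_def sums_iff)
  qed
  have aq: "(\<lambda>k. a k - u (r q) k) \<in> carr Y" "nrm Y (\<lambda>k. a k - u (r q) k) \<le> (1/2) ^ q * 2" for q
    using series_mem[OF d sd] order_trans[OF nrm_series_le[OF d sd] nd] by (simp_all add: dk)
  show "a \<in> carr Y" using add_mem[OF aq(1)[of 0] mem[of "r 0"]] by simp
  have "nrm Y a \<le> M + (1/2) ^ q * 2" for q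
    using nrm_triangle[OF mem[of "r q"] aq(1)[of q]] aq(2)[of q] bd[of "r q"] by simp
  moreover have "(\<lambda>q. M + (1/2) ^ q * 2) \<longlonglongrightarrow> M + 0 * 2"
    by (intro tendsto_intros LIMSEQ_realpow_zero) auto
  ultimately show "nrm Y a \<le> M" by (intro LIMSEQ_le_const[of _ M]) auto
qed

section \<open>Riemann means and Cauchy estimates\<close>

text \<open>This stands in for the integral of a norm continuous function on [0,1]. The Riemann
  means are Cauchy in norm by uniform continuity, and \<open>limit_of_Cauchy\<close> then transfers
  membership and the bound to their coordinatewise limit.\<close>

lemma riemann_mean_limit:
  fixes p :: "real \<Rightarrow> cseq"
  assumes mem: "\<And>t. t \<in> {0..1} \<Longrightarrow> p t \<in> carr Y"
    and bd: "\<And>t. t \<in> {0..1} \<Longrightarrow> nrm Y (p t) \<le> M"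
    and cont: "\<And>t. t \<in> {0..1} \<Longrightarrow> ((\<lambda>s. nrm Y (\<lambda>k. p s k - p t k)) \<longlongrightarrow> 0) (at t within {0..1})"
    and lim: "\<And>k. (\<lambda>N. inverse (of_nat (Suc N)) * (\<Sum>m<Suc N. p (real m / real (Suc N)) k)) \<longlonglongrightarrow> a k"
  shows "a \<in> carr Y" "nrm Y a \<le> M"
proof -
  define S where "S = (\<lambda>N k. inverse (complex_of_nat N) * (\<Sum>m<N. p (real m / real N) k))"
  have tm: "real m / real N \<in> {0..1}" if "m < N" for m N using that by simp
  have Smem: "S N \<in> carr Y" for N
    unfolding S_def by (intro scale_mem sum_mem mem tm) auto
  have mean_le: "nrm Y (\<lambda>k. inverse (complex_of_nat N) * (\<Sum>m<N. v m k)) \<le> e"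
    if "\<And>m. m < N \<Longrightarrow> v m \<in> carr Y" "\<And>m. m < N \<Longrightarrow> nrm Y (v m) \<le> e" "N > 0" for N v e
  proof -
    have "nrm Y (\<lambda>k. \<Sum>m<N. v m k) \<le> (\<Sum>m<N. nrm Y (v m))" by (rule nrm_sum) (use that in auto)
    also have "\<dots> \<le> real N * e" using sum_bounded_above[of "{..<N}" "\<lambda>m. nrm Y (v m)" e] that by auto
    finally have "cmod (inverse (complex_of_nat N)) * nrm Y (\<lambda>k. \<Sum>m<N. v m k) \<le> e"
      using that(3) by (simp add: norm_divide field_simps)
    then show ?thesis
      using nrm_scale_le[OF sum_mem[of "{..<N}" v], of "inverse (of_nat N)"] that by auto
  qed
  have unif: "\<exists>\<delta>>0. \<forall>s\<in>{0..1}. \<forall>t\<in>{0..1}. \<bar>s - t\<bar> < \<delta> \<longrightarrow> nrm Y (\<lambda>k. p s k - p t k) \<le> e" if e: "e > 0" for e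
  proof -
    have "\<exists>\<delta>>0. \<forall>s\<in>{0..1}. \<bar>s - t\<bar> < \<delta> \<longrightarrow> nrm Y (\<lambda>k. p s k - p t k) \<le> e/2" if t: "t \<in> {0..1}" for t
    proof -
      have "\<forall>\<^sub>F s in at t within {0..1}. nrm Y (\<lambda>k. p s k - p t k) < e/2"
        using order_tendstoD(2)[OF cont[OF t], of "e/2"] e by simp
      then obtain \<delta> where \<delta>: "\<delta> > 0" "\<And>s. s \<in> {0..1} \<Longrightarrow> s \<noteq> t \<Longrightarrow> dist s t < \<delta> \<Longrightarrow> nrm Y (\<lambda>k. p s k - p t k) < e/2"
        by (auto simp: eventually_at)
      show ?thesis
      proof (intro exI[of _ \<delta>] conjI ballI impI)
        fix s assume "s \<in> {0..1}" "\<bar>s - t\<bar> < \<delta>"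
        then show "nrm Y (\<lambda>k. p s k - p t k) \<le> e/2"
          using \<delta>(2)[of s] e nrm_zero by (cases "s = t") (auto simp: dist_real_def less_imp_le)
      qed (rule \<delta>)
    qed
    then obtain D where D: "\<And>t. t \<in> {0..1} \<Longrightarrow> D t > 0"
      "\<And>s t. t \<in> {0..1} \<Longrightarrow> s \<in> {0..1} \<Longrightarrow> \<bar>s - t\<bar> < D t \<Longrightarrow> nrm Y (\<lambda>k. p s k - p t k) \<le> e/2"
      by metis
    \<comment> \<open>A Lebesgue number of the cover: points closer than \<delta> lie in a common
      ball, and the triangle inequality passes through its centre.\<close>
    obtain \<delta> where \<delta>: "\<delta> > 0" "\<And>x. x \<in> {0..1} \<Longrightarrow> \<exists>G\<in>(\<lambda>t. ball t (D t)) ` {0..1}. ball x \<delta> \<subseteq> G"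
    proof (rule Heine_Borel_lemma[of "{0..1::real}" "(\<lambda>t. ball t (D t)) ` {0..1}"])
      show "{0..1} \<subseteq> \<Union> ((\<lambda>t. ball t (D t)) ` {0..1})" using D(1) by force
    qed auto
    show ?thesis
    proof (intro exI[of _ \<delta>] conjI ballI impI)
      fix s t :: real assume st: "s \<in> {0..1}" "t \<in> {0..1}" "\<bar>s - t\<bar> < \<delta>"
      obtain x where x: "x \<in> {0..1}" "ball s \<delta> \<subseteq> ball x (D x)" using \<delta>(2)[OF st(1)] by auto
      have "s \<in> ball x (D x)" "t \<in> ball x (D x)"
        using x(2) st(3) \<delta>(1) by (auto simp: dist_real_def subset_iff)
      then have "nrm Y (\<lambda>k. p s k - p x k) \<le> e/2" "nrm Y (\<lambda>k. p t k - p x k) \<le> e/2"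
        using D(2)[OF x(1)] st by (auto simp: dist_real_def abs_minus_commute)
      moreover have "nrm Y (\<lambda>k. p x k - p t k) = nrm Y (\<lambda>k. p t k - p x k)"
        by (intro nrm_diff_commute mem) (use x st in auto)
      moreover have "nrm Y (\<lambda>k. p s k - p t k) \<le> nrm Y (\<lambda>k. p s k - p x k) + nrm Y (\<lambda>k. p x k - p t k)"
        by (intro nrm_triangle_via mem) (use x st in auto)
      ultimately show "nrm Y (\<lambda>k. p s k - p t k) \<le> e" by linarith
    qed (rule \<delta>)
  qed
  have refine: "nrm Y (\<lambda>k. S (N * L) k - S N k) \<le> e"
    if \<delta>: "\<forall>s\<in>{0..1}. \<forall>t\<in>{0..1}. \<bar>s - t\<bar> < \<delta> \<longrightarrow> nrm Y (\<lambda>k. p s k - p t k) \<le> e"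
      and N: "inverse (real N) < \<delta>" "N > 0" "L > 0" for N L e \<delta>
  proof -
    have close: "\<bar>real i / real (N * L) - real (i div L) / real N\<bar> < \<delta>" for i
    proof -
      have "real i = real (i div L) * real L + real (i mod L)"
        by (metis div_mult_mod_eq of_nat_add of_nat_mult)
      then have "real i / real (N * L) - real (i div L) / real N = real (i mod L) / real (N * L)"
        using N by (simp add: field_simps)
      moreover have "real (i mod L) / real (N * L) < inverse (real N)"
        using N mod_less_divisor[OF N(3), of i] by (simp add: field_simps)
      moreover have "0 \<le> real (i mod L) / real (N * L)" by simp
      ultimately show ?thesis using N(1) by linarith
    qed
    have lt: "i div L < N" if "i < N * L" for i using that by (simp add: less_mult_imp_div_less)
    \<comment> \<open>Each of the \<open>N\<close> samples is repeated \<open>L\<close> times, so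
      that the coarse and the fine mean run over the same \<open>N * L\<close> indices.\<close>
    have SN: "S N k = inverse (of_nat (N * L)) * (\<Sum>i<N * L. p (real (i div L) / real N) k)" for k
    proof -
      have "(\<Sum>i<N * L. p (real (i div L) / real N) k)
        = (\<Sum>m<N. \<Sum>i\<in>{m * L..<m * L + L}. p (real (i div L) / real N) k)"
        by (rule sum.nat_group[symmetric])
      also have "\<dots> = (\<Sum>m<N. \<Sum>i\<in>{m * L..<m * L + L}. p (real m / real N) k)"
      proof (intro sum.cong refl)
        fix m i assume "i \<in> {m * L..<m * L + L}"
        then have "i div L = m" by (intro div_nat_eqI) (auto simp: mult.commute)
        then show "p (real (i div L) / real N) k = p (real m / real N) k" by simp
      qed
      also have "\<dots> = of_nat L * (\<Sum>m<N. p (real m / real N) k)" by (simp add: sum_distrib_left)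
      finally show ?thesis using N by (simp add: S_def)
    qed
    have "nrm Y (\<lambda>k. inverse (of_nat (N * L)) *
      (\<Sum>i<N * L. p (real i / real (N * L)) k - p (real (i div L) / real N) k)) \<le> e"
    proof (rule mean_le)
      fix i assume i: "i < N * L"
      show "(\<lambda>k. p (real i / real (N * L)) k - p (real (i div L) / real N) k) \<in> carr Y"
        by (intro diff_mem mem tm i lt)
      show "nrm Y (\<lambda>k. p (real i / real (N * L)) k - p (real (i div L) / real N) k) \<le> e"
        using \<delta> close tm[OF i] tm[OF lt[OF i]] by blast
    qed (use N in simp)
    moreover have "S (N * L) k - S N k = inverse (of_nat (N * L)) *
      (\<Sum>i<N * L. p (real i / real (N * L)) k - p (real (i div L) / real N) k)" for k
      unfolding SN unfolding S_def by (simp add: sum_subtractf right_diff_distrib)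
    ultimately show ?thesis by presburger
  qed
  have Cau: "\<exists>N. \<forall>m\<ge>N. \<forall>n\<ge>N. nrm Y (\<lambda>k. S (Suc m) k - S (Suc n) k) \<le> e" if e: "e > 0" for e
  proof -
    obtain \<delta> where \<delta>: "\<delta> > 0" "\<forall>s\<in>{0..1}. \<forall>t\<in>{0..1}. \<bar>s - t\<bar> < \<delta> \<longrightarrow> nrm Y (\<lambda>k. p s k - p t k) \<le> e/2"
      using unif[of "e/2"] e by auto
    obtain N where N: "inverse (real (Suc N)) < \<delta>" using reals_Archimedean[OF \<delta>(1)] by blast
    have inv: "inverse (real (Suc m)) < \<delta>" if "m \<ge> N" for m
      by (rule order_le_less_trans[OF _ N]) (use that in \<open>simp add: le_imp_inverse_le\<close>)
    show ?thesis
    proof (intro exI[of _ N] allI impI)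
      fix m n assume "N \<le> m" "N \<le> n"
      \<comment> \<open>Both means are compared with the one for the common refinement into
        \<open>Suc m * Suc n\<close> pieces.\<close>
      then have "nrm Y (\<lambda>k. S (Suc m * Suc n) k - S (Suc m) k) \<le> e/2"
        "nrm Y (\<lambda>k. S (Suc n * Suc m) k - S (Suc n) k) \<le> e/2"
        using refine[OF \<delta>(2) inv] by blast+
      moreover have "nrm Y (\<lambda>k. S (Suc m) k - S (Suc n) k) \<le>
        nrm Y (\<lambda>k. S (Suc m) k - S (Suc m * Suc n) k) + nrm Y (\<lambda>k. S (Suc m * Suc n) k - S (Suc n) k)"
        by (intro nrm_triangle_via Smem)
      moreover have "nrm Y (\<lambda>k. S (Suc m) k - S (Suc m * Suc n) k) = nrm Y (\<lambda>k. S (Suc m * Suc n) k - S (Suc m) k)"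
        by (intro nrm_diff_commute Smem)
      ultimately show "nrm Y (\<lambda>k. S (Suc m) k - S (Suc n) k) \<le> e"
        by (simp only: mult.commute[of "Suc n" "Suc m"])
    qed
  qed
  have Sbd: "nrm Y (S (Suc n)) \<le> M" for n
    unfolding S_def by (rule mean_le) (auto intro!: mem bd tm simp del: of_nat_Suc)
  show "a \<in> carr Y" "nrm Y a \<le> M"
    using limit_of_Cauchy[of "\<lambda>n. S (Suc n)" a M, OF Smem Cau _ Sbd] lim
    unfolding S_def by auto
qed

end

text \<open>Orthogonality of the roots of unity. The summand is the \<open>m\<close>-th power of a
  quotient \<open>q\<close> of two \<open>N\<close>-th roots of unity, and the geometric sum
  vanishes unless \<open>q = 1\<close>; exponents below \<open>N\<close> make this the case
  \<open>i = j\<close>.\<close>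

lemma mean_root_of_unity_powers:
  fixes i j N :: nat
  assumes "i < N" "j < N"
  shows "inverse (of_nat N) * (\<Sum>m<N. cis (2 * pi * (real m / real N)) ^ i * inverse (cis (2 * pi * (real m / real N)) ^ j))
    = (if i = j then 1 else 0 :: complex)"
proof -
  define q where "q = cis (2 * pi * real i / real N) / cis (2 * pi * real j / real N)"
  have qm: "cis (2 * pi * (real m / real N)) ^ i * inverse (cis (2 * pi * (real m / real N)) ^ j) = q ^ m" for m
  proof -
    have "cis (2 * pi * (real m / real N)) ^ l = cis (2 * pi * real l / real N) ^ m" for l
      unfolding Complex.DeMoivre by (rule arg_cong[where f = cis]) simp
    then show ?thesis by (simp only: q_def power_divide) (simp only: divide_inverse)
  qed
  show ?thesis
  proof (cases "i = j")
    case True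
    then have "q = 1" by (simp add: q_def)
    then show ?thesis using True assms unfolding qm by simp
  next
    case False
    have "inj_on (\<lambda>k. cis (2 * pi * real k / real N)) {..<N}"
      using Complex.bij_betw_roots_unity[of N] assms by (simp add: bij_betw_def)
    then have "cis (2 * pi * real i / real N) \<noteq> cis (2 * pi * real j / real N)"
      using False assms by (auto dest: inj_onD)
    then have "q \<noteq> 1" by (simp add: q_def)
    have "cis (2 * pi * real l / real N) ^ N = 1" for l
    proof -
      have "real N * (2 * pi * real l / real N) = 2 * pi * real l" using assms by simp
      then show ?thesis using cis_multiple_2pi[of "real l"] by (simp only: Complex.DeMoivre) simp
    qed
    then have "q ^ N = 1" by (simp add: q_def power_divide)
    then show ?thesis using False \<open>q \<noteq> 1\<close> unfolding qm by (simp add: geometric_sum)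
  qed
qed

text \<open>The Cauchy integral formula in discrete form. Averaging the power series over
  \<open>Suc N\<close> points of the circle leaves coefficient \<open>j\<close> and removes every
  other coefficient \<open>i\<close> as soon as \<open>N\<close> reaches both indices. Tannery's
  theorem, with the moduli of the \<open>c i\<close> as majorant, exchanges the limit with the
  sum.\<close>

lemma taylor_coeff_as_limit_of_means:
  assumes holo: "F holomorphic_on ball z0 R" and r: "0 < r" "r < R"
  shows "(\<lambda>N. inverse (of_nat (Suc N)) *
      (\<Sum>m<Suc N. inverse ((of_real r * cis (2 * pi * (real m / real (Suc N)))) ^ j) *
        F (z0 + of_real r * cis (2 * pi * (real m / real (Suc N))))))
    \<longlonglongrightarrow> taylor_coeff F j z0"
proof -
  define a where "a = (\<lambda>i. taylor_coeff F i z0)"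
  define c where "c = (\<lambda>i. a i * of_real r ^ i / of_real r ^ j)"
  define w where "w = (\<lambda>N m. cis (2 * pi * (real m / real (Suc N))))"
  define \<mu> where "\<mu> = (\<lambda>N i. inverse (of_nat (Suc N)) * (\<Sum>m<Suc N. w N m ^ i * inverse (w N m ^ j)))"
  have ser: "(\<lambda>n. a n * (x - z0) ^ n) sums F x" if "x \<in> ball z0 R" for x
    unfolding a_def taylor_coeff_def using holomorphic_power_series[OF holo that] .
  \<comment> \<open>Absolute convergence at radius \<open>r\<close> comes from convergence at the
    intermediate radius \<open>(r + R) / 2\<close>.\<close>
  have "summable (\<lambda>n. norm (a n * (of_real r :: complex) ^ n))"
  proof (rule powser_insidea)
    show "summable (\<lambda>n. a n * of_real ((r + R) / 2) ^ n)"
      using sums_summable[OF ser[of "z0 + of_real ((r + R) / 2)"]] r by (simp add: dist_norm del: of_real_divide of_real_add)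
    show "norm (complex_of_real r) < norm (complex_of_real ((r + R) / 2))"
      using r by (simp del: of_real_divide of_real_add)
  qed
  then have sc: "summable (\<lambda>n. norm (c n))"
    unfolding c_def norm_divide by (rule summable_divide)
  have term_eq: "inverse ((of_real r * w N m) ^ j) * F (z0 + of_real r * w N m)
      = (\<Sum>i. c i * (w N m ^ i * inverse (w N m ^ j)))" 
    and term_sum: "summable (\<lambda>i. c i * (w N m ^ i * inverse (w N m ^ j)))" for N m
  proof -
    have "norm (w N m) = 1" by (simp add: w_def)
    then have "z0 + of_real r * w N m \<in> ball z0 R" using r by (simp add: dist_norm norm_mult)
    from sums_mult[OF ser[OF this], of "inverse ((of_real r * w N m) ^ j)"]
    have "(\<lambda>i. c i * (w N m ^ i * inverse (w N m ^ j))) sums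
        (inverse ((of_real r * w N m) ^ j) * F (z0 + of_real r * w N m))"
      by (simp add: c_def power_mult_distrib divide_inverse mult_ac)
    then show "inverse ((of_real r * w N m) ^ j) * F (z0 + of_real r * w N m)
      = (\<Sum>i. c i * (w N m ^ i * inverse (w N m ^ j)))"
      "summable (\<lambda>i. c i * (w N m ^ i * inverse (w N m ^ j)))" by (auto simp: sums_iff)
  qed
  have mean: "inverse (of_nat (Suc N)) * (\<Sum>m<Suc N. inverse ((of_real r * w N m) ^ j) * F (z0 + of_real r * w N m))
      = (\<Sum>i. c i * \<mu> N i)" for N
  proof -
    have "(\<Sum>m<Suc N. inverse ((of_real r * w N m) ^ j) * F (z0 + of_real r * w N m))
        = (\<Sum>i. \<Sum>m<Suc N. c i * (w N m ^ i * inverse (w N m ^ j)))"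
      unfolding term_eq by (rule suminf_sum[symmetric]) (rule term_sum)
    also have "inverse (of_nat (Suc N)) * \<dots> =
        (\<Sum>i. inverse (of_nat (Suc N)) * (\<Sum>m<Suc N. c i * (w N m ^ i * inverse (w N m ^ j))))"
      by (rule suminf_mult[symmetric]) (rule summable_sum, rule term_sum)
    also have "\<dots> = (\<Sum>i. c i * \<mu> N i)"
      by (simp only: \<mu>_def sum_distrib_left mult_ac)
    finally show ?thesis .
  qed
  have \<mu>le: "norm (\<mu> N i) \<le> 1" for N i
  proof -
    have nw: "norm (w N m ^ i * inverse (w N m ^ j)) = 1" for m
      by (simp add: w_def norm_mult norm_inverse norm_power)
    have "norm (\<Sum>m<Suc N. w N m ^ i * inverse (w N m ^ j)) \<le> real (Suc N)"
      using sum_norm_le[of "{..<Suc N}" "\<lambda>m. w N m ^ i * inverse (w N m ^ j)" "\<lambda>_. 1"] nw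
      by (simp del: sum.lessThan_Suc)
    then show ?thesis
      by (simp add: \<mu>_def norm_mult norm_inverse norm_divide field_simps del: of_nat_Suc sum.lessThan_Suc)
  qed
  have \<mu>lim: "(\<lambda>N. \<mu> N i) \<longlonglongrightarrow> (if i = j then 1 else 0)" for i
  proof (rule tendsto_eventually)
    show "\<forall>\<^sub>F N in sequentially. \<mu> N i = (if i = j then 1 else 0)"
      using eventually_ge_at_top[of "max i j"]
    proof eventually_elim
      fix N assume "max i j \<le> N"
      then show "\<mu> N i = (if i = j then 1 else 0)"
        unfolding \<mu>_def w_def by (intro mean_root_of_unity_powers) auto
    qed
  qed
  have "(\<lambda>N. \<Sum>i. c i * \<mu> N i) \<longlonglongrightarrow> (\<Sum>i. c i * (if i = j then 1 else 0))"
  proof (rule conjunct2[OF conjunct2[OF tannerys_theorem]])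
    show "(\<lambda>N. c i * \<mu> N i) \<longlonglongrightarrow> c i * (if i = j then 1 else 0)" for i
      by (intro tendsto_mult tendsto_const \<mu>lim)
    show "\<forall>\<^sub>F (i, N) in at_top \<times>\<^sub>F sequentially. norm (c i * \<mu> N i) \<le> norm (c i)"
      using mult_left_mono[OF \<mu>le norm_ge_zero] by (intro always_eventually) (auto simp: norm_mult)
  qed (use sc in auto)
  also have "(\<Sum>i. c i * (if i = j then 1 else 0)) = c j"
    using sums_finite[of "{j}" "\<lambda>i. c i * (if i = j then 1 else 0)"] by (auto simp: sums_iff)
  also have "c j = a j" using r by (simp add: c_def)
  finally show ?thesis unfolding mean[symmetric] w_def a_def .
qed

context banach_seq
begin

lemma tendsto_scale:
  assumes mem: "eventually (\<lambda>s. v s \<in> carr Y) F" "x \<in> carr Y"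
    and c: "(c \<longlongrightarrow> d) F" and v: "((\<lambda>s. nrm Y (\<lambda>k. v s k - x k)) \<longlongrightarrow> 0) F"
  shows "((\<lambda>s. nrm Y (\<lambda>k. c s * v s k - d * x k)) \<longlongrightarrow> 0) F"
proof (rule Lim_null_comparison)
  show "\<forall>\<^sub>F s in F. norm (nrm Y (\<lambda>k. c s * v s k - d * x k))
      \<le> cmod (c s) * nrm Y (\<lambda>k. v s k - x k) + cmod (c s - d) * nrm Y x"
    using mem(1)
  proof eventually_elim
    fix s assume vs: "v s \<in> carr Y"
    have "(\<lambda>k. c s * v s k - d * x k) = (\<lambda>k. c s * (v s k - x k) + (c s - d) * x k)"
      by (auto simp: algebra_simps)
    then have "nrm Y (\<lambda>k. c s * v s k - d * x k) \<le> nrm Y (\<lambda>k. c s * (v s k - x k)) + nrm Y (\<lambda>k. (c s - d) * x k)"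
      using nrm_triangle[OF scale_mem[OF diff_mem[OF vs mem(2)]] scale_mem[OF mem(2)]] by metis
    moreover have "nrm Y (\<lambda>k. c s * (v s k - x k)) = cmod (c s) * nrm Y (\<lambda>k. v s k - x k)"
      by (rule nrm_scale[OF diff_mem[OF vs mem(2)]])
    moreover have "0 \<le> nrm Y (\<lambda>k. c s * v s k - d * x k)"
      by (intro nrm_nonneg diff_mem scale_mem vs mem)
    ultimately show "norm (nrm Y (\<lambda>k. c s * v s k - d * x k))
      \<le> cmod (c s) * nrm Y (\<lambda>k. v s k - x k) + cmod (c s - d) * nrm Y x"
      by (simp add: nrm_scale[OF mem(2)])
  qed
  have "((\<lambda>s. cmod (c s) * nrm Y (\<lambda>k. v s k - x k) + cmod (c s - d) * nrm Y x) \<longlongrightarrow>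
      cmod d * 0 + cmod (d - d) * nrm Y x) F"
    by (intro tendsto_intros c v)
  then show "((\<lambda>s. cmod (c s) * nrm Y (\<lambda>k. v s k - x k) + cmod (c s - d) * nrm Y x) \<longlongrightarrow> 0) F"
    by simp
qed

text \<open>Continuity into \<open>Y\<close> together with holomorphy of the coordinates already gives
  differentiability in \<open>Y\<close>.\<close>

definition holo_into :: "complex set \<Rightarrow> (complex \<Rightarrow> cseq) \<Rightarrow> bool" where
  "holo_into S f \<longleftrightarrow> open S \<and> (\<forall>z\<in>S. f z \<in> carr Y) \<and>
     (\<forall>z\<in>S. ((\<lambda>w. nrm Y (\<lambda>k. f w k - f z k)) \<longlongrightarrow> 0) (at z)) \<and>
     (\<forall>k. (\<lambda>z. f z k) holomorphic_on S)"

text \<open>Cauchy's estimate in norm: the coefficient is the coordinatewise limit of Riemann means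
  over the circle of radius \<open>r\<close>, and their integrand has norm at most
  \<open>M / r ^ j\<close>.\<close>

lemma
  assumes f: "holo_into S f" and S: "ball z0 R \<subseteq> S" and r: "0 < r" "r < R"
    and bd: "\<And>z. z \<in> cball z0 r \<Longrightarrow> nrm Y (f z) \<le> M"
  shows taylor_coeff_mem: "(\<lambda>k. taylor_coeff (\<lambda>z. f z k) j z0) \<in> carr Y"
    and nrm_taylor_coeff_le: "nrm Y (\<lambda>k. taylor_coeff (\<lambda>z. f z k) j z0) \<le> M / r ^ j"
proof -
  define \<gamma> where "\<gamma> = (\<lambda>t::real. z0 + of_real r * cis (2 * pi * t))"
  define c where "c = (\<lambda>t::real. inverse ((of_real r * cis (2 * pi * t)) ^ j))"
  define p where "p = (\<lambda>t k. c t * f (\<gamma> t) k)"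
  have \<gamma>: "\<gamma> t \<in> cball z0 r" "\<gamma> t \<in> S" for t
    using r S by (auto simp: \<gamma>_def dist_norm norm_mult)
  have fmem: "f (\<gamma> t) \<in> carr Y" for t using f \<gamma> by (auto simp: holo_into_def)
  have cn: "cmod (c t) = inverse (r ^ j)" for t
    using r by (simp add: c_def norm_inverse norm_power norm_mult)
  have contc: "isCont c t" for t
    unfolding c_def cis_conv_exp using r by (intro continuous_intros) auto
  have cont\<gamma>: "isCont \<gamma> t" for t unfolding \<gamma>_def cis_conv_exp by (intro continuous_intros)
  have *: "((\<lambda>s. nrm Y (\<lambda>k. f (\<gamma> s) k - f (\<gamma> t) k)) \<longlongrightarrow> 0) (at t within A)" for t A
  proof -
    define G where "G = (\<lambda>w. nrm Y (\<lambda>k. f w k - f (\<gamma> t) k))"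
    have "G \<midarrow>\<gamma> t\<rightarrow> 0" using f \<gamma> by (auto simp: holo_into_def G_def)
    then have "isCont G (\<gamma> t)" by (simp add: isCont_def G_def nrm_zero)
    then have "((\<lambda>s. G (\<gamma> s)) \<longlongrightarrow> G (\<gamma> t)) (at t within A)"
      by (rule isCont_tendsto_compose) (use cont\<gamma>[of t] in \<open>auto simp: continuous_at_imp_continuous_at_within simp flip: continuous_within\<close>)
    then show ?thesis by (simp add: G_def nrm_zero)
  qed
  have "(\<lambda>k. taylor_coeff (\<lambda>z. f z k) j z0) \<in> carr Y \<and>
    nrm Y (\<lambda>k. taylor_coeff (\<lambda>z. f z k) j z0) \<le> M / r ^ j"
  proof (intro conjI; rule riemann_mean_limit)
    show "p t \<in> carr Y" for t unfolding p_def by (intro scale_mem fmem)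
    show "nrm Y (p t) \<le> M / r ^ j" for t
      unfolding p_def nrm_scale[OF fmem] cn
      using mult_left_mono[OF bd[OF \<gamma>(1)], of "inverse (r ^ j)"] r by (simp add: divide_inverse mult.commute)
    then show "nrm Y (p t) \<le> M / r ^ j" for t .
    show "((\<lambda>s. nrm Y (\<lambda>k. p s k - p t k)) \<longlongrightarrow> 0) (at t within {0..1})" for t
      unfolding p_def using contc[of t]
      by (intro tendsto_scale * always_eventually allI fmem)
         (simp add: continuous_at_imp_continuous_at_within flip: continuous_within)
    then show "((\<lambda>s. nrm Y (\<lambda>k. p s k - p t k)) \<longlongrightarrow> 0) (at t within {0..1})" for t .
    show "(\<lambda>N. inverse (of_nat (Suc N)) * (\<Sum>m<Suc N. p (real m / real (Suc N)) k))
      \<longlonglongrightarrow> taylor_coeff (\<lambda>z. f z k) j z0" for k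
    proof -
      have "(\<lambda>z. f z k) holomorphic_on ball z0 R"
        using f S by (auto simp: holo_into_def intro: holomorphic_on_subset)
      from taylor_coeff_as_limit_of_means[OF this r, of j] show ?thesis
        by (simp only: p_def c_def \<gamma>_def)
    qed
    then show "(\<lambda>N. inverse (of_nat (Suc N)) * (\<Sum>m<Suc N. p (real m / real (Suc N)) k))
      \<longlonglongrightarrow> taylor_coeff (\<lambda>z. f z k) j z0" for k .
    show "p t \<in> carr Y" for t unfolding p_def by (intro scale_mem fmem)
  qed
  then show "(\<lambda>k. taylor_coeff (\<lambda>z. f z k) j z0) \<in> carr Y"
    "nrm Y (\<lambda>k. taylor_coeff (\<lambda>z. f z k) j z0) \<le> M / r ^ j" by auto
qed

end

section \<open>Differentiability in norm\<close>

lemma taylor_coeff_deriv: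
  "taylor_coeff (deriv F) i z = of_nat (Suc i) * taylor_coeff F (Suc i) z"
  by (simp add: taylor_coeff_def funpow_swap1 field_simps del: of_nat_Suc)

context banach_seq
begin

lemma nrm_tendsto_0_linear:
  assumes "eventually (\<lambda>w. v w \<in> carr Y \<and> nrm Y (v w) \<le> C * cmod (w - z)) (at z)"
  shows "((\<lambda>w. nrm Y (v w)) \<longlongrightarrow> 0) (at z)"
proof (rule Lim_null_comparison)
  show "\<forall>\<^sub>F w in at z. norm (nrm Y (v w)) \<le> C * cmod (w - z)"
    using assms by eventually_elim (auto simp: nrm_nonneg)
  have "((\<lambda>w. C * cmod (w - z)) \<longlongrightarrow> C * cmod (z - z)) (at z)" by (intro tendsto_intros)
  then show "((\<lambda>w. C * cmod (w - z)) \<longlongrightarrow> 0) (at z)" by simp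
qed

lemma
  assumes "\<And>i. u i \<in> carr Y" "\<And>i. nrm Y (u i) \<le> K * c i" "summable c"
  shows dominated_series_mem: "(\<lambda>k. \<Sum>i. u i k) \<in> carr Y"
    and nrm_dominated_series_le: "nrm Y (\<lambda>k. \<Sum>i. u i k) \<le> K * suminf c"
proof -
  have "summable (\<lambda>i. K * c i)" using assms(3) by (rule summable_mult)
  moreover from this have s: "summable (\<lambda>i. nrm Y (u i))"
    by (rule summable_comparison_test'[of _ 0]) (use assms nrm_nonneg in auto)
  ultimately have "(\<Sum>i. nrm Y (u i)) \<le> K * suminf c"
    using suminf_le[of "\<lambda>i. nrm Y (u i)" "\<lambda>i. K * c i"] assms(2) suminf_mult[OF assms(3), of K] by simp
  then show "(\<lambda>k. \<Sum>i. u i k) \<in> carr Y" "nrm Y (\<lambda>k. \<Sum>i. u i k) \<le> K * suminf c"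
    using series_mem[of u, OF assms(1) s] nrm_series_le[of u, OF assms(1) s] by simp_all
qed

text \<open>In terms of \<open>x = w - z0\<close> both quantities are power series without constant
  term, with coefficients \<open>a (i + 2)\<close> of norm at most \<open>M / r ^ (i + 2)\<close>.
  For \<open>x\<close> of modulus at most \<open>r / 2\<close> they are dominated by
  \<open>cmod x\<close> times a convergent series, hence tend to 0 linearly.\<close>

lemma
  assumes f: "holo_into S f" and z0: "z0 \<in> S"
  shows holo_into_has_deriv: "has_deriv_in Y f (\<lambda>k. deriv (\<lambda>z. f z k) z0) z0"
    and holo_into_deriv_continuous:
      "((\<lambda>w. nrm Y (\<lambda>k. deriv (\<lambda>z. f z k) w - deriv (\<lambda>z. f z k) z0)) \<longlongrightarrow> 0) (at z0)"
proof -
  have S: "open S" and holo: "\<And>k. (\<lambda>z. f z k) holomorphic_on S"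
    and mem: "\<And>z. z \<in> S \<Longrightarrow> f z \<in> carr Y"
    and cont: "((\<lambda>w. nrm Y (\<lambda>k. f w k - f z0 k)) \<longlongrightarrow> 0) (at z0)"
    using f z0 by (auto simp: holo_into_def)
  obtain R where R: "R > 0" "ball z0 R \<subseteq> S" using S z0 open_contains_ball by blast
  have "eventually (\<lambda>w. nrm Y (\<lambda>k. f w k - f z0 k) < 1) (at z0)"
    using order_tendstoD(2)[OF cont] by simp
  then obtain d where d: "d > 0" "\<And>w. w \<noteq> z0 \<Longrightarrow> dist w z0 < d \<Longrightarrow> nrm Y (\<lambda>k. f w k - f z0 k) < 1"
    by (auto simp: eventually_at)
  define r where "r = min (R/2) (d/2)"
  have r: "0 < r" "r < R" "r < d" using R d by (auto simp: r_def)
  \<comment> \<open>Continuity at the single point \<open>z0\<close> already bounds \<open>f\<close>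
    on a small closed disk, which is all that Cauchy's estimate asks for.\<close>
  define M where "M = nrm Y (f z0) + 1"
  have M: "nrm Y (f w) \<le> M" if w: "w \<in> cball z0 r" for w
  proof (cases "w = z0")
    case False
    have wS: "w \<in> S" using w R r by (auto simp: subset_iff)
    have "nrm Y (\<lambda>k. (f w k - f z0 k) + f z0 k) \<le> nrm Y (\<lambda>k. f w k - f z0 k) + nrm Y (f z0)"
      by (intro nrm_triangle diff_mem mem wS z0)
    moreover have "nrm Y (\<lambda>k. f w k - f z0 k) < 1"
      using False w r by (intro d(2)) (auto simp: dist_commute)
    ultimately show ?thesis by (simp add: M_def)
  qed (simp add: M_def)
  define a where "a = (\<lambda>i k. taylor_coeff (\<lambda>z. f z k) i z0)"
  have a: "a i \<in> carr Y" "nrm Y (a i) \<le> M / r ^ i" for i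
    unfolding a_def
    by (rule taylor_coeff_mem[OF f R(2) r(1,2) M], assumption, rule nrm_taylor_coeff_le[OF f R(2) r(1,2) M], assumption)
  have M0: "0 \<le> M" using nrm_nonneg[OF mem[OF z0]] by (simp add: M_def)
  have a01: "a 0 k = f z0 k" "a (Suc 0) k = deriv (\<lambda>z. f z k) z0" for k
    by (simp_all add: a_def taylor_coeff_def)
  define K where "K = M / r\<^sup>2"
  \<comment> \<open>The factor \<delta> serves both claims: it is 1 for the difference quotient and
    \<open>i + 2\<close> for the termwise differentiated series.\<close>
  have ub: "nrm Y (\<lambda>k. (\<delta> * x ^ Suc i) * a (i + 2) k) \<le> (K * cmod x) * (cmod \<delta> * (1/2) ^ i)"
    if x: "cmod x \<le> r/2" for x \<delta> i
  proof -
    have "cmod x ^ i * inverse (r ^ i) \<le> (r/2) ^ i * inverse (r ^ i)"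
      using x r by (intro mult_right_mono power_mono) auto
    also have "\<dots> = (1/2) ^ i" using r by (simp add: power_divide)
    finally have *: "cmod x ^ i * inverse (r ^ i) \<le> (1/2) ^ i" .
    have "nrm Y (\<lambda>k. (\<delta> * x ^ Suc i) * a (i + 2) k) = cmod (\<delta> * x ^ Suc i) * nrm Y (a (i + 2))"
      by (rule nrm_scale[OF a(1)])
    also have "\<dots> \<le> cmod (\<delta> * x ^ Suc i) * (M / r ^ (i + 2))" by (intro mult_left_mono a) auto
    also have "\<dots> = (K * cmod x * cmod \<delta>) * (cmod x ^ i * inverse (r ^ i))"
      using r by (simp add: norm_mult norm_power K_def power_add power2_eq_square divide_inverse mult_ac)
    also have "\<dots> \<le> (K * cmod x * cmod \<delta>) * (1/2) ^ i"
      using M0 by (intro mult_left_mono * mult_nonneg_nonneg) (auto simp: K_def)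
    finally show ?thesis by (simp add: mult.assoc)
  qed
  have near: "\<forall>\<^sub>F w in at z0. w \<noteq> z0 \<and> cmod (w - z0) \<le> r/2"
    using r by (auto simp: eventually_at dist_norm intro!: exI[of _ "r/2"])
  have ball: "w \<in> ball z0 R" if "cmod (w - z0) \<le> r/2" for w
    using that r by (simp add: dist_norm norm_minus_commute)
  have holoR: "(\<lambda>z. f z k) holomorphic_on ball z0 R" for k
    using holo R(2) by (rule holomorphic_on_subset)
  show "has_deriv_in Y f (\<lambda>k. deriv (\<lambda>z. f z k) z0) z0"
    unfolding has_deriv_in_def
  proof
    show "(\<lambda>k. deriv (\<lambda>z. f z k) z0) \<in> carr Y" using a(1)[of "Suc 0"] ext[of "a (Suc 0)", OF a01(2)] by simp
    have bound: "(\<lambda>k. (f w k - f z0 k) / (w - z0) - deriv (\<lambda>z. f z k) z0) \<in> carr Y \<and>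
      nrm Y (\<lambda>k. (f w k - f z0 k) / (w - z0) - deriv (\<lambda>z. f z k) z0) \<le> (2 * K) * cmod (w - z0)"
      if w: "w \<noteq> z0 \<and> cmod (w - z0) \<le> r/2" for w
    proof -
      define x where "x = w - z0"
      have x: "x \<noteq> 0" "cmod x \<le> r/2" using w by (auto simp: x_def)
      have eq: "(\<Sum>i. (1 * x ^ Suc i) * a (i + 2) k) = (f w k - f z0 k) / x - deriv (\<lambda>z. f z k) z0" for k
      proof -
        have "(\<lambda>i. a i k * x ^ i) sums f w k"
          using holomorphic_power_series[OF holoR[of k] ball[of w]] w by (simp add: a_def taylor_coeff_def x_def)
        then have "(\<lambda>i. a (i + 2) k * x ^ (i + 2)) sums (f w k - (\<Sum>i<2. a i k * x ^ i))"
          by (subst sums_iff_shift) simp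
        from sums_divide[OF this, of x]
        have "(\<lambda>i. (1 * x ^ Suc i) * a (i + 2) k) sums ((f w k - (\<Sum>i<2. a i k * x ^ i)) / x)"
          using x(1) by (simp add: mult_ac)
        moreover have "(\<Sum>i<2. a i k * x ^ i) = f z0 k + deriv (\<lambda>z. f z k) z0 * x"
          by (simp add: numeral_2_eq_2 a01)
        then have "(f w k - (\<Sum>i<2. a i k * x ^ i)) / x = (f w k - f z0 k) / x - deriv (\<lambda>z. f z k) z0"
          using x(1) by (simp add: divide_simps)
        ultimately show ?thesis by (simp add: sums_iff)
      qed
      have "(\<lambda>k. \<Sum>i. (1 * x ^ Suc i) * a (i + 2) k) \<in> carr Y"
        "nrm Y (\<lambda>k. \<Sum>i. (1 * x ^ Suc i) * a (i + 2) k) \<le> K * cmod x * (\<Sum>i. cmod 1 * (1/2) ^ i)"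
        by (rule dominated_series_mem[OF scale_mem[OF a(1)] ub[OF x(2), of 1]], simp add: summable_geometric)
           (rule nrm_dominated_series_le[OF scale_mem[OF a(1)] ub[OF x(2), of 1]], simp add: summable_geometric)
      moreover have "(\<Sum>i. cmod 1 * (1/2) ^ i) = (2::real)" by (simp add: suminf_geometric)
      ultimately show ?thesis unfolding eq by (simp add: x_def mult_ac)
    qed
    show "((\<lambda>w. nrm Y (\<lambda>k. (f w k - f z0 k) / (w - z0) - deriv (\<lambda>z. f z k) z0)) \<longlongrightarrow> 0) (at z0)"
      by (rule nrm_tendsto_0_linear[OF eventually_mono[OF near bound]])
  qed
  \<comment> \<open>The weight \<open>i + 2\<close> is split as \<open>Suc i + 1\<close>; the first
    part is the differentiated geometric series.\<close>
  have sm: "summable (\<lambda>i. cmod (of_nat (i + 2)) * (1/2) ^ i)"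
  proof -
    have "summable (\<lambda>n. diffs (\<lambda>n. 1::real) n * (1/2) ^ n)"
      by (rule termdiff_converges[of _ 1]) (auto intro: summable_geometric)
    then have "summable (\<lambda>n. real (Suc n) * (1/2) ^ n + (1/2) ^ n)"
      by (intro summable_add) (auto simp: diffs_def intro: summable_geometric)
    moreover have "cmod (of_nat (i + 2)) * (1/2) ^ i = real (Suc i) * (1/2) ^ i + (1/2) ^ i" for i
      unfolding norm_of_nat by (simp add: algebra_simps)
    ultimately show ?thesis by simp
  qed
  define C where "C = (\<Sum>i. cmod (of_nat (i + 2)) * (1/2) ^ i)"
  have bound: "(\<lambda>k. deriv (\<lambda>z. f z k) w - deriv (\<lambda>z. f z k) z0) \<in> carr Y \<and>
      nrm Y (\<lambda>k. deriv (\<lambda>z. f z k) w - deriv (\<lambda>z. f z k) z0) \<le> (C * K) * cmod (w - z0)"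
    if w: "w \<noteq> z0 \<and> cmod (w - z0) \<le> r/2" for w
  proof -
    define x where "x = w - z0"
    have x: "cmod x \<le> r/2" using w by (auto simp: x_def)
    have eq: "(\<Sum>i. (of_nat (i + 2) * x ^ Suc i) * a (i + 2) k) = deriv (\<lambda>z. f z k) w - deriv (\<lambda>z. f z k) z0" for k
    proof -
      have "deriv (\<lambda>z. f z k) holomorphic_on ball z0 R" by (intro holomorphic_deriv holoR) auto
      from holomorphic_power_series[OF this ball[of w]]
      have "(\<lambda>i. of_nat (Suc i) * a (Suc i) k * x ^ i) sums deriv (\<lambda>z. f z k) w"
        using w unfolding taylor_coeff_def[symmetric] taylor_coeff_deriv by (simp add: a_def x_def)
      then have "(\<lambda>i. of_nat (Suc (Suc i)) * a (Suc (Suc i)) k * x ^ Suc i) sums (deriv (\<lambda>z. f z k) w - a (Suc 0) k)"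
        by (subst sums_Suc_iff) simp
      then show ?thesis by (simp add: sums_iff a01 mult_ac)
    qed
    have "(\<lambda>k. \<Sum>i. (of_nat (i + 2) * x ^ Suc i) * a (i + 2) k) \<in> carr Y"
      "nrm Y (\<lambda>k. \<Sum>i. (of_nat (i + 2) * x ^ Suc i) * a (i + 2) k) \<le> K * cmod x * C"
      unfolding C_def using dominated_series_mem[OF scale_mem[OF a(1)] ub[OF x] sm]
        nrm_dominated_series_le[OF scale_mem[OF a(1)] ub[OF x] sm] by auto
    then show ?thesis unfolding eq by (simp add: x_def mult_ac)
  qed
  show "((\<lambda>w. nrm Y (\<lambda>k. deriv (\<lambda>z. f z k) w - deriv (\<lambda>z. f z k) z0)) \<longlongrightarrow> 0) (at z0)"
    by (rule nrm_tendsto_0_linear[OF eventually_mono[OF near bound]])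
qed

lemma holo_into_deriv:
  assumes f: "holo_into S f"
  shows "holo_into S (\<lambda>z k. deriv (\<lambda>z. f z k) z)"
  unfolding holo_into_def
proof (intro conjI ballI allI)
  show "(\<lambda>k. deriv (\<lambda>z. f z k) z) \<in> carr Y" if "z \<in> S" for z
    using holo_into_has_deriv[OF f that] by (simp add: has_deriv_in_def)
  show "(\<lambda>z. deriv (\<lambda>z. f z k) z) holomorphic_on S" for k
    using f by (intro holomorphic_deriv) (auto simp: holo_into_def)
  show "((\<lambda>w. nrm Y (\<lambda>k. deriv (\<lambda>z. f z k) w - deriv (\<lambda>z. f z k) z)) \<longlongrightarrow> 0) (at z)" if "z \<in> S" for z
    by (rule holo_into_deriv_continuous[OF f that])
  show "open S" using f by (simp add: holo_into_def)
qed

lemma has_deriv_in_coord: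
  assumes S: "open S" "z \<in> S" and mem: "\<And>w. w \<in> S \<Longrightarrow> f w \<in> carr Y" and d: "has_deriv_in Y f d z"
  shows "((\<lambda>w. f w k) has_field_derivative d k) (at z)"
proof -
  have "((\<lambda>w. (f w k - f z k) / (w - z) - d k) \<longlongrightarrow> 0) (at z)"
  proof (rule coord_continuous)
    have "eventually (\<lambda>w. w \<in> S) (at z)" using S by (rule eventually_at_in_open')
    then show "\<forall>\<^sub>F w in at z. (\<lambda>k. (f w k - f z k) / (w - z) - d k) \<in> carr Y"
    proof eventually_elim
      fix w assume "w \<in> S"
      then have "(\<lambda>k. inverse (w - z) * (f w k - f z k) - d k) \<in> carr Y"
        using d S mem by (intro diff_mem scale_mem) (auto simp: has_deriv_in_def)
      then show "(\<lambda>k. (f w k - f z k) / (w - z) - d k) \<in> carr Y" by (simp add: divide_inverse mult.commute)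
    qed
  qed (use d in \<open>simp add: has_deriv_in_def\<close>)
  then have "((\<lambda>w. (f w k - f z k) / (w - z)) \<longlongrightarrow> d k) (at z)" by (simp add: Lim_null[symmetric])
  then show ?thesis by (simp add: has_field_derivative_iff)
qed

text \<open>Derivatives in norm are unique because their coordinates are, so the definite
  description in \<open>deriv_in\<close> denotes. Agreement of \<open>g\<close> with
  \<open>f\<close> is asked on \<open>S\<close> only, since an iterated \<open>deriv_in\<close> is
  known only there.\<close>

lemma deriv_in_eq:
  assumes f: "holo_into S f" and z: "z \<in> S" and g: "\<And>w. w \<in> S \<Longrightarrow> g w = f w"
  shows "deriv_in Y g z = (\<lambda>k. deriv (\<lambda>z. f z k) z)"
proof -
  have S: "open S" and mem: "\<And>z. z \<in> S \<Longrightarrow> g z \<in> carr Y"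
    using f g by (auto simp: holo_into_def)
  have ev: "\<forall>\<^sub>F w in at z. nrm Y (\<lambda>k. (f w k - f z k) / (w - z) - d k) = nrm Y (\<lambda>k. (g w k - g z k) / (w - z) - d k)" for d
    using eventually_at_in_open'[OF S z] by eventually_elim (simp add: g z)
  have iff: "has_deriv_in Y g d z \<longleftrightarrow> has_deriv_in Y f d z" for d
    unfolding has_deriv_in_def tendsto_cong[OF ev[of d]] ..
  show ?thesis
    unfolding deriv_in_def
  proof (rule the_equality)
    show 1: "has_deriv_in Y g (\<lambda>k. deriv (\<lambda>z. f z k) z) z"
      unfolding iff by (rule holo_into_has_deriv[OF f z])
    fix d assume "has_deriv_in Y g d z"
    then show "d = (\<lambda>k. deriv (\<lambda>z. f z k) z)"
      by (intro ext DERIV_unique[OF has_deriv_in_coord[OF S z mem] has_deriv_in_coord[OF S z mem 1]])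
  qed
qed

lemma
  assumes f: "holo_into S f"
  shows holo_into_higher_deriv: "holo_into S (\<lambda>z k. (deriv ^^ j) (\<lambda>z. f z k) z)"
    and higher_deriv_in: "z \<in> S \<Longrightarrow> (deriv_in Y ^^ j) f z = (\<lambda>k. (deriv ^^ j) (\<lambda>z. f z k) z)"
proof (induction j arbitrary: z)
  case 0
  {
    case 1 then show ?case using f by simp
  next
    case 2 then show ?case by simp
  }
next
  case (Suc j)
  {
    case 1 show ?case using holo_into_deriv[OF Suc.IH(1)] by simp
  next
    case 2
    then show ?case using deriv_in_eq[OF Suc.IH(1) 2, of "(deriv_in Y ^^ j) f"] Suc.IH(2) by simp
  }
qed

text \<open>From here on Taylor coefficients in a sequence space can be computed coordinate by
  coordinate, so scalar complex analysis applies to them.\<close>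

lemma
  assumes f: "holo_into S f" and z: "z \<in> S"
  shows taylor_coeff_in_eq: "taylor_coeff_in Y f j z = (\<lambda>k. taylor_coeff (\<lambda>z. f z k) j z)"
    and taylor_coeff_in_mem: "taylor_coeff_in Y f j z \<in> carr Y"
proof -
  show eq: "taylor_coeff_in Y f j z = (\<lambda>k. taylor_coeff (\<lambda>z. f z k) j z)"
    by (simp add: taylor_coeff_in_def taylor_coeff_def higher_deriv_in[OF f z])
  have "(\<lambda>k. (deriv ^^ j) (\<lambda>z. f z k) z) \<in> carr Y"
    using holo_into_higher_deriv[OF f] z by (auto simp: holo_into_def)
  from scale_mem[OF this, of "inverse (fact j)"] show "taylor_coeff_in Y f j z \<in> carr Y"
    unfolding eq taylor_coeff_def by (simp add: divide_inverse mult.commute)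
qed

end

section \<open>The spaces of the couple\<close>

lemma (in banach_seq) coord_summable:
  assumes "\<And>n. u n \<in> carr Y" "summable (\<lambda>n. nrm Y (u n))"
  shows "summable (\<lambda>n. u n k)"
proof -
  obtain C where C: "\<And>x. x \<in> carr Y \<Longrightarrow> cmod (x k) \<le> C * nrm Y x" using coord_bound by blast
  show ?thesis
    by (rule summable_comparison_test'[OF summable_mult[OF assms(2), of C], of 0]) (use C assms in auto)
qed

section \<open>The sum of a couple\<close>

lemma sums_halves: "(\<lambda>n. \<delta> * (1/2) ^ Suc n) sums (\<delta> :: real)"
  using sums_mult[OF power_half_series, of \<delta>] by simp

locale banach_couple = X0: banach_seq X0 + X1: banach_seq X1 for X0 X1
begin

lemma carr_sum_space: "x \<in> carr (sum_space X0 X1) \<longleftrightarrow>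
    (\<exists>a\<in>carr X0. \<exists>b\<in>carr X1. x = (\<lambda>k. a k + b k))"
  by (simp add: sum_space_def)

lemma nrm_sum_space: "nrm (sum_space X0 X1) x = Inf {nrm X0 a + nrm X1 b | a b.
    a \<in> carr X0 \<and> b \<in> carr X1 \<and> x = (\<lambda>k. a k + b k)}"
  by (simp add: sum_space_def)

lemma nrm_sum_space_le:
  assumes "a \<in> carr X0" "b \<in> carr X1"
  shows "nrm (sum_space X0 X1) (\<lambda>k. a k + b k) \<le> nrm X0 a + nrm X1 b"
  unfolding nrm_sum_space
proof (rule cInf_lower)
  show "bdd_below {nrm X0 a' + nrm X1 b' | a' b'. a' \<in> carr X0 \<and> b' \<in> carr X1 \<and>
      (\<lambda>k. a k + b k) = (\<lambda>k. a' k + b' k)}"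
    by (intro bdd_belowI[of _ 0]) (auto intro: add_nonneg_nonneg X0.nrm_nonneg X1.nrm_nonneg)
qed (use assms in blast)

lemma sum_space_decomposition:
  assumes "x \<in> carr (sum_space X0 X1)" "nrm (sum_space X0 X1) x < R"
  obtains a b where "a \<in> carr X0" "b \<in> carr X1" "x = (\<lambda>k. a k + b k)" "nrm X0 a + nrm X1 b < R"
proof -
  have "{nrm X0 a + nrm X1 b | a b. a \<in> carr X0 \<and> b \<in> carr X1 \<and> x = (\<lambda>k. a k + b k)} \<noteq> {}"
    using assms(1) unfolding carr_sum_space by blast
  from cInf_lessD[OF this] assms(2) show ?thesis
    unfolding nrm_sum_space using that by blast
qed

lemma nrm_sum_space_nonneg:
  assumes "x \<in> carr (sum_space X0 X1)"
  shows "0 \<le> nrm (sum_space X0 X1) x"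
proof (rule ccontr)
  assume "\<not> ?thesis"
  then obtain a b where "a \<in> carr X0" "b \<in> carr X1" "nrm X0 a + nrm X1 b < 0"
    using sum_space_decomposition[OF assms, of 0] by (metis not_le)
  then show False using X0.nrm_nonneg[of a] X1.nrm_nonneg[of b] by simp
qed

text \<open>Each term is decomposed up to a slack \<open>\<delta> * (1/2) ^ Suc n\<close>, and the
  two families of parts are summed separately in \<open>X0\<close> and \<open>X1\<close>. The slacks
  add up to \<delta>, whence a bound by any \<open>R\<close> above the sum of the norms; letting
  \<open>R\<close> decrease gives the sharp inequality afterwards.\<close>

lemma sum_space_series:
  assumes u: "\<And>n. u n \<in> carr (sum_space X0 X1)" and s: "summable (\<lambda>n. nrm (sum_space X0 X1) (u n))"
    and R: "(\<Sum>n. nrm (sum_space X0 X1) (u n)) < R"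
  shows "(\<lambda>k. \<Sum>n. u n k) \<in> carr (sum_space X0 X1)" "nrm (sum_space X0 X1) (\<lambda>k. \<Sum>n. u n k) \<le> R"
proof -
  define \<delta> where "\<delta> = R - (\<Sum>n. nrm (sum_space X0 X1) (u n))"
  have \<delta>: "\<delta> > 0" using R by (simp add: \<delta>_def)
  have ex: "\<exists>a b. a \<in> carr X0 \<and> b \<in> carr X1 \<and> u n = (\<lambda>k. a k + b k) \<and>
      nrm X0 a + nrm X1 b < nrm (sum_space X0 X1) (u n) + \<delta> * (1/2) ^ Suc n" for n
  proof -
    have "nrm (sum_space X0 X1) (u n) < nrm (sum_space X0 X1) (u n) + \<delta> * (1/2) ^ Suc n"
      using \<delta> by simp
    then show ?thesis by (rule sum_space_decomposition[OF u]) blast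
  qed
  obtain a where a: "\<forall>n. \<exists>b. a n \<in> carr X0 \<and> b \<in> carr X1 \<and> u n = (\<lambda>k. a n k + b k) \<and>
      nrm X0 (a n) + nrm X1 b < nrm (sum_space X0 X1) (u n) + \<delta> * (1/2) ^ Suc n"
    using choice[OF allI[OF ex]] by (rule exE)
  obtain b where "\<forall>n. a n \<in> carr X0 \<and> b n \<in> carr X1 \<and> u n = (\<lambda>k. a n k + b n k) \<and>
      nrm X0 (a n) + nrm X1 (b n) < nrm (sum_space X0 X1) (u n) + \<delta> * (1/2) ^ Suc n"
    using choice[OF a] by (rule exE)
  then have ab: "\<And>n. a n \<in> carr X0" "\<And>n. b n \<in> carr X1" "\<And>n. u n = (\<lambda>k. a n k + b n k)"
    "\<And>n. nrm X0 (a n) + nrm X1 (b n) < nrm (sum_space X0 X1) (u n) + \<delta> * (1/2) ^ Suc n"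
    by blast+
  have sR: "(\<lambda>n. nrm (sum_space X0 X1) (u n) + \<delta> * (1/2) ^ Suc n) sums R"
    using sums_add[OF summable_sums[OF s] sums_halves[of \<delta>]] by (simp add: \<delta>_def)
  have nn: "0 \<le> nrm X0 (a n)" "0 \<le> nrm X1 (b n)" for n
    using ab X0.nrm_nonneg X1.nrm_nonneg by auto
  have le: "norm (nrm X0 (a n)) \<le> nrm (sum_space X0 X1) (u n) + \<delta> * (1/2) ^ Suc n"
    "norm (nrm X1 (b n)) \<le> nrm (sum_space X0 X1) (u n) + \<delta> * (1/2) ^ Suc n" for n
    using ab(4)[of n] nn[of n] by auto
  have sa: "summable (\<lambda>n. nrm X0 (a n))"
    by (rule summable_comparison_test'[OF sums_summable[OF sR]]) (rule le(1))
  have sb: "summable (\<lambda>n. nrm X1 (b n))"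
    by (rule summable_comparison_test'[OF sums_summable[OF sR]]) (rule le(2))
  have "(\<Sum>n. nrm X0 (a n)) + (\<Sum>n. nrm X1 (b n)) \<le> R"
    unfolding suminf_add[OF sa sb] sums_unique[OF sR]
    by (rule suminf_le[OF _ summable_add[OF sa sb] sums_summable[OF sR]]) (rule less_imp_le[OF ab(4)])
  moreover have eq: "(\<lambda>k. \<Sum>n. u n k) = (\<lambda>k. (\<Sum>n. a n k) + (\<Sum>n. b n k))"
    using suminf_add[OF X0.coord_summable[of a, OF ab(1) sa] X1.coord_summable[of b, OF ab(2) sb]]
    by (simp add: ab(3))
  moreover have A: "(\<lambda>k. \<Sum>n. a n k) \<in> carr X0" "(\<lambda>k. \<Sum>n. b n k) \<in> carr X1"
    "nrm X0 (\<lambda>k. \<Sum>n. a n k) \<le> (\<Sum>n. nrm X0 (a n))" "nrm X1 (\<lambda>k. \<Sum>n. b n k) \<le> (\<Sum>n. nrm X1 (b n))"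
    using X0.series_mem[of a, OF ab(1) sa] X1.series_mem[of b, OF ab(2) sb]
      X0.nrm_series_le[of a, OF ab(1) sa] X1.nrm_series_le[of b, OF ab(2) sb] by auto
  ultimately show "nrm (sum_space X0 X1) (\<lambda>k. \<Sum>n. u n k) \<le> R"
    using nrm_sum_space_le[OF A(1,2)] by (simp only: eq)
  show "(\<lambda>k. \<Sum>n. u n k) \<in> carr (sum_space X0 X1)"
    unfolding carr_sum_space eq
    by (rule bexI[of _ "\<lambda>k. \<Sum>n. a n k"], rule bexI[of _ "\<lambda>k. \<Sum>n. b n k"], rule refl) (rule A)+
qed

sublocale sum: banach_seq "sum_space X0 X1"
proof
  show "(\<lambda>_. 0) \<in> carr (sum_space X0 X1)"
    unfolding carr_sum_space by (rule bexI[OF bexI[OF _ X1.zero_mem] X0.zero_mem]) simp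
  show "0 \<le> nrm (sum_space X0 X1) x" if "x \<in> carr (sum_space X0 X1)" for x
    by (rule nrm_sum_space_nonneg[OF that])
  show scale: "(\<lambda>k. c * x k) \<in> carr (sum_space X0 X1)" if "x \<in> carr (sum_space X0 X1)" for x c
  proof -
    obtain a b where "a \<in> carr X0" "b \<in> carr X1" "x = (\<lambda>k. a k + b k)"
      using \<open>x \<in> _\<close> unfolding carr_sum_space by blast
    then show ?thesis unfolding carr_sum_space
      by (intro bexI[of _ "\<lambda>k. c * a k"] bexI[of _ "\<lambda>k. c * b k"])
         (auto simp: distrib_left X0.scale_mem X1.scale_mem)
  qed
  show "nrm (sum_space X0 X1) (\<lambda>k. c * x k) \<le> cmod c * nrm (sum_space X0 X1) x"
    if x: "x \<in> carr (sum_space X0 X1)" for x c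
  proof (rule field_le_epsilon)
    fix e :: real assume "e > 0"
    then have "nrm (sum_space X0 X1) x < nrm (sum_space X0 X1) x + e / (cmod c + 1)"
      by (simp add: add_nonneg_pos)
    then obtain a b where ab: "a \<in> carr X0" "b \<in> carr X1" "x = (\<lambda>k. a k + b k)"
      "nrm X0 a + nrm X1 b < nrm (sum_space X0 X1) x + e / (cmod c + 1)"
      by (rule sum_space_decomposition[OF x])
    have "nrm (sum_space X0 X1) (\<lambda>k. c * x k) = nrm (sum_space X0 X1) (\<lambda>k. c * a k + c * b k)"
      by (simp add: ab(3) distrib_left)
    also have "\<dots> \<le> nrm X0 (\<lambda>k. c * a k) + nrm X1 (\<lambda>k. c * b k)"
      by (intro nrm_sum_space_le X0.scale_mem X1.scale_mem ab)
    also have "\<dots> = cmod c * (nrm X0 a + nrm X1 b)"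
      by (simp add: X0.nrm_scale X1.nrm_scale ab distrib_left)
    also have "\<dots> \<le> cmod c * (nrm (sum_space X0 X1) x + e / (cmod c + 1))"
      using ab(4) by (intro mult_left_mono) auto
    also have "\<dots> \<le> cmod c * nrm (sum_space X0 X1) x + e"
    proof -
      have "cmod c * (e / (cmod c + 1)) \<le> e"
        using \<open>e > 0\<close> by (simp add: divide_simps add_nonneg_pos)
      then show ?thesis by (simp add: distrib_left)
    qed
    finally show "nrm (sum_space X0 X1) (\<lambda>k. c * x k) \<le> cmod c * nrm (sum_space X0 X1) x + e" .
  qed
  show "\<exists>C. \<forall>x\<in>carr (sum_space X0 X1). cmod (x k) \<le> C * nrm (sum_space X0 X1) x" for k
  proof -
    obtain C0 where C0: "\<And>x. x \<in> carr X0 \<Longrightarrow> cmod (x k) \<le> C0 * nrm X0 x" using X0.coord_bound by blast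
    obtain C1 where C1: "\<And>x. x \<in> carr X1 \<Longrightarrow> cmod (x k) \<le> C1 * nrm X1 x" using X1.coord_bound by blast
    define C where "C = max 1 (max C0 C1)"
    show ?thesis
    proof (intro exI[of _ C] ballI)
      fix x assume x: "x \<in> carr (sum_space X0 X1)"
      have "cmod (x k) / C \<le> nrm (sum_space X0 X1) x"
      proof (rule dense_ge)
        fix R assume "nrm (sum_space X0 X1) x < R"
        then obtain a b where ab: "a \<in> carr X0" "b \<in> carr X1" "x = (\<lambda>k. a k + b k)" "nrm X0 a + nrm X1 b < R"
          using sum_space_decomposition[OF x] by metis
        have "cmod (a k) \<le> C * nrm X0 a"
          by (rule order_trans[OF C0[OF ab(1)] mult_right_mono]) (auto simp: C_def X0.nrm_nonneg ab)
        moreover have "cmod (b k) \<le> C * nrm X1 b"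
          by (rule order_trans[OF C1[OF ab(2)] mult_right_mono]) (auto simp: C_def X1.nrm_nonneg ab)
        ultimately have "cmod (x k) \<le> C * (nrm X0 a + nrm X1 b)"
          unfolding ab(3) distrib_left using norm_triangle_ineq[of "a k" "b k"] by linarith
        also have "\<dots> \<le> C * R" using ab(4) by (intro mult_left_mono) (auto simp: C_def)
        finally show "cmod (x k) / C \<le> R" by (simp add: C_def divide_simps mult.commute)
      qed
      then show "cmod (x k) \<le> C * nrm (sum_space X0 X1) x" by (simp add: C_def divide_simps mult.commute)
    qed
  qed
  show "(\<lambda>k. \<Sum>n. u n k) \<in> carr (sum_space X0 X1)"
    if "\<And>n. u n \<in> carr (sum_space X0 X1)" "summable (\<lambda>n. nrm (sum_space X0 X1) (u n))" for u
    by (rule sum_space_series(1)[of u, OF that less_add_one])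
  show "nrm (sum_space X0 X1) (\<lambda>k. \<Sum>n. u n k) \<le> (\<Sum>n. nrm (sum_space X0 X1) (u n))"
    if "\<And>n. u n \<in> carr (sum_space X0 X1)" "summable (\<lambda>n. nrm (sum_space X0 X1) (u n))" for u
    by (rule dense_ge) (rule sum_space_series(2)[of u, OF that])
qed

end

text \<open>\<open>i\<close> plays the role of \<open>\<phi>\<^sup>-\<^sup>1\<close>. Membership in the unit ball is expressed by majorants
  \<open>i \<circ> r\<close> with \<open>r\<close> summable, which for \<open>i = 1\<close> degenerates to boundedness by \<open>1\<close>. The divergent
  weights \<open>c\<close> in the last assumption make it valid for \<open>c\<^sub>0\<close>.\<close>

locale calibrated = banach_seq Y for Y +
  fixes i :: "real \<Rightarrow> real"
  assumes i_nonneg: "0 \<le> s \<Longrightarrow> 0 \<le> i s"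
    and i_pos: "0 < s \<Longrightarrow> 0 < i s"
    and i_mono: "0 \<le> s \<Longrightarrow> s \<le> t \<Longrightarrow> i s \<le> i t"
    and i_scale: "0 \<le> s \<Longrightarrow> 0 \<le> t \<Longrightarrow> t \<le> 1 \<Longrightarrow> t * i s \<le> i (t * s)"
    and ball_majorant: "x \<in> carr Y \<Longrightarrow> nrm Y x < \<tau> \<Longrightarrow> 0 < \<epsilon> \<Longrightarrow> \<epsilon> \<le> 1 \<Longrightarrow>
      \<exists>r. (\<forall>k. 0 \<le> r k \<and> cmod (x k) \<le> \<tau> / \<epsilon> * i (r k)) \<and> (\<forall>N. (\<Sum>k<N. r k) \<le> \<epsilon>)"
    and majorant_mem: "(\<And>k. 0 \<le> r k) \<Longrightarrow> (\<And>N. (\<Sum>k<N. r k) \<le> M) \<Longrightarrow> 1 \<le> M \<Longrightarrow>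
      filterlim c at_top sequentially \<Longrightarrow> 0 < \<gamma> \<Longrightarrow> (\<And>k. \<gamma> \<le> c k) \<Longrightarrow>
      (\<And>k. cmod (y k) \<le> i (r k) / c k) \<Longrightarrow> y \<in> carr Y \<and> nrm Y y \<le> M / \<gamma>"

section \<open>Orlicz sequence spaces\<close>

locale orlicz_function =
  fixes \<phi> :: "complex \<Rightarrow> real"
  assumes orlicz: "orlicz \<phi>" and nondegenerate: "nondegenerate \<phi>"
begin

lemma nonneg: "0 \<le> \<phi> x" and at_0: "\<phi> 0 = 0" and convex: "convex_on UNIV \<phi>"
  using orlicz by (auto simp: orlicz_def)

lemma radial: "\<phi> x = \<phi> (of_real (cmod x))"
proof -
  have "x = exp (\<i> * of_real (Arg x)) * of_real (cmod x)"
    using Arg_eq[of x] by (cases "x = 0") (auto simp: mult.commute)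
  moreover have "\<phi> (exp (\<i> * of_real (Arg x)) * of_real (cmod x)) = \<phi> (of_real (cmod x))"
    using orlicz unfolding orlicz_def by blast
  ultimately show ?thesis by simp
qed

lemma scale_le: "0 \<le> t \<Longrightarrow> t \<le> 1 \<Longrightarrow> \<phi> (of_real t * x) \<le> t * \<phi> x"
  using convex_onD[OF convex, of t 0 x] by (simp add: at_0 scaleR_conv_of_real)

lemma mono: "cmod x \<le> cmod y \<Longrightarrow> \<phi> x \<le> \<phi> y"
proof (cases "y = 0")
  case False
  assume le: "cmod x \<le> cmod y"
  have "\<phi> (of_real (cmod x / cmod y) * of_real (cmod y)) \<le> cmod x / cmod y * \<phi> (of_real (cmod y))"
    using le False by (intro scale_le) auto
  also have "\<dots> \<le> 1 * \<phi> (of_real (cmod y))"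
    using le False nonneg by (intro mult_right_mono) auto
  finally show ?thesis using False radial[of x] radial[of y] by simp
qed simp

lemma pos: "x \<noteq> 0 \<Longrightarrow> 0 < \<phi> x"
  using nondegenerate radial[of x] by (simp add: nondegenerate_def)

lemma strict_mono: "cmod x < cmod y \<Longrightarrow> \<phi> x < \<phi> y"
proof -
  assume lt: "cmod x < cmod y"
  then have y: "y \<noteq> 0" by auto
  have "\<phi> (of_real (cmod x / cmod y) * of_real (cmod y)) \<le> cmod x / cmod y * \<phi> (of_real (cmod y))"
    using lt y by (intro scale_le) auto
  also have "\<dots> < 1 * \<phi> (of_real (cmod y))"
    using lt y pos by (intro mult_strict_right_mono) auto
  finally show ?thesis using y radial[of x] radial[of y] by simp
qed

lemma le_iff: "\<phi> x \<le> \<phi> y \<longleftrightarrow> cmod x \<le> cmod y"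
  using mono strict_mono by (meson linorder_not_le)

lemma continuous: "continuous_on A \<phi>"
  using convex_on_continuous[OF open_UNIV convex] continuous_on_subset by blast

lemma surj:
  assumes "0 \<le> s"
  shows "\<exists>t\<ge>0. \<phi> (of_real t) = s"
proof -
  have "filterlim (\<lambda>t::real. \<phi> (of_real t * 1)) at_top at_top"
    using orlicz unfolding orlicz_def by (metis one_neq_zero)
  then have "eventually (\<lambda>t::real. s \<le> \<phi> (of_real t * 1)) at_top"
    by (simp add: filterlim_at_top)
  then have "eventually (\<lambda>t::real. s \<le> \<phi> (of_real t * 1) \<and> 0 \<le> t) at_top"
    using eventually_ge_at_top by (rule eventually_conj)
  then obtain T :: real where T: "s \<le> \<phi> (of_real T)" "0 \<le> T"
    by (auto simp: eventually_at_top_linorder)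
  have "continuous_on {0..T} (\<lambda>t. \<phi> (of_real t))"
    by (rule continuous_on_compose2[OF continuous[of UNIV]]) (auto intro: continuous_intros)
  then show ?thesis using IVT'[of "\<lambda>t. \<phi> (of_real t)" 0 s T] T assms at_0 by auto
qed

lemma bij: "bij_betw (\<lambda>t. \<phi> (of_real t)) {0..} {0..}"
  unfolding bij_betw_def
proof
  show "inj_on (\<lambda>t. \<phi> (of_real t)) {0..}"
  proof (rule inj_onI)
    fix s t :: real assume "s \<in> {0..}" "t \<in> {0..}" "\<phi> (of_real s) = \<phi> (of_real t)"
    then show "s = t" using le_iff[of "of_real s" "of_real t"] le_iff[of "of_real t" "of_real s"] by auto
  qed
  show "(\<lambda>t. \<phi> (of_real t)) ` {0..} = {0..}"
    using surj nonneg by (auto simp: image_iff)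
qed

abbreviation inv :: "real \<Rightarrow> real" where "inv \<equiv> orlicz_inv \<phi>"

lemma inv_apply: "0 \<le> t \<Longrightarrow> inv (\<phi> (of_real t)) = t"
  unfolding orlicz_inv_def using bij by (intro the_inv_into_f_f) (auto simp: bij_betw_def)

lemma apply_inv: "0 \<le> s \<Longrightarrow> \<phi> (of_real (inv s)) = s"
  unfolding orlicz_inv_def using bij by (intro f_the_inv_into_f) (auto simp: bij_betw_def)

lemma inv_nonneg: "0 \<le> s \<Longrightarrow> 0 \<le> inv s"
  using the_inv_into_into[of "\<lambda>t. \<phi> (of_real t)" "{0..}" s "{0..}"] bij
  by (auto simp: orlicz_inv_def bij_betw_def)

text \<open>The Galois connection between \<phi> and its inverse, through which monotonicity,
  scaling and doubling of \<open>inv\<close> are read off from \<phi>.\<close>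

lemma le_inv: "0 \<le> s \<Longrightarrow> cmod x \<le> inv s \<longleftrightarrow> \<phi> x \<le> s"
  using le_iff[of x "of_real (inv s)"] apply_inv[of s] inv_nonneg[of s] by simp

lemma inv_mono: "0 \<le> s \<Longrightarrow> s \<le> t \<Longrightarrow> inv s \<le> inv t"
  using le_inv[of t "of_real (inv s)"] apply_inv[of s] inv_nonneg[of s] by simp

lemma inv_0: "inv 0 = 0"
  using inv_apply[of 0] at_0 by simp

lemma inv_strict_mono: "0 \<le> s \<Longrightarrow> s < t \<Longrightarrow> inv s < inv t"
  using apply_inv[of s] apply_inv[of t] inv_mono[of s t] by (cases "inv s = inv t") auto

lemma inv_scale: "0 \<le> s \<Longrightarrow> 0 \<le> t \<Longrightarrow> t \<le> 1 \<Longrightarrow> t * inv s \<le> inv (t * s)"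
  using le_inv[of "t * s" "of_real t * of_real (inv s)"] scale_le[of t "of_real (inv s)"]
    apply_inv[of s] inv_nonneg[of s] by (simp add: norm_mult)

lemma inv_delta2:
  assumes "delta2 \<phi>"
  obtains K where "1 \<le> K" "\<And>s. 0 \<le> s \<Longrightarrow> 2 * inv s \<le> inv (K * s)"
proof -
  obtain M where M: "0 < M" "\<And>x. \<phi> (2 * x) \<le> M * \<phi> x" using assms by (auto simp: delta2_def)
  have "2 * inv s \<le> inv (max 1 M * s)" if s: "0 \<le> s" for s
  proof -
    have "\<phi> (2 * of_real (inv s)) \<le> M * s" using M(2)[of "of_real (inv s)"] apply_inv[OF s] by simp
    also have "\<dots> \<le> max 1 M * s" using s by (intro mult_right_mono) auto
    finally show ?thesis
      using le_inv[of "max 1 M * s" "2 * of_real (inv s)"] s inv_nonneg[OF s] by (simp add: norm_mult)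
  qed
  then show ?thesis using that[of "max 1 M"] by auto
qed

abbreviation X :: seq_space where "X \<equiv> ell_orlicz \<phi>"

text \<open>Bounding all partial sums covers summability and the bound on the sum at once, see
  \<open>modular_ball_iff\<close>, and keeps the estimates finite.\<close>

definition modular_ball :: "real \<Rightarrow> cseq \<Rightarrow> bool" where
  "modular_ball \<rho> x \<longleftrightarrow> (\<forall>K. (\<Sum>k<K. \<phi> (x k / of_real \<rho>)) \<le> 1)"

lemma modular_ball_iff:
  "modular_ball \<rho> x \<longleftrightarrow> summable (\<lambda>k. \<phi> (x k / of_real \<rho>)) \<and> (\<Sum>k. \<phi> (x k / of_real \<rho>)) \<le> 1"
proof
  assume "modular_ball \<rho> x"
  then have *: "(\<Sum>k<K. \<phi> (x k / of_real \<rho>)) \<le> 1" for K by (simp add: modular_ball_def)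
  then have "summable (\<lambda>k. \<phi> (x k / of_real \<rho>))"
    by (intro summableI_nonneg_bounded[of _ 1] nonneg)
  then show "summable (\<lambda>k. \<phi> (x k / of_real \<rho>)) \<and> (\<Sum>k. \<phi> (x k / of_real \<rho>)) \<le> 1"
    using suminf_le_const * by blast
next
  assume *: "summable (\<lambda>k. \<phi> (x k / of_real \<rho>)) \<and> (\<Sum>k. \<phi> (x k / of_real \<rho>)) \<le> 1"
  then have "(\<Sum>k<K. \<phi> (x k / of_real \<rho>)) \<le> (\<Sum>k. \<phi> (x k / of_real \<rho>))" for K
    by (intro sum_le_suminf nonneg) auto
  then show "modular_ball \<rho> x" using * order_trans unfolding modular_ball_def by blast
qed

lemma modular_ball_mono:
  assumes "modular_ball \<rho> x" "0 < \<rho>" "\<rho> \<le> \<rho>'"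
  shows "modular_ball \<rho>' x"
  unfolding modular_ball_def
proof
  fix K
  have "(\<Sum>k<K. \<phi> (x k / of_real \<rho>')) \<le> (\<Sum>k<K. \<phi> (x k / of_real \<rho>))"
    using assms(2,3) by (intro sum_mono mono) (auto simp: norm_divide intro!: frac_le)
  also have "\<dots> \<le> 1" using assms(1) by (simp add: modular_ball_def)
  finally show "(\<Sum>k<K. \<phi> (x k / of_real \<rho>')) \<le> 1" .
qed

lemma nrm_eq: "nrm X x = Inf {\<rho>. 0 < \<rho> \<and> modular_ball \<rho> x}"
  by (simp add: ell_orlicz_def fo_norm_def modular_ball_iff)

lemma modular_ball_imp_carr: "0 < \<rho> \<Longrightarrow> modular_ball \<rho> x \<Longrightarrow> x \<in> carr X"
  by (auto simp: ell_orlicz_def fo_space_def modular_ball_iff)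

lemma carr_imp_modular_ball:
  assumes "x \<in> carr X"
  obtains \<rho> where "0 < \<rho>" "modular_ball \<rho> x"
proof -
  obtain \<rho> where \<rho>: "0 < \<rho>" "summable (\<lambda>k. \<phi> (x k / of_real \<rho>))"
    using assms by (auto simp: ell_orlicz_def fo_space_def)
  \<comment> \<open>By convexity, dividing the argument by \<open>T\<close>, which is at least 1,
    divides the modular at least by \<open>T\<close>; so a finite modular at \<rho> becomes at most
    1 at \<open>\<rho> * T\<close>.\<close>
  define T where "T = max 1 (\<Sum>k. \<phi> (x k / of_real \<rho>))"
  have T: "1 \<le> T" by (simp add: T_def)
  have "(\<Sum>k<K. \<phi> (x k / of_real (\<rho> * T))) \<le> 1" for K
  proof -
    have "(\<Sum>k<K. \<phi> (x k / of_real (\<rho> * T))) \<le> (\<Sum>k<K. 1 / T * \<phi> (x k / of_real \<rho>))"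
    proof (rule sum_mono)
      fix k
      have "x k / of_real (\<rho> * T) = of_real (1 / T) * (x k / of_real \<rho>)" by simp
      moreover have "\<phi> (of_real (1 / T) * (x k / of_real \<rho>)) \<le> 1 / T * \<phi> (x k / of_real \<rho>)"
        using T by (intro scale_le) auto
      ultimately show "\<phi> (x k / of_real (\<rho> * T)) \<le> 1 / T * \<phi> (x k / of_real \<rho>)" by (simp only:)
    qed
    also have "\<dots> = 1 / T * (\<Sum>k<K. \<phi> (x k / of_real \<rho>))" by (simp add: sum_distrib_left)
    also have "\<dots> \<le> 1 / T * T"
      using sum_le_suminf[OF \<rho>(2), of "{..<K}"] nonneg T by (intro mult_left_mono) (auto simp: T_def)
    finally show ?thesis using T by simp
  qed
  then show ?thesis using that[of "\<rho> * T"] \<rho> T by (simp add: modular_ball_def)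
qed

lemma nrm_le: "0 < \<rho> \<Longrightarrow> modular_ball \<rho> x \<Longrightarrow> nrm X x \<le> \<rho>"
  unfolding nrm_eq by (rule cInf_lower) (auto intro: bdd_belowI[of _ 0])

lemma modular_ball_if_nrm_less:
  assumes "x \<in> carr X" "nrm X x < \<rho>"
  shows "0 < \<rho>" "modular_ball \<rho> x"
proof -
  have "{\<rho>. 0 < \<rho> \<and> modular_ball \<rho> x} \<noteq> {}" using carr_imp_modular_ball[OF assms(1)] by blast
  from cInf_lessD[OF this] obtain \<rho>' where "0 < \<rho>'" "modular_ball \<rho>' x" "\<rho>' < \<rho>"
    using assms(2) unfolding nrm_eq by blast
  then show "0 < \<rho>" "modular_ball \<rho> x" using modular_ball_mono[of \<rho>' x \<rho>] by auto
qed

lemma nrm_nonneg: "x \<in> carr X \<Longrightarrow> 0 \<le> nrm X x"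
  using modular_ball_if_nrm_less(1)[of x] by (meson dense_ge less_imp_le)

lemma jensen:
  fixes w :: "nat \<Rightarrow> real"
  assumes "\<And>n. 0 \<le> w n" "(\<Sum>n<m. w n) \<le> 1"
  shows "\<phi> (\<Sum>n<m. of_real (w n) * y n) \<le> (\<Sum>n<m. w n * \<phi> (y n))"
proof -
  \<comment> \<open>The weights add up to at most 1. The missing mass is placed at an additional
    index \<open>m\<close> with the point 0, where \<phi> vanishes.\<close>
  define v where "v = (\<lambda>n. if n = m then 1 - (\<Sum>n<m. w n) else w n)"
  define z where "z = (\<lambda>n. if n = m then 0 else y n)"
  have split: "(\<Sum>n\<le>m. F n) = (\<Sum>n<m. F n) + F m" for F :: "nat \<Rightarrow> 'c::comm_monoid_add"
    unfolding lessThan_Suc_atMost[symmetric] by simp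
  have "\<phi> (\<Sum>n\<in>{..m}. v n *\<^sub>R z n) \<le> (\<Sum>n\<in>{..m}. v n * \<phi> (z n))"
  proof (rule convex_on_sum[OF finite_atMost _ convex])
    have "(\<Sum>n<m. v n) = (\<Sum>n<m. w n)" by (auto simp: v_def intro!: sum.cong)
    then show "(\<Sum>n\<in>{..m}. v n) = 1" by (simp add: split v_def)
    show "0 \<le> v n" for n using assms by (simp add: v_def)
  qed auto
  moreover have "(\<Sum>n<m. v n *\<^sub>R z n) = (\<Sum>n<m. of_real (w n) * y n)"
    "(\<Sum>n<m. v n * \<phi> (z n)) = (\<Sum>n<m. w n * \<phi> (y n))"
    by (auto simp: v_def z_def scaleR_conv_of_real intro!: sum.cong)
  ultimately show ?thesis by (simp add: split z_def at_0)
qed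

text \<open>Radii \<open>\<rho> n\<close> slightly above the norms are chosen with total
  \<open>R\<close>, so that \<open>\<rho> n / R\<close> are admissible Jensen weights for the
  normalised terms \<open>u n k / \<rho> n\<close>. This bounds every partial series; continuity of
  \<phi> lets the number of terms grow while only finitely many coordinates are summed.\<close>

lemma series_modular_ball:
  assumes u: "\<And>n. u n \<in> carr X" and s: "summable (\<lambda>n. nrm X (u n))"
    and R: "(\<Sum>n. nrm X (u n)) < R" and sk: "\<And>k. summable (\<lambda>n. u n k)"
  shows "modular_ball R (\<lambda>k. \<Sum>n. u n k)"
proof -
  define \<delta> where "\<delta> = R - (\<Sum>n. nrm X (u n))"
  have \<delta>: "\<delta> > 0" using R by (simp add: \<delta>_def)
  define \<rho> where "\<rho> = (\<lambda>n. nrm X (u n) + \<delta> * (1/2) ^ Suc n)"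
  have \<rho>: "\<rho> sums R"
    using sums_add[OF summable_sums[OF s] sums_halves[of \<delta>]] by (simp add: \<delta>_def \<rho>_def[abs_def])
  have mb: "0 < \<rho> n" "modular_ball (\<rho> n) (u n)" for n
    using modular_ball_if_nrm_less[OF u, of n "\<rho> n"] \<delta> by (auto simp: \<rho>_def)
  have R0: "0 < R" using suminf_nonneg[OF s nrm_nonneg[OF u]] R by simp
  have w: "(\<Sum>n<m. \<rho> n / R) \<le> 1" for m
  proof -
    have "(\<Sum>n<m. \<rho> n) \<le> R" using sum_le_suminf[OF sums_summable[OF \<rho>], of "{..<m}"] mb(1) sums_unique[OF \<rho>]
      by (auto simp: less_imp_le)
    then show ?thesis using R0 by (simp add: sum_divide_distrib[symmetric])
  qed
  have part: "(\<Sum>k<K. \<phi> ((\<Sum>n<m. u n k) / of_real R)) \<le> 1" for K m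
  proof -
    have "\<phi> ((\<Sum>n<m. u n k) / of_real R) \<le> (\<Sum>n<m. \<rho> n / R * \<phi> (u n k / of_real (\<rho> n)))" for k
    proof -
      have "of_real (\<rho> n / R) * (u n k / of_real (\<rho> n)) = u n k / of_real R" for n
        using mb(1)[of n] by simp
      moreover have "\<phi> (\<Sum>n<m. of_real (\<rho> n / R) * (u n k / of_real (\<rho> n)))
          \<le> (\<Sum>n<m. \<rho> n / R * \<phi> (u n k / of_real (\<rho> n)))"
        using mb(1) R0 by (intro jensen w) (simp add: less_imp_le)
      ultimately show ?thesis by (simp only: sum_divide_distrib)
    qed
    then have "(\<Sum>k<K. \<phi> ((\<Sum>n<m. u n k) / of_real R)) \<le> (\<Sum>k<K. \<Sum>n<m. \<rho> n / R * \<phi> (u n k / of_real (\<rho> n)))"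
      by (rule sum_mono)
    also have "\<dots> = (\<Sum>n<m. \<rho> n / R * (\<Sum>k<K. \<phi> (u n k / of_real (\<rho> n))))"
      by (subst sum.swap) (simp add: sum_distrib_left)
    also have "\<dots> \<le> (\<Sum>n<m. \<rho> n / R * 1)"
      using mb R0 by (intro sum_mono mult_left_mono) (auto simp: modular_ball_def less_imp_le)
    also have "\<dots> \<le> 1" using w by simp
    finally show ?thesis .
  qed
  show ?thesis
    unfolding modular_ball_def
  proof
    fix K
    have "(\<lambda>m. \<Sum>k<K. \<phi> ((\<Sum>n<m. u n k) / of_real R)) \<longlonglongrightarrow> (\<Sum>k<K. \<phi> ((\<Sum>n. u n k) / of_real R))"
    proof (intro tendsto_sum)
      fix k
      have "(\<lambda>m. (\<Sum>n<m. u n k) / of_real R) \<longlonglongrightarrow> (\<Sum>n. u n k) / of_real R"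
        using summable_LIMSEQ[OF sk] R0 by (intro tendsto_divide tendsto_const) auto
      then show "(\<lambda>m. \<phi> ((\<Sum>n<m. u n k) / of_real R)) \<longlonglongrightarrow> \<phi> ((\<Sum>n. u n k) / of_real R)"
        by (rule continuous_on_tendsto_compose[OF continuous[of UNIV]]) auto
    qed
    then show "(\<Sum>k<K. \<phi> ((\<Sum>n. u n k) / of_real R)) \<le> 1"
      by (rule LIMSEQ_le_const2) (use part in auto)
  qed
qed

lemma coord_le:
  assumes "x \<in> carr X"
  shows "cmod (x k) \<le> inv 1 * nrm X x"
proof -
  have i1: "0 < inv 1" using inv_strict_mono[of 0 1] inv_0 by simp
  have "cmod (x k) / inv 1 \<le> nrm X x"
  proof (rule dense_ge)
    fix R assume "nrm X x < R"
    then have R: "0 < R" "modular_ball R x" using modular_ball_if_nrm_less[OF assms] by auto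
    have "\<phi> (x k / of_real R) \<le> (\<Sum>k<Suc k. \<phi> (x k / of_real R))"
      using sum_nonneg[of "{..<k}" "\<lambda>k. \<phi> (x k / of_real R)"] nonneg by simp
    then have "\<phi> (x k / of_real R) \<le> 1" using R(2) order_trans unfolding modular_ball_def by blast
    then have "cmod (x k) / R \<le> inv 1" using le_inv[of 1 "x k / of_real R"] R(1) by (simp add: norm_divide)
    then show "cmod (x k) / inv 1 \<le> R" using R(1) i1 by (simp add: divide_simps mult.commute)
  qed
  then show ?thesis using i1 by (simp add: divide_simps mult.commute)
qed

lemma coord_summable:
  assumes "\<And>n. u n \<in> carr X" "summable (\<lambda>n. nrm X (u n))"
  shows "summable (\<lambda>n. u n k)"
  by (rule summable_comparison_test'[OF summable_mult[OF assms(2), of "inv 1"], of 0])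
     (use coord_le assms in auto)

sublocale calibrated X inv
proof
  show "(\<lambda>_. 0) \<in> carr X"
    by (rule modular_ball_imp_carr[of 1]) (auto simp: modular_ball_def at_0)
  show "0 \<le> nrm X x" if "x \<in> carr X" for x by (rule nrm_nonneg[OF that])
  \<comment> \<open>The summand \<epsilon> keeps the radius positive when \<open>c = 0\<close>; it
    is sent to 0 in the norm estimate.\<close>
  have mb_scale: "modular_ball ((cmod c + \<epsilon>) * R) (\<lambda>k. c * x k)" if "modular_ball R x" "0 < R" "0 < \<epsilon>" for c x R \<epsilon>
    unfolding modular_ball_def
  proof
    fix K
    have p: "0 < cmod c + \<epsilon>" using that(3) by (simp add: add_nonneg_pos)
    have "(\<Sum>k<K. \<phi> (c * x k / of_real ((cmod c + \<epsilon>) * R))) \<le> (\<Sum>k<K. \<phi> (x k / of_real R))"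
    proof (intro sum_mono mono)
      fix k
      have "cmod c * cmod (x k) \<le> (cmod c + \<epsilon>) * cmod (x k)" using that(3) by (intro mult_right_mono) auto
      then show "cmod (c * x k / of_real ((cmod c + \<epsilon>) * R)) \<le> cmod (x k / of_real R)"
        using p that(2,3) by (simp add: norm_mult norm_divide divide_simps mult.commute del: of_real_add)
    qed
    then show "(\<Sum>k<K. \<phi> (c * x k / of_real ((cmod c + \<epsilon>) * R))) \<le> 1"
      using that(1) order_trans unfolding modular_ball_def by blast
  qed
  show "(\<lambda>k. c * x k) \<in> carr X" if x: "x \<in> carr X" for c x
  proof -
    obtain \<rho> where \<rho>: "0 < \<rho>" "modular_ball \<rho> x" using carr_imp_modular_ball[OF x] .
    show ?thesis
      by (rule modular_ball_imp_carr[OF _ mb_scale[OF \<rho>(2,1), of 1]]) (use \<rho> in \<open>auto intro!: mult_pos_pos add_nonneg_pos\<close>)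
  qed
  show "nrm X (\<lambda>k. c * x k) \<le> cmod c * nrm X x" if x: "x \<in> carr X" for c x
  proof -
    have *: "nrm X (\<lambda>k. c * x k) \<le> (cmod c + \<epsilon>) * (nrm X x + \<epsilon>)" if "0 < \<epsilon>" for \<epsilon>
    proof -
      have "0 < nrm X x + \<epsilon>" "modular_ball (nrm X x + \<epsilon>) x"
        using modular_ball_if_nrm_less[OF x, of "nrm X x + \<epsilon>"] that by auto
      then show ?thesis using mb_scale[of "nrm X x + \<epsilon>" x \<epsilon> c] that
        by (intro nrm_le) (auto intro!: mult_pos_pos add_nonneg_pos)
    qed
    have "((\<lambda>\<epsilon>. (cmod c + \<epsilon>) * (nrm X x + \<epsilon>)) \<longlongrightarrow> (cmod c + 0) * (nrm X x + 0)) (at_right 0)"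
      by (intro tendsto_intros)
    then have "nrm X (\<lambda>k. c * x k) \<le> (cmod c + 0) * (nrm X x + 0)"
    proof (rule tendsto_lowerbound)
      show "\<forall>\<^sub>F \<epsilon> in at_right 0. nrm X (\<lambda>k. c * x k) \<le> (cmod c + \<epsilon>) * (nrm X x + \<epsilon>)"
        using eventually_at_right_less[of "0::real"] by eventually_elim (rule *)
    qed simp
    then show ?thesis by simp
  qed
  show "\<exists>C. \<forall>x\<in>carr X. cmod (x k) \<le> C * nrm X x" for k using coord_le by blast
  show "(\<lambda>k. \<Sum>n. u n k) \<in> carr X" if u: "\<And>n. u n \<in> carr X" "summable (\<lambda>n. nrm X (u n))" for u
  proof (rule modular_ball_imp_carr)
    show "modular_ball ((\<Sum>n. nrm X (u n)) + 1) (\<lambda>k. \<Sum>n. u n k)"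
      by (rule series_modular_ball[of u, OF u _ coord_summable[of u, OF u]]) simp
    show "0 < (\<Sum>n. nrm X (u n)) + 1" using suminf_nonneg[OF u(2) nrm_nonneg[OF u(1)]] by simp
  qed
  show "nrm X (\<lambda>k. \<Sum>n. u n k) \<le> (\<Sum>n. nrm X (u n))"
    if u: "\<And>n. u n \<in> carr X" "summable (\<lambda>n. nrm X (u n))" for u
  proof (rule dense_ge)
    fix R assume R: "(\<Sum>n. nrm X (u n)) < R"
    show "nrm X (\<lambda>k. \<Sum>n. u n k) \<le> R"
    proof (rule nrm_le)
      show "0 < R" using suminf_nonneg[OF u(2) nrm_nonneg[OF u(1)]] R by simp
      show "modular_ball R (\<lambda>k. \<Sum>n. u n k)"
        by (rule series_modular_ball[of u, OF u R coord_summable[of u, OF u]])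
    qed
  qed
  show "0 \<le> inv s" if "0 \<le> s" for s using that by (rule inv_nonneg)
  show "0 < inv s" if "0 < s" for s using inv_strict_mono[of 0 s] that inv_0 by simp
  show "inv s \<le> inv t" if "0 \<le> s" "s \<le> t" for s t using that by (rule inv_mono)
  show "t * inv s \<le> inv (t * s)" if "0 \<le> s" "0 \<le> t" "t \<le> 1" for s t using that by (rule inv_scale)
  show "\<exists>r. (\<forall>k. 0 \<le> r k \<and> cmod (x k) \<le> \<tau> / \<epsilon> * inv (r k)) \<and> (\<forall>N. (\<Sum>k<N. r k) \<le> \<epsilon>)"
    if x: "x \<in> carr X" "nrm X x < \<tau>" and \<epsilon>: "0 < \<epsilon>" "\<epsilon> \<le> 1" for x \<tau> \<epsilon>
  proof -
    have \<tau>: "0 < \<tau>" "modular_ball \<tau> x" using modular_ball_if_nrm_less[OF x] by auto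
    \<comment> \<open>Shrinking \<open>x\<close> by \<epsilon> costs the factor
      \<open>1 / \<epsilon>\<close> in the majorant, while convexity makes the modular at most
      \<epsilon> instead of 1.\<close>
    define r where "r = (\<lambda>k. \<phi> (of_real \<epsilon> * (x k / of_real \<tau>)))"
    have "cmod (x k) \<le> \<tau> / \<epsilon> * inv (r k)" for k
    proof -
      have "\<epsilon> * (cmod (x k) / \<tau>) \<le> inv (r k)"
        using le_inv[of "r k" "of_real \<epsilon> * (x k / of_real \<tau>)"] nonneg \<epsilon> \<tau>
        by (simp add: r_def norm_mult norm_divide)
      then show ?thesis using \<epsilon> \<tau> by (simp add: divide_simps mult_ac)
    qed
    moreover have "(\<Sum>k<N. r k) \<le> \<epsilon>" for N
    proof -
      have "(\<Sum>k<N. r k) \<le> (\<Sum>k<N. \<epsilon> * \<phi> (x k / of_real \<tau>))"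
        unfolding r_def using \<epsilon> by (intro sum_mono scale_le) auto
      also have "\<dots> = \<epsilon> * (\<Sum>k<N. \<phi> (x k / of_real \<tau>))" by (simp add: sum_distrib_left)
      also have "\<dots> \<le> \<epsilon> * 1" using \<tau>(2) \<epsilon> by (intro mult_left_mono) (auto simp: modular_ball_def)
      finally show ?thesis by simp
    qed
    ultimately show ?thesis using nonneg by (intro exI[of _ r]) (auto simp: r_def)
  qed
  show "y \<in> carr X \<and> nrm X y \<le> M / \<gamma>"
    if r: "\<And>k. 0 \<le> r k" "\<And>N. (\<Sum>k<N. r k) \<le> M" and M: "1 \<le> M"
      and c: "0 < \<gamma>" "\<And>k. \<gamma> \<le> c k" and y: "\<And>k. cmod (y k) \<le> inv (r k) / c k"
    for r M c \<gamma> y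
  proof -
    \<comment> \<open>The two factors of the radius act separately: \<open>1 / \<gamma>\<close> is
      gained from the weights, and \<open>M\<close> brings the modular down from \<open>M\<close> to
      1 through \<open>inv_scale\<close>.\<close>
    have "\<phi> (y k / of_real (M / \<gamma>)) \<le> r k / M" for k
    proof -
      have "cmod (y k) * \<gamma> \<le> cmod (y k) * c k" using c by (intro mult_left_mono) auto
      also have "\<dots> \<le> inv (r k)" using y[of k] c(1) c(2)[of k] by (simp add: pos_le_divide_eq)
      finally have "1 / M * (cmod (y k) * \<gamma>) \<le> 1 / M * inv (r k)" using M by (intro mult_left_mono) auto
      also have "\<dots> \<le> inv (1 / M * r k)" using M r by (intro inv_scale) auto
      finally have "cmod (y k / of_real (M / \<gamma>)) \<le> inv (r k / M)"
        using M c(1) by (simp add: norm_divide norm_mult)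
      then show ?thesis using le_inv[of "r k / M"] r M by simp
    qed
    then have "(\<Sum>k<N. \<phi> (y k / of_real (M / \<gamma>))) \<le> (\<Sum>k<N. r k / M)" for N
      by (rule sum_mono)
    also have "(\<Sum>k<N. r k / M) \<le> 1" for N using r(2)[of N] M by (simp add: sum_divide_distrib[symmetric])
    finally have "modular_ball (M / \<gamma>) y" by (simp add: modular_ball_def)
    moreover have "0 < M / \<gamma>" using M c by simp
    ultimately show ?thesis using nrm_le modular_ball_imp_carr by blast
  qed
qed

end

section \<open>The sup-norm spaces\<close>

lemma cmod_le_SUP: "bounded (range x) \<Longrightarrow> cmod (x k) \<le> (SUP k. cmod (x k))"
  by (rule cSUP_upper) (auto simp: bdd_above_norm[symmetric] image_image)

lemma bounded_series_SUP:
  fixes u :: "nat \<Rightarrow> cseq"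
  assumes u: "\<And>n. bounded (range (u n))" and s: "summable (\<lambda>n. SUP k. cmod (u n k))"
  shows "cmod (\<Sum>n. u n k) \<le> (\<Sum>n. SUP k. cmod (u n k))" "summable (\<lambda>n. u n k)"
proof -
  show "summable (\<lambda>n. u n k)"
    by (rule summable_comparison_test'[OF s, of 0]) (rule cmod_le_SUP[OF u])
  show "cmod (\<Sum>n. u n k) \<le> (\<Sum>n. SUP k. cmod (u n k))"
    by (rule norm_suminf_le[OF cmod_le_SUP[OF u] s])
qed

text \<open>The common part of \<open>ell_infty\<close> and \<open>c_zero\<close>; what
  distinguishes them sits in the closure assumptions. For \<open>c_zero\<close> the assumption
  \<open>mem\<close> is where divergent weights force decay.\<close>

lemma calibrated_sup_norm:
  assumes bdd: "\<And>x. x \<in> carr Y \<Longrightarrow> bounded (range x)"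
    and nrm: "\<And>x. nrm Y x = (SUP k. cmod (x k))"
    and zero: "(\<lambda>_. 0) \<in> carr Y"
    and scale: "\<And>c x. x \<in> carr Y \<Longrightarrow> (\<lambda>k. c * x k) \<in> carr Y"
    and series: "\<And>u. (\<And>n. u n \<in> carr Y) \<Longrightarrow> summable (\<lambda>n. SUP k. cmod (u n k)) \<Longrightarrow> (\<lambda>k. \<Sum>n. u n k) \<in> carr Y"
    and mem: "\<And>c \<gamma> y. filterlim c at_top sequentially \<Longrightarrow> 0 < \<gamma> \<Longrightarrow> (\<And>k. \<gamma> \<le> c k) \<Longrightarrow>
      (\<And>k. cmod (y k) \<le> 1 / c k) \<Longrightarrow> y \<in> carr Y"
  shows "calibrated Y (\<lambda>_. 1)"
proof
  show "(\<lambda>_. 0) \<in> carr Y" by (rule zero)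
  show nn: "0 \<le> nrm Y x" if "x \<in> carr Y" for x
    unfolding nrm using cmod_le_SUP[OF bdd[OF that], of 0] norm_ge_zero[of "x 0"] by linarith
  show "(\<lambda>k. c * x k) \<in> carr Y" if "x \<in> carr Y" for c x by (rule scale[OF that])
  show "nrm Y (\<lambda>k. c * x k) \<le> cmod c * nrm Y x" if "x \<in> carr Y" for c x
    unfolding nrm by (rule cSUP_least) (auto simp: norm_mult intro!: mult_left_mono cmod_le_SUP bdd that)
  show "\<exists>C. \<forall>x\<in>carr Y. cmod (x k) \<le> C * nrm Y x" for k
    by (rule exI[of _ 1]) (auto simp: nrm intro!: cmod_le_SUP bdd)
  show "(\<lambda>k. \<Sum>n. u n k) \<in> carr Y" if "\<And>n. u n \<in> carr Y" "summable (\<lambda>n. nrm Y (u n))" for u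
    using series[of u] that by (simp add: nrm)
  show "nrm Y (\<lambda>k. \<Sum>n. u n k) \<le> (\<Sum>n. nrm Y (u n))"
    if "\<And>n. u n \<in> carr Y" "summable (\<lambda>n. nrm Y (u n))" for u
    using that unfolding nrm by (intro cSUP_least bounded_series_SUP bdd) auto
  show "\<exists>r. (\<forall>k. 0 \<le> r k \<and> cmod (x k) \<le> \<tau> / \<epsilon> * 1) \<and> (\<forall>N. (\<Sum>k<N. r k) \<le> \<epsilon>)"
    if x: "x \<in> carr Y" "nrm Y x < \<tau>" and \<epsilon>: "0 < \<epsilon>" "\<epsilon> \<le> 1" for x :: cseq and \<tau> \<epsilon> :: real
  proof -
    have "cmod (x k) \<le> \<tau> / \<epsilon>" for k
    proof -
      have "cmod (x k) \<le> \<tau>" using cmod_le_SUP[OF bdd[OF x(1)], of k] x(2) by (simp add: nrm)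
      also have "\<tau> \<le> \<tau> / \<epsilon>" using \<epsilon> nn[OF x(1)] x(2) by (simp add: pos_le_divide_eq mult_left_le)
      finally show ?thesis .
    qed
    \<comment> \<open>With the constant 1 as inverse every \<open>r\<close> gives the same majorant,
      so the zero sequence is chosen.\<close>
    then show ?thesis using \<epsilon> by (intro exI[of _ "\<lambda>_. 0"]) auto
  qed
  show "y \<in> carr Y \<and> nrm Y y \<le> M / \<gamma>"
    if M: "1 \<le> M" and c: "filterlim c at_top sequentially" "0 < \<gamma>" "\<And>k. \<gamma> \<le> c k" and y: "\<And>k. cmod (y k) \<le> 1 / c k"
    for M \<gamma> :: real and c and y :: cseq
  proof
    show "y \<in> carr Y" by (rule mem[OF c y])
    have "cmod (y k) \<le> M / \<gamma>" for k
      using c M by (intro order_trans[OF y] frac_le) auto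
    then show "nrm Y y \<le> M / \<gamma>" unfolding nrm by (intro cSUP_least) auto
  qed
qed auto

lemma calibrated_ell_infty: "calibrated ell_infty (\<lambda>_. 1)"
proof (rule calibrated_sup_norm)
  show "(\<lambda>k. c * x k) \<in> carr ell_infty" if x: "x \<in> carr ell_infty" for c x
  proof -
    obtain C where "\<And>k. cmod (x k) \<le> C" using x by (auto simp: ell_infty_def bounded_iff)
    then have "cmod (c * x k) \<le> cmod c * C" for k by (auto simp: norm_mult intro: mult_left_mono)
    then show ?thesis by (auto simp: ell_infty_def bounded_iff)
  qed
  show "(\<lambda>k. \<Sum>n. u n k) \<in> carr ell_infty"
    if "\<And>n. u n \<in> carr ell_infty" "summable (\<lambda>n. SUP k. cmod (u n k))" for u
    using that bounded_series_SUP(1)[of u] by (auto simp: ell_infty_def bounded_iff)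
  show "y \<in> carr ell_infty"
    if c: "0 < \<gamma>" "\<And>k. \<gamma> \<le> c k" and y: "\<And>k. cmod (y k) \<le> 1 / c k" for c \<gamma> y
  proof -
    have "cmod (y k) \<le> 1 / \<gamma>" for k using c by (intro order_trans[OF y] frac_le) auto
    then show ?thesis by (auto simp: ell_infty_def bounded_iff)
  qed
qed (auto simp: ell_infty_def)

lemma calibrated_c_zero: "calibrated c_zero (\<lambda>_. 1)"
proof (rule calibrated_sup_norm)
  show bdd: "bounded (range x)" if "x \<in> carr c_zero" for x
    using that convergent_imp_bounded by (auto simp: c_zero_def)
  show "(\<lambda>k. c * x k) \<in> carr c_zero" if "x \<in> carr c_zero" for c x
    using that by (auto simp: c_zero_def intro: tendsto_mult_right_zero)
  show "(\<lambda>k. \<Sum>n. u n k) \<in> carr c_zero"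
    if u: "\<And>n. u n \<in> carr c_zero" "summable (\<lambda>n. SUP k. cmod (u n k))" for u
  proof -
    have "(\<lambda>k. \<Sum>n. u n k) \<longlonglongrightarrow> (\<Sum>n::nat. 0)"
    proof (rule conjunct2[OF conjunct2[OF tannerys_theorem]])
      show "(\<lambda>k. u n k) \<longlonglongrightarrow> 0" for n using u(1)[of n] by (simp add: c_zero_def)
      show "\<forall>\<^sub>F (n, k) in at_top \<times>\<^sub>F sequentially. norm (u n k) \<le> (SUP k. cmod (u n k))"
        by (intro always_eventually) (auto intro!: cmod_le_SUP bdd u)
    qed (use u in auto)
    then show ?thesis by (simp add: c_zero_def)
  qed
  show "y \<in> carr c_zero"
    if c: "filterlim c at_top sequentially" and y: "\<And>k. cmod (y k) \<le> 1 / c k" for c \<gamma> y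
  proof -
    have "(\<lambda>k. 1 / c k) \<longlonglongrightarrow> 0"
      using tendsto_inverse_0_at_top[OF c] by (simp add: divide_inverse)
    then have "y \<longlonglongrightarrow> 0" by (rule Lim_null_comparison[rotated]) (use y in auto)
    then show ?thesis by (simp add: c_zero_def)
  qed
qed (auto simp: c_zero_def)

section \<open>The function \<open>\<phi>\<^sub>\<theta>\<close>\<close>

lemma taylor_coeff_0: "taylor_coeff f 0 a = f a"
  by (simp add: taylor_coeff_def)

lemma
  assumes "f holomorphic_on S" "g holomorphic_on S" "open S" "a \<in> S"
  shows taylor_coeff_add: "taylor_coeff (\<lambda>z. f z + g z) j a = taylor_coeff f j a + taylor_coeff g j a"
    and taylor_coeff_diff: "taylor_coeff (\<lambda>z. f z - g z) j a = taylor_coeff f j a - taylor_coeff g j a"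
  using assms by (simp_all add: taylor_coeff_def higher_deriv_add higher_deriv_diff add_divide_distrib diff_divide_distrib)

lemma taylor_coeff_cong:
  assumes "f holomorphic_on S" "open S" "a \<in> S" "\<And>z. z \<in> S \<Longrightarrow> f z = g z"
  shows "taylor_coeff f j a = taylor_coeff g j a"
proof -
  have "g holomorphic_on S" using holomorphic_transform[OF assms(1)] assms(4) by auto
  then show ?thesis
    using higher_deriv_transform_within_open[OF assms(1) _ assms(2,3,4)] by (simp add: taylor_coeff_def)
qed

lemma taylor_coeff_power_mult:
  assumes "Q holomorphic_on S" "open S" "a \<in> S"
  shows "taylor_coeff (\<lambda>z. (z - a) ^ m * Q z) j a = (if j < m then 0 else taylor_coeff Q (j - m) a)"
proof (induction m arbitrary: j)
  case (Suc m)
  have holo: "(\<lambda>z. (z - a) ^ m * Q z) holomorphic_on S"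
    using assms(1) by (intro holomorphic_intros)
  have eq: "(\<lambda>z. (z - a) ^ Suc m * Q z) = (\<lambda>z. (z - a) * ((z - a) ^ m * Q z))" by (simp add: mult.assoc)
  show ?case
    using taylor_coeff_linear_mult[OF holo assms(2,3)] Suc.IH unfolding eq
    by (cases j) (auto simp: taylor_coeff_0)
qed simp

text \<open>As \<open>h\<close> has a simple zero at \<theta>, a summand \<open>h ^ m * u\<close>
  leaves all coefficients below \<open>m\<close> untouched, and \<open>u\<close> can be chosen to
  prescribe the coefficient of index \<open>m\<close>. This is the mechanism behind the recursion
  for \<open>g_tuple\<close>.\<close>

lemma taylor_coeff_conformal_power:
  assumes h: "strip_conformal \<theta> h" "0 < \<theta>" "\<theta> < 1" and u: "u holomorphic_on interior strip"
  shows "j < m \<Longrightarrow> taylor_coeff (\<lambda>z. h z ^ m * u z) j (of_real \<theta>) = 0"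
    and "taylor_coeff (\<lambda>z. h z ^ m * u z) m (of_real \<theta>) = deriv h (of_real \<theta>) ^ m * u (of_real \<theta>)"
proof -
  let ?\<theta> = "complex_of_real \<theta>"
  have \<theta>: "?\<theta> \<in> interior strip" using of_real_interior_strip h by blast
  have holoh: "h holomorphic_on interior strip" and h0: "h ?\<theta> = 0"
    using h by (auto simp: strip_conformal_def)
  have "taylor_coeff h j ?\<theta> = 0" if "j < 1" for j using that h0 by (simp add: taylor_coeff_def)
  then obtain H where H: "H holomorphic_on interior strip"
    "\<And>z. z \<in> interior strip \<Longrightarrow> h z = (z - ?\<theta>) ^ 1 * H z" "H ?\<theta> = taylor_coeff h 1 ?\<theta>"
    using factor_zero_of_order[OF holoh open_interior \<theta>, of 1] by blast
  have H\<theta>: "H ?\<theta> = deriv h ?\<theta>" using H(3) by (simp add: taylor_coeff_def)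
  have holo: "(\<lambda>z. H z ^ m * u z) holomorphic_on interior strip" using H(1) u by (intro holomorphic_intros)
  have "taylor_coeff (\<lambda>z. h z ^ m * u z) j ?\<theta> = taylor_coeff (\<lambda>z. (z - ?\<theta>) ^ m * (H z ^ m * u z)) j ?\<theta>" for j
  proof (rule taylor_coeff_cong[OF _ open_interior \<theta>])
    show "(\<lambda>z. h z ^ m * u z) holomorphic_on interior strip" using holoh u by (intro holomorphic_intros)
  qed (simp add: H(2) power_mult_distrib)
  then show "j < m \<Longrightarrow> taylor_coeff (\<lambda>z. h z ^ m * u z) j ?\<theta> = 0"
    "taylor_coeff (\<lambda>z. h z ^ m * u z) m ?\<theta> = deriv h ?\<theta> ^ m * u ?\<theta>"
    by (simp_all add: taylor_coeff_power_mult[OF holo open_interior \<theta>] taylor_coeff_0 H\<theta>)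
qed

lemma (in calibrated) i_dilate: "1 \<le> K \<Longrightarrow> 0 \<le> s \<Longrightarrow> i (K * s) \<le> K * i s"
  using i_scale[of "K * s" "1 / K"] by (simp add: field_simps)

text \<open>For \<open>\<phi> = i\<^sup>-\<^sup>1\<close> this reads \<open>u * \<phi> a / a \<le> max (\<phi> a) (\<phi> u)\<close>, since \<open>\<phi> t / t\<close> increases.\<close>

lemma (in calibrated) i_young:
  assumes "0 \<le> r" "0 < s"
  shows "i r * (s / i s) \<le> s + r"
proof (cases "r \<le> s")
  case True
  then have "i r * (s / i s) \<le> i s * (s / i s)"
    using assms i_pos by (intro mult_right_mono i_mono) (auto simp: less_imp_le)
  also have "\<dots> = s" using i_pos[OF assms(2)] by simp
  finally show ?thesis using assms by simp
next
  case False
  then have "s / r * i r \<le> i s" using i_scale[of r "s / r"] assms by simp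
  then have "i r * (s / i s) \<le> r" using False i_pos[OF assms(2)] assms by (simp add: field_simps)
  then show ?thesis using assms by simp
qed

lemma mult_cnj_sgn: "z * cnj (sgn z) = of_real (cmod z)"
  using complex_norm_square[of z] by (cases "z = 0") (auto simp: sgn_eq power2_eq_square field_simps)

text \<open>Dividing by \<open>2 * A\<close> rather than by \<open>A\<close> leaves only half of
  \<open>s\<close> on the right. Once summed, the bound reads \<open>S \<le> (S + R) / 2\<close> for
  the sum \<open>S\<close> of all \<open>s\<close>, and this yields
  \<open>S \<le> R\<close>.\<close>

lemma (in calibrated) i_young_scaled:
  assumes "0 \<le> r" "0 < s" "0 < A" "u \<le> A * i r"
  shows "u * (s / i s) / (2 * A) \<le> (s + r) / 2"
proof -
  have "u * (s / i s) / (2 * A) \<le> A * i r * (s / i s) / (2 * A)"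
    using assms i_pos by (intro divide_right_mono mult_right_mono) (auto simp: less_imp_le)
  also have "\<dots> = i r * (s / i s) / 2" using assms(3) by simp
  also have "\<dots> \<le> (s + r) / 2" using i_young[OF assms(1,2)] by (intro divide_right_mono) auto
  finally show ?thesis .
qed

text \<open>\<open>i0\<close> and \<open>i1\<close> play the roles of the inverses of \<phi>_0 and
  \<phi>_1. Since \<open>i0\<close> may be the constant 1, strict growth, the full range and the
  doubling of their geometric mean are drawn from \<open>i1\<close>.\<close>

locale interpolation = X0: calibrated X0 i0 + X1: calibrated X1 i1 for X0 i0 X1 i1 +
  fixes \<theta> :: real and h :: "complex \<Rightarrow> complex"
  assumes \<theta>: "0 < \<theta>" "\<theta> < 1" and h: "strip_conformal \<theta> h"
    and i1_0: "i1 0 = 0"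
    and i1_strict_mono: "0 \<le> s \<Longrightarrow> s < t \<Longrightarrow> i1 s < i1 t"
    and i1_small: "0 < e \<Longrightarrow> \<exists>s>0. i1 s \<le> e"
    and i1_large: "\<exists>s>0. R \<le> i1 s"
    and i1_delta2: "\<exists>K\<ge>1. \<forall>s\<ge>0. 2 * i1 s \<le> i1 (K * s)"
begin

text \<open>This is the inverse of \<phi>_\<theta> on the half line. Working with it postpones all
  statements about \<open>the_inv_into\<close> until bijectivity is established.\<close>

definition \<iota> :: "real \<Rightarrow> real" where "\<iota> s = i0 s powr (1 - \<theta>) * i1 s powr \<theta>"

abbreviation p :: "complex \<Rightarrow> real" where "p \<equiv> phi_theta i0 i1 \<theta>"

lemma \<iota>_0: "\<iota> 0 = 0"
  using \<theta> by (simp add: \<iota>_def i1_0)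

lemma \<iota>_pos: "0 < s \<Longrightarrow> 0 < \<iota> s"
  by (simp add: \<iota>_def X0.i_pos X1.i_pos less_imp_neq[THEN not_sym])

lemma \<iota>_strict_mono:
  assumes "0 \<le> s" "s < t"
  shows "\<iota> s < \<iota> t"
proof (cases "s = 0")
  case True then show ?thesis using \<iota>_0 \<iota>_pos assms by simp
next
  case False
  then have s: "0 < s" using assms by simp
  have "\<iota> s < i0 s powr (1 - \<theta>) * i1 t powr \<theta>"
    unfolding \<iota>_def using assms s \<theta> X0.i_pos[OF s] i1_strict_mono X1.i_nonneg
    by (intro mult_strict_left_mono powr_less_mono2) auto
  also have "\<dots> \<le> \<iota> t"
    unfolding \<iota>_def using assms \<theta> X0.i_nonneg X0.i_mono
    by (intro mult_right_mono powr_mono2) auto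
  finally show ?thesis .
qed

lemma \<iota>_scale:
  assumes "0 \<le> s" "0 \<le> t" "t \<le> 1"
  shows "t * \<iota> s \<le> \<iota> (t * s)"
proof -
  have "t = t powr (1 - \<theta>) * t powr \<theta>" using assms by (simp add: powr_add[symmetric])
  then have "t * \<iota> s = (t * i0 s) powr (1 - \<theta>) * (t * i1 s) powr \<theta>"
    using assms X0.i_nonneg X1.i_nonneg by (simp add: \<iota>_def powr_mult)
  also have "\<dots> \<le> \<iota> (t * s)"
    unfolding \<iota>_def using assms \<theta> X0.i_nonneg X1.i_nonneg X0.i_scale X1.i_scale
    by (intro mult_mono powr_mono2) auto
  finally show ?thesis .
qed

text \<open>\<open>\<iota> t\<close> increases while \<open>\<iota> t / t\<close> decreases, by
  \<open>\<iota>_scale\<close>. These two monotonicities squeeze \<open>\<iota> t\<close> between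
  \<open>\<iota> s * min 1 (t / s)\<close> and \<open>\<iota> s * max 1 (t / s)\<close>.\<close>

lemma \<iota>_continuous:
  assumes "0 < s"
  shows "isCont \<iota> s"
proof -
  have lower: "\<iota> s * (t / s) \<le> \<iota> t" if "0 < t" "t \<le> s" for t s
    using \<iota>_scale[of s "t / s"] that by (simp add: mult.commute)
  have mono: "\<iota> t \<le> \<iota> s" if "0 < t" "t \<le> s" for t s
    using \<iota>_strict_mono[of t s] that by (cases "t = s") auto
  have "(\<iota> \<longlongrightarrow> \<iota> s) (at s)"
  proof (rule tendsto_sandwich)
    have pos: "\<forall>\<^sub>F t in at s. 0 < t"
      using assms by (intro order_tendstoD[OF tendsto_ident_at]) auto
    then show "\<forall>\<^sub>F t in at s. \<iota> s * min 1 (t / s) \<le> \<iota> t"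
    proof eventually_elim
      case (elim t)
      then show ?case using lower[of t s] mono[of s t] assms by (cases "t \<le> s") (auto simp: min_def divide_simps)
    qed
    show "\<forall>\<^sub>F t in at s. \<iota> t \<le> \<iota> s * max 1 (t / s)"
      using pos
    proof eventually_elim
      case (elim t)
      then show ?case using lower[of s t] mono[of t s] assms by (cases "t \<le> s") (auto simp: max_def divide_simps)
    qed
    have "((\<lambda>t. \<iota> s * min 1 (t / s)) \<longlongrightarrow> \<iota> s * min 1 (s / s)) (at s)"
      using assms by (intro tendsto_intros) auto
    then show "((\<lambda>t. \<iota> s * min 1 (t / s)) \<longlongrightarrow> \<iota> s) (at s)" using assms by simp
    have "((\<lambda>t. \<iota> s * max 1 (t / s)) \<longlongrightarrow> \<iota> s * max 1 (s / s)) (at s)"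
      using assms by (intro tendsto_intros) auto
    then show "((\<lambda>t. \<iota> s * max 1 (t / s)) \<longlongrightarrow> \<iota> s) (at s)" using assms by simp
  qed
  then show ?thesis by (simp add: isCont_def)
qed

lemma \<iota>_surj:
  assumes "0 \<le> y"
  shows "\<exists>s\<ge>0. \<iota> s = y"
proof (cases "y = 0")
  case True then show ?thesis using \<iota>_0 by auto
next
  case False
  then have y: "0 < y" using assms by simp
  define c where "c = i0 1 powr (1 - \<theta>)"
  have c: "0 < c" using X0.i_pos[of 1] by (simp add: c_def)
  \<comment> \<open>\<open>Y\<close> solves \<open>c * Y powr \<theta> = y\<close>. The arguments
    \<open>s1\<close> and \<open>s2\<close> are taken on either side of 1, so that \<open>i0\<close>
    there compares with \<open>i0 1\<close> and \<open>i1\<close> alone decides on which side of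
    \<open>y\<close> the value lies.\<close>
  define Y where "Y = (y / c) powr (1 / \<theta>)"
  have Y: "0 < Y" "Y powr \<theta> = y / c" using y c \<theta> by (auto simp: Y_def powr_powr)
  obtain s1 where s1: "0 < s1" "i1 s1 \<le> min Y (i1 1)"
    using i1_small[of "min Y (i1 1)"] Y X1.i_pos[of 1] by auto
  then have "s1 \<le> 1" using i1_strict_mono[of 1 s1] by (cases "s1 \<le> 1") auto
  then have "\<iota> s1 \<le> c * Y powr \<theta>"
    unfolding \<iota>_def c_def using s1 \<theta> X0.i_nonneg X1.i_nonneg X0.i_mono
    by (intro mult_mono powr_mono2) auto
  then have low: "\<iota> s1 \<le> y" using c by (simp add: Y(2))
  obtain s2 where s2: "0 < s2" "max Y (i1 1) \<le> i1 s2" using i1_large by blast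
  then have "1 \<le> s2" using i1_strict_mono[of s2 1] by (cases "1 \<le> s2") auto
  then have "c * Y powr \<theta> \<le> \<iota> s2"
    unfolding \<iota>_def c_def using s2 \<theta> Y y c X0.i_nonneg X0.i_mono
    by (intro mult_mono powr_mono2) auto
  then have high: "y \<le> \<iota> s2" using c by (simp add: Y(2))
  have "s1 \<le> s2" using \<open>s1 \<le> 1\<close> \<open>1 \<le> s2\<close> by simp
  then obtain s where "s1 \<le> s" "s \<le> s2" "\<iota> s = y"
    using IVT[of \<iota> s1 y s2] low high s1(1) \<iota>_continuous by force
  then show ?thesis using s1 by (intro exI[of _ s]) auto
qed

lemma \<iota>_nonneg: "0 \<le> \<iota> s"
  by (simp add: \<iota>_def)

lemma \<iota>_inj: "inj_on \<iota> {0..}"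
  by (rule strict_mono_on_imp_inj_on) (auto simp: strict_mono_on_def intro: \<iota>_strict_mono)

lemma \<iota>_image: "\<iota> ` {0..} = {0..}"
  using \<iota>_surj \<iota>_nonneg by (auto simp: image_iff)

lemma p_eq: "p x = the_inv_into {0..} \<iota> (cmod x)"
  by (simp add: phi_theta_def \<iota>_def[abs_def])

lemma p_nonneg: "0 \<le> p x"
  using the_inv_into_into[OF \<iota>_inj, of "cmod x" "{0..}"] by (simp add: p_eq \<iota>_image)

lemma \<iota>_p: "\<iota> (p x) = cmod x"
  using f_the_inv_into_f[OF \<iota>_inj, of "cmod x"] by (simp add: p_eq \<iota>_image)

lemma p_le_iff: "0 \<le> s \<Longrightarrow> p x \<le> s \<longleftrightarrow> cmod x \<le> \<iota> s"
  using \<iota>_strict_mono[of "p x" s] \<iota>_strict_mono[of s "p x"] p_nonneg[of x] \<iota>_p[of x]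
  by (metis less_eq_real_def linorder_not_le)

lemma p_0: "p 0 = 0"
  using p_le_iff[of 0 0] p_nonneg[of 0] \<iota>_0 by simp

lemma p_pos: "x \<noteq> 0 \<Longrightarrow> 0 < p x"
  using \<iota>_p[of x] \<iota>_0 p_nonneg[of x] by (cases "p x = 0") auto

lemma p_mono: "cmod x \<le> cmod y \<Longrightarrow> p x \<le> p y"
  by (simp add: p_le_iff p_nonneg \<iota>_p)

lemma p_cmod: "p (of_real (cmod x)) = p x"
  by (simp add: p_eq)

text \<open>When the argument is multiplied by \<open>K\<close>, \<open>i0\<close> does not decrease
  and \<open>i1\<close> at least doubles, so their geometric mean gains the factor
  \<open>d = 2 powr \<theta>\<close>. Iteration gives polynomial growth of \<phi>_\<theta> along
  powers of \<open>d\<close>.\<close>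

lemma p_geometric_growth:
  obtains K d where "1 < K" "1 < d" "\<And>n x. p (of_real (d ^ n) * x) \<le> K ^ n * p x"
proof -
  obtain K where K: "1 \<le> K" "\<And>s. 0 \<le> s \<Longrightarrow> 2 * i1 s \<le> i1 (K * s)" using i1_delta2 by blast
  define d where "d = 2 powr \<theta>"
  have d: "1 < d" using \<theta> by (simp add: d_def)
  have step: "d * \<iota> s \<le> \<iota> (K * s)" if s: "0 \<le> s" for s
  proof -
    have "s \<le> K * s" using K s by (simp add: mult_le_cancel_right1)
    then have "i0 s powr (1 - \<theta>) * (2 * i1 s) powr \<theta> \<le> \<iota> (K * s)"
      unfolding \<iota>_def using K s \<theta> X0.i_nonneg X1.i_nonneg X0.i_mono
      by (intro mult_mono powr_mono2) auto
    then show ?thesis using X1.i_nonneg[OF s] by (simp add: \<iota>_def d_def powr_mult mult_ac)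
  qed
  \<comment> \<open>\<open>K + 1\<close> replaces \<open>K\<close>, which may equal 1, because the
    base is later used for a logarithm.\<close>
  have one: "p (of_real d * x) \<le> (K + 1) * p x" for x
  proof -
    have "cmod (of_real d * x) \<le> \<iota> (K * p x)"
      using step[OF p_nonneg[of x]] d by (simp add: norm_mult \<iota>_p)
    then have "p (of_real d * x) \<le> K * p x" using p_nonneg[of x] K by (simp add: p_le_iff)
    then show ?thesis using p_nonneg[of x] by (simp add: algebra_simps)
  qed
  have "p (of_real (d ^ n) * x) \<le> (K + 1) ^ n * p x" for n x
  proof (induction n)
    case (Suc n)
    have "p (of_real (d ^ Suc n) * x) \<le> (K + 1) * p (of_real (d ^ n) * x)"
      using one[of "of_real (d ^ n) * x"] by (simp add: mult.assoc)
    also have "\<dots> \<le> (K + 1) * ((K + 1) ^ n * p x)" using Suc K by (intro mult_left_mono) auto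
    finally show ?case by (simp add: mult.assoc)
  qed simp
  then show ?thesis using that[of "K + 1" d] K d by auto
qed

lemma p_dominated:
  obtains K where "1 \<le> K" "\<And>x y. cmod y \<le> A * cmod x \<Longrightarrow> p y \<le> K * p x"
proof -
  obtain K d where K: "1 < K" "1 < d" "\<And>n x. p (of_real (d ^ n) * x) \<le> K ^ n * p x"
    by (rule p_geometric_growth) blast
  obtain n where n: "A < d ^ n" using real_arch_pow[OF K(2)] by blast
  have "p y \<le> K ^ n * p x" if "cmod y \<le> A * cmod x" for x y
  proof (rule order_trans[OF p_mono K(3)])
    have "A * cmod x \<le> d ^ n * cmod x" using n by (intro mult_right_mono) auto
    then show "cmod y \<le> cmod (of_real (d ^ n) * x)" using that K(2) by (simp add: norm_mult norm_power)
  qed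
  then show ?thesis using that[of "K ^ n"] K(1) by auto
qed

text \<open>A sum is at most twice its larger summand in modulus, so the dilation estimate replaces
  subadditivity.\<close>

lemma p_quasi_triangle:
  obtains K where "1 \<le> K" "\<And>x y. p (x + y) \<le> K * (p x + p y)"
proof -
  obtain K where K: "1 \<le> K" "\<And>x y. cmod y \<le> 2 * cmod x \<Longrightarrow> p y \<le> K * p x"
    by (rule p_dominated) blast
  have "p (x + y) \<le> K * (p x + p y)" for x y
  proof -
    have "cmod (x + y) \<le> 2 * cmod (if cmod x \<le> cmod y then y else x)"
      using norm_triangle_ineq[of x y] by (auto split: if_splits)
    then have "p (x + y) \<le> K * p (if cmod x \<le> cmod y then y else x)" by (rule K(2))
    also have "\<dots> \<le> K * (p x + p y)" using K(1) p_nonneg by (intro mult_left_mono) auto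
    finally show ?thesis .
  qed
  then show ?thesis using that K(1) by blast
qed

text \<open>With \<open>s\<^sub>k = p x\<^sub>k\<close>, pairing with the analytic family
  \<open>i0 (s\<^sub>k) powr (z - 1) * i1 (s\<^sub>k) powr - z\<close> turns \<open>\<Sum> s\<^sub>k\<close> into the value at \<open>\<theta>\<close> of a function
  which \<open>i_young\<close> bounds by \<open>(\<Sum> s\<^sub>k + R) / 2\<close> on the boundary.\<close>

lemma modular_at_\<theta>_le:
  fixes q :: "nat \<Rightarrow> complex \<Rightarrow> complex"
  assumes cont: "\<And>k. k < N \<Longrightarrow> continuous_on strip (q k)"
    and holo: "\<And>k. k < N \<Longrightarrow> q k holomorphic_on interior strip"
    and bdd: "\<And>k. k < N \<Longrightarrow> bounded (q k ` strip)"
    and A: "0 < A"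
    and left: "\<And>t. \<exists>r. (\<forall>k<N. 0 \<le> r k \<and> cmod (q k (Complex 0 t)) \<le> A * i0 (r k)) \<and> (\<Sum>k<N. r k) \<le> R"
    and right: "\<And>t. \<exists>r. (\<forall>k<N. 0 \<le> r k \<and> cmod (q k (Complex 1 t)) \<le> A * i1 (r k)) \<and> (\<Sum>k<N. r k) \<le> R"
  shows "(\<Sum>k<N. p (q k (of_real \<theta>) / of_real (2 * A))) \<le> R"
proof -
  define x where "x = (\<lambda>k. q k (of_real \<theta>) / of_real (2 * A))"
  define s where "s = (\<lambda>k. p (x k))"
  \<comment> \<open>Indices with \<open>x k = 0\<close> contribute nothing and are left out, so that
    both logarithms in \<open>w\<close> have positive arguments.\<close>
  define I where "I = {k. k < N \<and> x k \<noteq> 0}"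
  have fin: "finite I" and IN: "I \<subseteq> {..<N}" by (auto simp: I_def)
  have s: "0 < s k" if "k \<in> I" for k using that p_pos by (simp add: I_def s_def)
  have a: "0 < i0 (s k)" and b: "0 < i1 (s k)" if "k \<in> I" for k
    using s[OF that] X0.i_pos X1.i_pos by auto
  \<comment> \<open>\<open>w k\<close> is \<open>s k\<close> divided by the extremal function
    through \<open>x k\<close>; the conjugate inverts the unimodular sign. At \<theta> its product
    with \<open>q k z / (2 * A)\<close> is therefore exactly \<open>s k\<close>.\<close>
  define w where "w = (\<lambda>k z. exp ((z - 1) * of_real (ln (i0 (s k)))) * exp (- z * of_real (ln (i1 (s k)))) *
      of_real (s k) * cnj (sgn (x k)))"
  have nsgn: "cmod (sgn (x k)) = 1" if "k \<in> I" for k using that by (simp add: I_def norm_sgn)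
  have nw: "cmod (w k z) = exp ((Re z - 1) * ln (i0 (s k))) * exp (- Re z * ln (i1 (s k))) * s k" if "k \<in> I" for k z
    using s[OF that] nsgn[OF that] by (simp add: w_def norm_mult)
  define F where "F = (\<lambda>z. \<Sum>k\<in>I. q k z / of_real (2 * A) * w k z)"
  have F\<theta>: "F (of_real \<theta>) = of_real (\<Sum>k\<in>I. s k)"
  proof -
    have "q k (of_real \<theta>) / of_real (2 * A) * w k (of_real \<theta>) = of_real (s k)" if k: "k \<in> I" for k
    proof -
      have "x k * cnj (sgn (x k)) = of_real (\<iota> (s k))"
        by (simp add: s_def \<iota>_p mult_cnj_sgn)
      moreover have "exp ((of_real \<theta> - 1) * of_real (ln (i0 (s k)))) * exp (- of_real \<theta> * of_real (ln (i1 (s k)))) * of_real (\<iota> (s k)) = (1::complex)"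
        (is "?e0 * ?e1 * _ = _")
      proof -
        have "exp ((\<theta> - 1) * ln (i0 (s k))) * exp (- \<theta> * ln (i1 (s k))) * \<iota> (s k) = 1"
          using a[OF k] b[OF k] by (simp add: \<iota>_def powr_def exp_add[symmetric] algebra_simps)
        then have "of_real (exp ((\<theta> - 1) * ln (i0 (s k))) * exp (- \<theta> * ln (i1 (s k))) * \<iota> (s k)) = (1::complex)"
          by (simp only: of_real_1)
        then show ?thesis by (simp add: exp_of_real[symmetric])
      qed
      moreover have "q k (of_real \<theta>) / of_real (2 * A) * w k (of_real \<theta>) = x k * (?e0 * ?e1 * of_real (s k) * cnj (sgn (x k)))"
        by (simp only: x_def w_def)
      moreover have "\<dots> = (?e0 * ?e1 * (x k * cnj (sgn (x k)))) * of_real (s k)" by (simp only: mult_ac)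
      ultimately show ?thesis by (simp only: mult_1)
    qed
    then show ?thesis by (simp add: F_def)
  qed
  have bound: "cmod (F z) \<le> ((\<Sum>k\<in>I. s k) + R) / 2"
    if z: "z \<in> strip" "Re z = 0 \<or> Re z = 1" for z
  proof -
    have "\<exists>r. (\<forall>k\<in>I. 0 \<le> r k \<and> cmod (q k z / of_real (2 * A) * w k z) \<le> (s k + r k) / 2) \<and> (\<Sum>k<N. r k) \<le> R \<and> (\<forall>k<N. 0 \<le> r k)"
      using z(2)
    proof
      assume "Re z = 0"
      then have z: "z = Complex 0 (Im z)" by (simp add: complex_eq_iff)
      obtain r where r: "\<And>k. k < N \<Longrightarrow> 0 \<le> r k \<and> cmod (q k z) \<le> A * i0 (r k)" "(\<Sum>k<N. r k) \<le> R"
        using left[of "Im z"] z by auto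
      have "cmod (q k z / of_real (2 * A) * w k z) \<le> (s k + r k) / 2" if k: "k \<in> I" for k
      proof -
        have kN: "k < N" using k IN by auto
        have "cmod (w k z) = s k / i0 (s k)"
          using a[OF k] \<open>Re z = 0\<close> by (simp add: nw[OF k] exp_minus divide_inverse mult.commute)
        then show ?thesis
          using X0.i_young_scaled[OF _ s[OF k] A, of "r k"] r(1)[OF kN] A by (simp add: norm_mult norm_divide)
      qed
      then show ?thesis using r IN by (intro exI[of _ r]) auto
    next
      assume "Re z = 1"
      then have z: "z = Complex 1 (Im z)" by (simp add: complex_eq_iff)
      obtain r where r: "\<And>k. k < N \<Longrightarrow> 0 \<le> r k \<and> cmod (q k z) \<le> A * i1 (r k)" "(\<Sum>k<N. r k) \<le> R"
        using right[of "Im z"] z by auto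
      have "cmod (q k z / of_real (2 * A) * w k z) \<le> (s k + r k) / 2" if k: "k \<in> I" for k
      proof -
        have kN: "k < N" using k IN by auto
        have "cmod (w k z) = s k / i1 (s k)"
          using b[OF k] \<open>Re z = 1\<close> by (simp add: nw[OF k] exp_minus divide_inverse mult.commute)
        then show ?thesis
          using X1.i_young_scaled[OF _ s[OF k] A, of "r k"] r(1)[OF kN] A by (simp add: norm_mult norm_divide)
      qed
      then show ?thesis using r IN by (intro exI[of _ r]) auto
    qed
    then obtain r where r: "\<And>k. k \<in> I \<Longrightarrow> cmod (q k z / of_real (2 * A) * w k z) \<le> (s k + r k) / 2"
      "(\<Sum>k<N. r k) \<le> R" "\<And>k. k < N \<Longrightarrow> 0 \<le> r k" by blast
    have "cmod (F z) \<le> (\<Sum>k\<in>I. (s k + r k) / 2)" unfolding F_def by (rule sum_norm_le) (rule r)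
    also have "\<dots> = ((\<Sum>k\<in>I. s k) + (\<Sum>k\<in>I. r k)) / 2" by (simp add: sum.distrib sum_divide_distrib[symmetric])
    also have "(\<Sum>k\<in>I. r k) \<le> (\<Sum>k<N. r k)" using r(3) IN by (intro sum_mono2) auto
    finally show ?thesis using r(2) by simp
  qed
  have wcont: "continuous_on S (w k)" and wholo: "w k holomorphic_on S" for k S
    unfolding w_def by (intro continuous_intros holomorphic_intros)+
  have bddF: "bounded (F ` strip)"
  proof -
    have "\<exists>B. \<forall>z\<in>strip. cmod (q k z / of_real (2 * A) * w k z) \<le> B" if k: "k \<in> I" for k
    proof -
      obtain B where B: "\<And>z. z \<in> strip \<Longrightarrow> cmod (q k z) \<le> B" using bdd[of k] k IN by (auto simp: bounded_iff)
      have "cmod (w k z) \<le> exp \<bar>ln (i0 (s k))\<bar> * exp \<bar>ln (i1 (s k))\<bar> * s k" if z: "z \<in> strip" for z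
      proof -
        have abs: "c * l \<le> \<bar>l\<bar>" if "\<bar>c\<bar> \<le> 1" for c l :: real
        proof -
          have "c * l \<le> \<bar>c\<bar> * \<bar>l\<bar>" by (metis abs_ge_self abs_mult)
          also have "\<dots> \<le> 1 * \<bar>l\<bar>" using that by (intro mult_right_mono) auto
          finally show ?thesis by simp
        qed
        have "(Re z - 1) * ln (i0 (s k)) \<le> \<bar>ln (i0 (s k))\<bar>" "- Re z * ln (i1 (s k)) \<le> \<bar>ln (i1 (s k))\<bar>"
          by (rule abs, use z in \<open>simp add: strip_def\<close>)+
        then show ?thesis unfolding nw[OF k] using s[OF k] by (intro mult_right_mono mult_mono) auto
      qed
      then have "cmod (q k z / of_real (2 * A) * w k z) \<le> B / (2 * A) * (exp \<bar>ln (i0 (s k))\<bar> * exp \<bar>ln (i1 (s k))\<bar> * s k)"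
        if z: "z \<in> strip" for z
        unfolding norm_mult using B[OF z] A z s[OF k] order_trans[OF norm_ge_zero B[OF z]]
        by (intro mult_mono) (auto simp: norm_divide intro!: divide_right_mono)
      then show ?thesis by blast
    qed
    then obtain B where "\<And>k z. k \<in> I \<Longrightarrow> z \<in> strip \<Longrightarrow> cmod (q k z / of_real (2 * A) * w k z) \<le> B k" by metis
    then have "cmod (F z) \<le> (\<Sum>k\<in>I. B k)" if "z \<in> strip" for z
      unfolding F_def using that by (intro sum_norm_le) auto
    then show ?thesis by (auto simp: bounded_iff)
  qed
  have contF: "continuous_on strip F"
    unfolding F_def using cont IN A by (intro continuous_intros wcont) auto
  have holoF: "F holomorphic_on interior strip"
    unfolding F_def using holo IN A by (intro holomorphic_intros wholo) auto
  have "cmod (F (of_real \<theta>)) \<le> ((\<Sum>k\<in>I. s k) + R) / 2"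
    by (rule strip_maximum_principle[OF contF holoF bddF bound]) (use \<theta> in \<open>auto simp: strip_def\<close>)
  moreover have "0 \<le> (\<Sum>k\<in>I. s k)" using s by (intro sum_nonneg) (auto simp: less_imp_le)
  ultimately have "(\<Sum>k\<in>I. s k) \<le> R" unfolding F\<theta> norm_of_real by simp
  moreover have "(\<Sum>k<N. s k) = (\<Sum>k\<in>I. s k)"
    using IN by (intro sum.mono_neutral_right) (auto simp: I_def s_def p_0)
  ultimately show ?thesis by (simp add: s_def x_def)
qed

end

section \<open>The functions \<open>g\<^sub>x\<close>\<close>

lemma (in calibrated) i_dominated:
  assumes "0 \<le> s" "s \<le> K * t" "1 \<le> K" "0 \<le> t" "t \<le> u"
  shows "i s \<le> K * i u"
proof -
  have "i s \<le> i (K * t)" using assms by (intro i_mono) auto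
  also have "\<dots> \<le> K * i t" using assms by (intro i_dilate)
  also have "\<dots> \<le> K * i u" using assms by (intro mult_left_mono i_mono) auto
  finally show ?thesis .
qed

text \<open>A norm below \<open>\<rho> * \<epsilon>\<close> gives a majorant of total at most
  \<epsilon> with constant \<rho>, independent of \<epsilon>. Merging it with the given
  \<open>t\<close> into \<open>r + t\<close> adds the constants and the totals, by monotonicity of
  \<open>i\<close>. This handles the boundary values of a difference of two liftings.\<close>

lemma (in calibrated) majorant_add:
  assumes x: "x \<in> carr Y" "nrm Y x < \<rho> * \<epsilon>" and \<epsilon>: "0 < \<epsilon>" "\<epsilon> \<le> 1" and \<rho>: "0 < \<rho>" and A: "0 < A"
    and t: "\<And>k. 0 \<le> t k" "(\<Sum>k<N. t k) \<le> M" and u: "\<And>k. u k \<le> cmod (x k) + A * i (t k)"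
  shows "\<exists>r. (\<forall>k<N. 0 \<le> r k \<and> u k \<le> (\<rho> + A) * i (r k)) \<and> (\<Sum>k<N. r k) \<le> \<epsilon> + M"
proof -
  obtain r where r: "\<And>k. 0 \<le> r k \<and> cmod (x k) \<le> \<rho> * \<epsilon> / \<epsilon> * i (r k)" "\<And>N. (\<Sum>k<N. r k) \<le> \<epsilon>"
    using ball_majorant[OF x \<epsilon>] by blast
  have "u k \<le> (\<rho> + A) * i (r k + t k)" for k
  proof -
    have "u k \<le> \<rho> * i (r k) + A * i (t k)" using u[of k] r(1)[of k] \<epsilon> by auto
    also have "\<dots> \<le> \<rho> * i (r k + t k) + A * i (r k + t k)"
      using \<rho> A r(1)[of k] t(1)[of k] by (intro add_mono mult_left_mono i_mono) auto
    finally show ?thesis by (simp add: algebra_simps)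
  qed
  then show ?thesis
    using r t by (intro exI[of _ "\<lambda>k. r k + t k"]) (auto simp: sum.distrib add_mono)
qed

context interpolation
begin

abbreviation gs :: "complex \<Rightarrow> complex \<Rightarrow> complex" where "gs \<equiv> g_scalar i0 i1 \<theta>"
abbreviation G :: "complex list \<Rightarrow> complex \<Rightarrow> complex" where "G \<equiv> g_tuple i0 i1 \<theta> h"
abbreviation P :: "complex list \<Rightarrow> real" where "P \<equiv> phi_theta_tuple i0 i1 \<theta> h"

lemma gs_0: "gs 0 z = 0"
  by (simp add: g_scalar_def)

lemma p_parts_pos: "x \<noteq> 0 \<Longrightarrow> 0 < i0 (p x)" "x \<noteq> 0 \<Longrightarrow> 0 < i1 (p x)"
  using p_pos X0.i_pos X1.i_pos by auto

lemma gs_eq: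
  assumes "x \<noteq> 0"
  shows "gs x = (\<lambda>z. exp ((1 - z) * of_real (ln (i0 (p x)))) * exp (z * of_real (ln (i1 (p x)))) * sgn x)"
  using p_parts_pos[OF assms] by (auto simp: g_scalar_def p_cmod powr_def Ln_of_real fun_eq_iff)

lemma holomorphic_gs: "gs x holomorphic_on S"
proof (cases "x = 0")
  case True
  then have "gs x = (\<lambda>z. 0)" by (simp add: fun_eq_iff gs_0)
  then show ?thesis by simp
next
  case False
  show ?thesis unfolding gs_eq[OF False] by (intro holomorphic_intros)
qed

lemma continuous_gs: "continuous_on S (gs x)"
  by (rule holomorphic_on_imp_continuous_on[OF holomorphic_gs])

lemma cmod_gs:
  assumes "x \<noteq> 0"
  shows "cmod (gs x z) = i0 (p x) powr (1 - Re z) * i1 (p x) powr Re z"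
  unfolding gs_eq[OF assms] using p_parts_pos[OF assms] assms
  by (simp add: norm_mult norm_sgn powr_def)

lemma cmod_gs_left: "cmod (gs x (Complex 0 t)) \<le> i0 (p x)"
  using p_parts_pos[of x] X0.i_nonneg[OF p_nonneg[of x]] by (cases "x = 0") (simp_all add: gs_0 cmod_gs)

lemma cmod_gs_right: "cmod (gs x (Complex 1 t)) \<le> i1 (p x)"
  using p_parts_pos[of x] X1.i_nonneg[OF p_nonneg[of x]] by (cases "x = 0") (simp_all add: gs_0 cmod_gs)

lemma cmod_gs_le:
  assumes z: "z \<in> strip"
  shows "cmod (gs x z) \<le> i0 (p x) + i1 (p x)"
proof (cases "x = 0")
  case True
  then show ?thesis using X0.i_nonneg[OF p_nonneg[of x]] X1.i_nonneg[OF p_nonneg[of x]] by (simp add: gs_0)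
next
  case False
  define m where "m = max (i0 (p x)) (i1 (p x))"
  have m: "0 < m" using p_parts_pos[OF False] by (simp add: m_def)
  have "cmod (gs x z) \<le> m powr (1 - Re z) * m powr Re z"
    unfolding cmod_gs[OF False] using z p_parts_pos[OF False]
    by (intro mult_mono powr_mono2) (auto simp: strip_def m_def)
  also have "\<dots> = m" using m by (simp add: powr_add[symmetric])
  also have "\<dots> \<le> i0 (p x) + i1 (p x)" using p_parts_pos[OF False] by (simp add: m_def)
  finally show ?thesis .
qed

lemma gs_\<theta>: "gs x (of_real \<theta>) = x"
proof -
  have "complex_of_real a powr (1 - of_real \<theta>) = of_real (a powr (1 - \<theta>))" if "0 \<le> a" for a
    using powr_of_real[OF that, of "1 - \<theta>"] by simp
  then have "gs x (of_real \<theta>) = of_real (\<iota> (p x)) * sgn x"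
    using X0.i_nonneg[OF p_nonneg[of x]] X1.i_nonneg[OF p_nonneg[of x]]
    by (simp add: g_scalar_def p_cmod \<iota>_def powr_of_real)
  then show ?thesis by (simp add: \<iota>_p sgn_eq)
qed

text \<open>The quantity subtracted from the coordinate of index \<open>length xs\<close> in \<open>\<phi>\<^sub>\<theta>\<^sub>,\<^sub>n\<close>.\<close>

definition \<omega> :: "complex list \<Rightarrow> complex" where "\<omega> xs = taylor_coeff (G xs) (length xs) (of_real \<theta>)"

lemma \<omega>_Nil: "\<omega> [] = 0"
  by (simp add: \<omega>_def taylor_coeff_0)

text \<open>For an empty tail the power of \<open>h\<close> and the constant are both 1 and \<omega>
  is 0, so one equation also covers singletons and inductions can run over all lists.\<close>

lemma G_Cons:
  "G (x # ys) = (\<lambda>z. G ys z + h z ^ length ys *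
     (inverse (fact (Suc (length ys)) * deriv h (of_real \<theta>) ^ length ys) *
      gs (fact (Suc (length ys)) * (x - \<omega> ys)) z))"
  by (cases ys) (auto simp: \<omega>_def Let_def divide_inverse mult_ac taylor_coeff_0)

lemma P_Cons: "P (x # ys) = P ys + p (x - \<omega> ys)"
  by (cases ys) (auto simp: \<omega>_def Let_def taylor_coeff_0)

declare g_tuple.simps(2,3) [simp del] phi_theta_tuple.simps(2,3) [simp del]

lemma P_nonneg: "0 \<le> P xs"
  by (induction xs) (auto simp: P_Cons p_nonneg)

lemma
  shows continuous_G: "continuous_on strip (G xs)"
    and holomorphic_G: "G xs holomorphic_on interior strip"
    and bounded_G: "bounded (G xs ` strip)"
proof (induction xs)
  case (Cons x ys)
  have conth: "continuous_on strip h" and holoh: "h holomorphic_on interior strip"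
    and hle: "\<And>z. z \<in> strip \<Longrightarrow> cmod (h z) \<le> 1" using h by (auto simp: strip_conformal_def)
  {
    case 1 then show ?case unfolding G_Cons by (intro continuous_intros conth continuous_gs Cons.IH)
  next
    case 2 then show ?case unfolding G_Cons by (intro holomorphic_intros holoh holomorphic_gs Cons.IH)
  next
    case 3
    let ?k = "inverse (fact (Suc (length ys)) * deriv h (of_real \<theta>) ^ length ys) :: complex"
    let ?v = "fact (Suc (length ys)) * (x - \<omega> ys)"
    obtain B where B: "\<And>z. z \<in> strip \<Longrightarrow> cmod (G ys z) \<le> B" using Cons.IH(3) by (auto simp: bounded_iff)
    have "cmod (G (x # ys) z) \<le> B + 1 * (cmod ?k * (i0 (p ?v) + i1 (p ?v)))" if z: "z \<in> strip" for z
    proof -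
      have "cmod (G (x # ys) z) \<le> cmod (G ys z) + cmod (h z) ^ length ys * (cmod ?k * cmod (gs ?v z))"
        unfolding G_Cons using norm_triangle_ineq by (simp only: norm_mult[symmetric] norm_power[symmetric])
      also have "\<dots> \<le> B + 1 * (cmod ?k * (i0 (p ?v) + i1 (p ?v)))"
        using hle[OF z] by (intro add_mono B z mult_mono mult_left_mono cmod_gs_le power_le_one) auto
      finally show ?thesis .
    qed
    then show ?case unfolding bounded_iff by blast
  }
qed (auto simp: bounded_iff)

text \<open>The last summand vanishes to order \<open>length ys\<close>, so the lower coefficients
  are inherited. Its own coefficient is \<open>x - \<omega> ys\<close>, since the factorial and the
  power of the derivative of \<open>h\<close> cancel; this corrects the coefficient \<omega> of the
  tail to \<open>x\<close>.\<close>

lemma taylor_coeff_G: "j < length xs \<Longrightarrow> taylor_coeff (G xs) j (of_real \<theta>) = rev xs ! j"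
proof (induction xs arbitrary: j)
  case (Cons x ys)
  let ?\<theta> = "complex_of_real \<theta>"
  let ?m = "length ys"
  let ?k = "inverse (fact (Suc ?m) * deriv h ?\<theta> ^ ?m) :: complex"
  let ?v = "fact (Suc ?m) * (x - \<omega> ys)"
  let ?u = "\<lambda>z. ?k * gs ?v z"
  have \<theta>i: "?\<theta> \<in> interior strip" using of_real_interior_strip \<theta> by blast
  have holou: "?u holomorphic_on interior strip" by (intro holomorphic_intros holomorphic_gs)
  have holoh: "h holomorphic_on interior strip" using h by (simp add: strip_conformal_def)
  have "taylor_coeff (G (x # ys)) j ?\<theta> = taylor_coeff (G ys) j ?\<theta> + taylor_coeff (\<lambda>z. h z ^ ?m * ?u z) j ?\<theta>"
    unfolding G_Cons
    by (rule taylor_coeff_add[OF holomorphic_G _ open_interior \<theta>i]) (intro holomorphic_intros holomorphic_gs holoh)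
  also have "\<dots> = rev (x # ys) ! j"
  proof (cases "j < ?m")
    case True
    then show ?thesis using Cons.IH[OF True] taylor_coeff_conformal_power(1)[OF h \<theta> holou True] by (simp add: nth_append)
  next
    case False
    then have j: "j = ?m" using Cons.prems by simp
    have "taylor_coeff (\<lambda>z. h z ^ ?m * ?u z) ?m ?\<theta> = deriv h ?\<theta> ^ ?m * (?k * ?v)"
      using taylor_coeff_conformal_power(2)[OF h \<theta> holou, of ?m] by (simp add: gs_\<theta>)
    also have "\<dots> = x - \<omega> ys"
      using strip_conformal_deriv_nonzero[OF h \<theta>] by (simp add: field_simps del: fact_Suc)
    finally show ?thesis unfolding j by (simp add: nth_append \<omega>_def)
  qed
  finally show ?case .
qed simp

text \<open>The constant depends on the length only. The factorial inside \<open>gs\<close> is paid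
  for by the dilation estimate for \<open>p\<close>, the resulting \<open>K\<close> leaves
  \<open>i\<close> by \<open>i_dominated\<close>, and \<open>P xs\<close> dominates both the modular
  of the tail and that of the corrected head.\<close>

lemma G_boundary_bound:
  obtains A where "0 < A"
    "\<And>xs t. length xs = n \<Longrightarrow> cmod (G xs (Complex 0 t)) \<le> A * i0 (P xs)"
    "\<And>xs t. length xs = n \<Longrightarrow> cmod (G xs (Complex 1 t)) \<le> A * i1 (P xs)"
proof -
  have "\<exists>A>0. \<forall>xs t. length xs = n \<longrightarrow> cmod (G xs (Complex 0 t)) \<le> A * i0 (P xs) \<and>
      cmod (G xs (Complex 1 t)) \<le> A * i1 (P xs)"
  proof (induction n)
    case 0
    then show ?case using X0.i_nonneg[of 0] X1.i_nonneg[of 0] by (intro exI[of _ 1]) auto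
  next
    case (Suc m)
    obtain A where A: "0 < A" "\<And>xs t. length xs = m \<Longrightarrow> cmod (G xs (Complex 0 t)) \<le> A * i0 (P xs)"
      "\<And>xs t. length xs = m \<Longrightarrow> cmod (G xs (Complex 1 t)) \<le> A * i1 (P xs)" using Suc.IH by blast
    obtain K where K: "1 \<le> K" "\<And>x y. cmod y \<le> fact (Suc m) * cmod x \<Longrightarrow> p y \<le> K * p x"
      by (rule p_dominated) blast
    define \<kappa> where "\<kappa> = cmod (inverse (fact (Suc m) * deriv h (of_real \<theta>) ^ m))"
    have \<kappa>: "0 \<le> \<kappa>" by (simp add: \<kappa>_def)
    show ?case
    proof (intro exI[of _ "A + \<kappa> * K"] conjI allI impI)
      show "0 < A + \<kappa> * K" using A(1) K(1) \<kappa> by (simp add: add_pos_nonneg)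
      fix xs :: "complex list" and t :: real assume "length xs = Suc m"
      then obtain x ys where xs: "xs = x # ys" "length ys = m" by (cases xs) auto
      define w where "w = x - \<omega> ys"
      have pv: "p (fact (Suc m) * w) \<le> K * p w"
        by (rule K(2)) (simp add: norm_mult del: fact_Suc)
      have Pxs: "P xs = P ys + p w" by (simp add: xs P_Cons w_def)
      have step: "cmod (G xs z) \<le> A * a + \<kappa> * (K * a)"
        if z: "z \<in> strip" and "cmod (G ys z) \<le> A * a" "cmod (gs (fact (Suc m) * w) z) \<le> K * a" for z a
      proof -
        have "cmod (h z) ^ m \<le> 1" using h z by (intro power_le_one) (auto simp: strip_conformal_def)
        have "cmod (G xs z) \<le> cmod (G ys z) + cmod (h z) ^ m * (\<kappa> * cmod (gs (fact (Suc m) * w) z))"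
          unfolding xs G_Cons xs(2) \<kappa>_def w_def using norm_triangle_ineq
          by (simp only: norm_mult[symmetric] norm_power[symmetric])
        also have "\<dots> \<le> A * a + 1 * (\<kappa> * (K * a))"
          using \<open>cmod (h z) ^ m \<le> 1\<close> \<kappa> that by (intro add_mono mult_mono) auto
        finally show ?thesis by simp
      qed
      have Pys: "P ys \<le> P xs" and Pw: "p w \<le> P xs"
        unfolding Pxs using P_nonneg[of ys] p_nonneg[of w] by auto
      have "cmod (gs (fact (Suc m) * w) (Complex 0 t)) \<le> K * i0 (P xs)"
        using cmod_gs_left[of "fact (Suc m) * w" t] X0.i_dominated[OF p_nonneg pv K(1) _ Pw] p_nonneg by (meson order_trans)
      moreover have "cmod (G ys (Complex 0 t)) \<le> A * i0 (P xs)"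
        by (rule order_trans[OF A(2)[OF xs(2)]]) (use A(1) X0.i_mono[OF P_nonneg Pys] in auto)
      ultimately have "cmod (G xs (Complex 0 t)) \<le> A * i0 (P xs) + \<kappa> * (K * i0 (P xs))"
        by (intro step) (auto simp: strip_def)
      then show "cmod (G xs (Complex 0 t)) \<le> (A + \<kappa> * K) * i0 (P xs)" by (simp add: algebra_simps)
      have "cmod (gs (fact (Suc m) * w) (Complex 1 t)) \<le> K * i1 (P xs)"
        using cmod_gs_right[of "fact (Suc m) * w" t] X1.i_dominated[OF p_nonneg pv K(1) _ Pw] p_nonneg by (meson order_trans)
      moreover have "cmod (G ys (Complex 1 t)) \<le> A * i1 (P xs)"
        by (rule order_trans[OF A(3)[OF xs(2)]]) (use A(1) X1.i_mono[OF P_nonneg Pys] in auto)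
      ultimately have "cmod (G xs (Complex 1 t)) \<le> A * i1 (P xs) + \<kappa> * (K * i1 (P xs))"
        by (intro step) (auto simp: strip_def)
      then show "cmod (G xs (Complex 1 t)) \<le> (A + \<kappa> * K) * i1 (P xs)" by (simp add: algebra_simps)
    qed
  qed
  then show ?thesis using that by blast
qed

section \<open>Comparison of two liftings\<close>

text \<open>Only scalar information on each coordinate is recorded, which is all that division by
  powers of \<open>h\<close> uses. The reversal is due to tuples being listed from the highest index
  down; \<open>n = 0\<close> prescribes nothing.\<close>

definition lifts :: "(complex \<Rightarrow> cseq) \<Rightarrow> nat \<Rightarrow> (nat \<Rightarrow> complex list) \<Rightarrow> bool" where
  "lifts F n X \<longleftrightarrow> (\<forall>k. continuous_on strip (\<lambda>z. F z k) \<and> (\<lambda>z. F z k) holomorphic_on interior strip \<and>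
     bounded ((\<lambda>z. F z k) ` strip) \<and> length (X k) = n \<and>
     (\<forall>j<n. taylor_coeff (\<lambda>z. F z k) j (of_real \<theta>) = rev (X k) ! j))"

definition boundary_less :: "(complex \<Rightarrow> cseq) \<Rightarrow> real \<Rightarrow> bool" where
  "boundary_less F R \<longleftrightarrow> (\<forall>t. F (Complex 0 t) \<in> carr X0 \<and> nrm X0 (F (Complex 0 t)) < R \<and>
     F (Complex 1 t) \<in> carr X1 \<and> nrm X1 (F (Complex 1 t)) < R)"

text \<open>Two liftings of the same \<open>n\<close>-tuple, one from the couple and one given by \<open>G\<close>, have \<open>n\<close>-th
  coefficients that differ by an element of the \<open>\<phi>\<^sub>\<theta>\<close>-space: divide the difference by
  \<open>h ^ n\<close>. For \<open>n = 0\<close> this bounds the evaluation at \<open>\<theta>\<close>.\<close>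

lemma modular_coeff_difference:
  assumes \<rho>: "0 < \<rho>"
  obtains K where "1 \<le> K"
    "\<And>F X \<epsilon> M N. lifts F n X \<Longrightarrow> 0 < \<epsilon> \<Longrightarrow> \<epsilon> \<le> 1 \<Longrightarrow> boundary_less F (\<rho> * \<epsilon>) \<Longrightarrow> (\<Sum>k<N. P (X k)) \<le> M \<Longrightarrow>
      (\<Sum>k<N. p (taylor_coeff (\<lambda>z. F z k) n (of_real \<theta>) - \<omega> (X k))) \<le> K * (\<epsilon> + M)"
proof -
  let ?\<theta> = "complex_of_real \<theta>"
  have \<theta>i: "?\<theta> \<in> interior strip" using of_real_interior_strip \<theta> by blast
  obtain A where A: "0 < A" "\<And>xs t. length xs = n \<Longrightarrow> cmod (G xs (Complex 0 t)) \<le> A * i0 (P xs)"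
    "\<And>xs t. length xs = n \<Longrightarrow> cmod (G xs (Complex 1 t)) \<le> A * i1 (P xs)"
    by (rule G_boundary_bound) blast
  \<comment> \<open>The dilation factor undoes the two normalisations of the quotient
    \<open>q\<close>: division by \<open>2 * (\<rho> + A)\<close> in
    \<open>modular_at_\<theta>_le\<close>, and by the \<open>n\<close>-th power of the derivative of
    \<open>h\<close>.\<close>
  obtain K where K: "1 \<le> K" "\<And>x y. cmod y \<le> (2 * (\<rho> + A) * cmod (deriv h ?\<theta>) ^ n) * cmod x \<Longrightarrow> p y \<le> K * p x"
    by (rule p_dominated) blast
  show ?thesis
  proof (rule that[OF K(1)])
    fix F X \<epsilon> M N
    assume lifts: "lifts F n X" and \<epsilon>: "0 < \<epsilon>" "\<epsilon> \<le> 1" and bdry: "boundary_less F (\<rho> * \<epsilon>)"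
      and M: "(\<Sum>k<N. P (X k)) \<le> M"
    have cont: "\<And>k. continuous_on strip (\<lambda>z. F z k)" and holo: "\<And>k. (\<lambda>z. F z k) holomorphic_on interior strip"
      and bdd: "\<And>k. bounded ((\<lambda>z. F z k) ` strip)" and len: "\<And>k. length (X k) = n"
      and coeff: "\<And>k j. j < n \<Longrightarrow> taylor_coeff (\<lambda>z. F z k) j ?\<theta> = rev (X k) ! j"
      using lifts by (auto simp: lifts_def)
    define f where "f = (\<lambda>k z. F z k - G (X k) z)"
    define D where "D = (\<lambda>k. taylor_coeff (\<lambda>z. F z k) n ?\<theta> - \<omega> (X k))"
    have tcf: "taylor_coeff (f k) j ?\<theta> = taylor_coeff (\<lambda>z. F z k) j ?\<theta> - taylor_coeff (G (X k)) j ?\<theta>" for k j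
      unfolding f_def by (rule taylor_coeff_diff[OF holo holomorphic_G open_interior \<theta>i])
    have "\<exists>q. continuous_on strip q \<and> q holomorphic_on interior strip \<and> bounded (q ` strip) \<and>
      (\<forall>z\<in>strip. Re z = 0 \<or> Re z = 1 \<longrightarrow> cmod (q z) = cmod (f k z)) \<and> q ?\<theta> = D k / deriv h ?\<theta> ^ n" for k
    proof -
      have "continuous_on strip (f k)" unfolding f_def by (intro continuous_intros cont continuous_G)
      moreover have "f k holomorphic_on interior strip" unfolding f_def by (intro holomorphic_intros holo holomorphic_G)
      moreover have "bounded (f k ` strip)" unfolding f_def by (intro bounded_minus_comp bdd bounded_G)
      moreover have "taylor_coeff (f k) j ?\<theta> = 0" if "j < n" for j
        using taylor_coeff_G[of j "X k"] that by (simp add: tcf coeff len)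
      ultimately obtain q where "continuous_on strip q" "q holomorphic_on interior strip" "bounded (q ` strip)"
        "\<And>z. z \<in> strip \<Longrightarrow> Re z = 0 \<or> Re z = 1 \<Longrightarrow> norm (q z) = norm (f k z)"
        "q ?\<theta> = taylor_coeff (f k) n ?\<theta> / deriv h ?\<theta> ^ n"
        using divide_by_conformal_power[OF h \<theta>] by blast
      then show ?thesis by (intro exI[of _ q]) (auto simp: tcf D_def \<omega>_def len)
    qed
    then obtain q where q: "\<And>k. continuous_on strip (q k)" "\<And>k. q k holomorphic_on interior strip"
      "\<And>k. bounded (q k ` strip)"
      "\<And>k z. z \<in> strip \<Longrightarrow> Re z = 0 \<or> Re z = 1 \<Longrightarrow> cmod (q k z) = cmod (f k z)"
      "\<And>k. q k ?\<theta> = D k / deriv h ?\<theta> ^ n" by metis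
    have le: "(\<Sum>k<N. p (q k ?\<theta> / of_real (2 * (\<rho> + A)))) \<le> \<epsilon> + M"
    proof (rule modular_at_\<theta>_le)
      fix t
      have "cmod (q k (Complex 0 t)) \<le> cmod (F (Complex 0 t) k) + A * i0 (P (X k))" for k
      proof -
        have "cmod (q k (Complex 0 t)) \<le> cmod (F (Complex 0 t) k) + cmod (G (X k) (Complex 0 t))"
          by (subst q(4)) (auto simp: strip_def f_def norm_triangle_ineq4)
        then show ?thesis using A(2)[OF len, of k t] by linarith
      qed
      then show "\<exists>r. (\<forall>k<N. 0 \<le> r k \<and> cmod (q k (Complex 0 t)) \<le> (\<rho> + A) * i0 (r k)) \<and> (\<Sum>k<N. r k) \<le> \<epsilon> + M"
        using bdry by (intro X0.majorant_add[OF _ _ \<epsilon> \<rho> A(1) P_nonneg M]) (auto simp: boundary_less_def)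
    next
      fix t
      have "cmod (q k (Complex 1 t)) \<le> cmod (F (Complex 1 t) k) + A * i1 (P (X k))" for k
      proof -
        have "cmod (q k (Complex 1 t)) \<le> cmod (F (Complex 1 t) k) + cmod (G (X k) (Complex 1 t))"
          by (subst q(4)) (auto simp: strip_def f_def norm_triangle_ineq4)
        then show ?thesis using A(3)[OF len, of k t] by linarith
      qed
      then show "\<exists>r. (\<forall>k<N. 0 \<le> r k \<and> cmod (q k (Complex 1 t)) \<le> (\<rho> + A) * i1 (r k)) \<and> (\<Sum>k<N. r k) \<le> \<epsilon> + M"
        using bdry by (intro X1.majorant_add[OF _ _ \<epsilon> \<rho> A(1) P_nonneg M]) (auto simp: boundary_less_def)
    qed (use q \<rho> A(1) in auto)
    have "p (D k) \<le> K * p (q k ?\<theta> / of_real (2 * (\<rho> + A)))" for k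
    proof (rule K(2))
      have "D k = (of_real (2 * (\<rho> + A)) * deriv h ?\<theta> ^ n) * (q k ?\<theta> / of_real (2 * (\<rho> + A)))"
        using strip_conformal_deriv_nonzero[OF h \<theta>] \<rho> A(1)
        by (simp add: q(5) add_pos_pos less_imp_neq[THEN not_sym] del: of_real_add)
      then have "cmod (D k) = cmod (of_real (2 * (\<rho> + A)) * deriv h ?\<theta> ^ n) * cmod (q k ?\<theta> / of_real (2 * (\<rho> + A)))"
        by (metis norm_mult)
      also have "cmod (of_real (2 * (\<rho> + A)) * deriv h ?\<theta> ^ n) = 2 * (\<rho> + A) * cmod (deriv h ?\<theta>) ^ n"
        unfolding norm_mult norm_of_real norm_power using \<rho> A(1) by simp
      finally show "cmod (D k) \<le> (2 * (\<rho> + A) * cmod (deriv h ?\<theta>) ^ n) * cmod (q k ?\<theta> / of_real (2 * (\<rho> + A)))"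
        by simp
    qed
    then have "(\<Sum>k<N. p (D k)) \<le> K * (\<Sum>k<N. p (q k ?\<theta> / of_real (2 * (\<rho> + A))))"
      unfolding sum_distrib_left by (rule sum_mono)
    also have "\<dots> \<le> K * (\<epsilon> + M)" using le K(1) by (intro mult_left_mono) auto
    finally show "(\<Sum>k<N. p (taylor_coeff (\<lambda>z. F z k) n ?\<theta> - \<omega> (X k))) \<le> K * (\<epsilon> + M)"
      by (simp only: D_def)
  qed
qed

end

section \<open>The interpolation space\<close>

text \<open>The inverse square roots of the tails \<open>T k\<close> tend to infinity, and
  multiplying by them keeps the series summable: \<open>u k / sqrt (T k)\<close> is at most twice
  the increment of \<open>sqrt (T k)\<close>, which telescopes.\<close>

lemma exists_divergent_weights:
  fixes t :: "nat \<Rightarrow> real"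
  assumes t: "\<And>k. 0 \<le> t k" and M: "\<And>N. (\<Sum>k<N. t k) \<le> M"
  obtains L where "\<And>k. 1 \<le> L k" "filterlim L at_top sequentially"
    "\<And>N. (\<Sum>k<N. L k * t k) \<le> M + 2 * sqrt (M + 1)"
proof -
  \<comment> \<open>Adding a geometric series of sum 1 keeps the tails positive when
    \<open>t\<close> vanishes eventually; it is the 1 in \<open>M + 1\<close>.\<close>
  define u where "u = (\<lambda>k. t k + (1/2) ^ Suc k)"
  have u: "0 < u k" for k using t by (simp add: u_def add_nonneg_pos)
  have st: "summable t" by (rule summableI_nonneg_bounded[of t M]) (use t M in auto)
  have su: "summable u"
    unfolding u_def by (intro summable_add st sums_summable[OF power_half_series])
  define T where "T = (\<lambda>k. \<Sum>i. u (i + k))"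
  have Tpos: "0 < T k" for k
    unfolding T_def by (rule suminf_pos) (use su u summable_ignore_initial_segment in auto)
  have Tstep: "T k - T (Suc k) = u k" for k
    using suminf_split_head[of "\<lambda>i. u (i + k)"] su summable_ignore_initial_segment by (simp add: T_def)
  have T0: "T 0 \<le> M + 1"
  proof -
    have "T 0 = (\<Sum>k. t k) + 1"
      using suminf_add[OF st sums_summable[OF power_half_series]] sums_unique[OF power_half_series]
      by (simp add: T_def u_def)
    moreover have "(\<Sum>k. t k) \<le> M" by (rule suminf_le_const[OF st]) (use M in auto)
    ultimately show ?thesis by simp
  qed
  define L where "L = (\<lambda>k. 1 + 1 / sqrt (T k))"
  have "filterlim L at_top sequentially"
  proof -
    have "T \<longlonglongrightarrow> 0" unfolding T_def by (rule suminf_exist_split2[OF su])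
    then have "(\<lambda>k. sqrt (T k)) \<longlonglongrightarrow> sqrt 0" by (rule tendsto_real_sqrt)
    then have "filterlim (\<lambda>k. inverse (sqrt (T k))) at_top sequentially"
      using Tpos by (intro filterlim_inverse_at_top) auto
    then show ?thesis unfolding L_def
      using filterlim_tendsto_add_at_top[OF tendsto_const] by (simp add: divide_inverse)
  qed
  moreover have "1 \<le> L k" for k using Tpos[of k] by (simp add: L_def)
  moreover have "(\<Sum>k<N. L k * t k) \<le> M + 2 * sqrt (M + 1)" for N
  proof -
    have "L k * t k \<le> t k + 2 * (sqrt (T k) - sqrt (T (Suc k)))" for k
    proof -
      have le: "sqrt (T (Suc k)) \<le> sqrt (T k)" using Tstep[of k] u[of k] by simp
      have "u k = (sqrt (T k) - sqrt (T (Suc k))) * (sqrt (T k) + sqrt (T (Suc k)))"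
        using Tstep[of k] Tpos[of k] Tpos[of "Suc k"] by (simp add: algebra_simps)
      also have "\<dots> \<le> (sqrt (T k) - sqrt (T (Suc k))) * (2 * sqrt (T k))"
        using le by (intro mult_left_mono) auto
      finally have "u k / sqrt (T k) \<le> 2 * (sqrt (T k) - sqrt (T (Suc k)))"
        using Tpos[of k] by (simp add: pos_divide_le_eq mult_ac)
      moreover have "t k / sqrt (T k) \<le> u k / sqrt (T k)"
        using Tpos[of k] by (intro divide_right_mono) (auto simp: u_def)
      ultimately show ?thesis by (simp add: L_def distrib_right)
    qed
    then have "(\<Sum>k<N. L k * t k) \<le> (\<Sum>k<N. t k + 2 * (sqrt (T k) - sqrt (T (Suc k))))" by (rule sum_mono)
    also have "\<dots> = (\<Sum>k<N. t k) + 2 * (sqrt (T 0) - sqrt (T N))"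
      by (simp only: sum.distrib sum_distrib_left[symmetric] sum_lessThan_telescope'[of "\<lambda>k. sqrt (T k)"])
    also have "\<dots> \<le> M + 2 * sqrt (M + 1)"
    proof -
      have "sqrt (T 0) - sqrt (T N) \<le> sqrt (T 0)" using Tpos[of N] by simp
      also have "\<dots> \<le> sqrt (M + 1)" using T0 by simp
      finally show ?thesis by (intro add_mono M mult_left_mono) auto
    qed
    finally show ?thesis .
  qed
  ultimately show ?thesis using that by blast
qed

text \<open>A dominated convergence principle: continuity of the coordinates handles finitely many
  of them, and the divergent weights make the rest uniformly small. The space enters through the
  class dominated by \<open>m\<close>, so that the same lemma serves both endpoints and their
  sum.\<close>

lemma bdd_continuous_into_if_dominated:
  fixes f :: "'a::topological_space \<Rightarrow> cseq"
  assumes Y: "\<And>c \<gamma> y. filterlim c at_top sequentially \<Longrightarrow> 0 < \<gamma> \<Longrightarrow> (\<And>k. \<gamma> \<le> c k) \<Longrightarrow>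
      (\<And>k. cmod (y k) \<le> m k / c k) \<Longrightarrow> y \<in> carr Y \<and> 0 \<le> nrm Y y \<and> nrm Y y \<le> C / \<gamma>"
    and C: "0 < C" and c: "filterlim c at_top sequentially" "\<And>k. 1 \<le> c k"
    and bound: "\<And>z k. z \<in> S \<Longrightarrow> cmod (f z k) \<le> m k / c k"
    and cont: "\<And>z k. z \<in> S \<Longrightarrow> ((\<lambda>w. f w k) \<longlongrightarrow> f z k) (at z within S)"
  shows "bdd_continuous_into Y S f" "\<And>z. z \<in> S \<Longrightarrow> nrm Y (f z) \<le> C"
proof -
  have mem: "f z \<in> carr Y" "nrm Y (f z) \<le> C" if "z \<in> S" for z
    using Y[OF c(1) zero_less_one c(2) bound[OF that]] by auto
  then show "\<And>z. z \<in> S \<Longrightarrow> nrm Y (f z) \<le> C" by blast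
  have "((\<lambda>w. nrm Y (\<lambda>k. f w k - f z k)) \<longlongrightarrow> 0) (at z within S)" if z: "z \<in> S" for z
  proof (rule tendstoI)
    fix e :: real assume e: "0 < e"
    define \<gamma> where "\<gamma> = 2 * C / e"
    have \<gamma>: "0 < \<gamma>" "C / \<gamma> < e" using e C by (auto simp: \<gamma>_def)
    obtain N where N: "\<And>k. k \<ge> N \<Longrightarrow> 2 * \<gamma> \<le> c k"
      using c(1) by (auto simp: filterlim_at_top eventually_sequentially)
    \<comment> \<open>Below \<open>N\<close> the weight \<gamma> is reached by coordinatewise
      continuity; beyond \<open>N\<close> half of \<open>c k\<close> remains after adding the bounds
      for \<open>f w\<close> and \<open>f z\<close>, and the choice of \<open>N\<close> keeps it
      above \<gamma>.\<close>
    define c' where "c' = (\<lambda>k. if k < N then \<gamma> else c k / 2)"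
    have c': "\<gamma> \<le> c' k" for k using N[of k] by (auto simp: c'_def)
    have "filterlim (\<lambda>k. 1/2 * c k) at_top sequentially"
      by (rule filterlim_tendsto_pos_mult_at_top[OF tendsto_const _ c(1)]) simp
    moreover have "eventually (\<lambda>k. 1/2 * c k = c' k) sequentially"
      using eventually_ge_at_top[of N] by eventually_elim (auto simp: c'_def)
    ultimately have c'_top: "filterlim c' at_top sequentially"
      by (rule filterlim_cong[OF refl refl, THEN iffD1, rotated])
    have S: "eventually (\<lambda>w. w \<in> S) (at z within S)"
      by (simp add: eventually_at_filter)
    have "eventually (\<lambda>w. cmod (f w k - f z k) \<le> m k / \<gamma>) (at z within S)" for k
    proof (cases "m k > 0")
      case True
      have "((\<lambda>w. f w k - f z k) \<longlongrightarrow> 0) (at z within S)" using cont[OF z] by (rule LIM_zero)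
      then have "eventually (\<lambda>w. dist (f w k - f z k) 0 < m k / \<gamma>) (at z within S)"
        by (rule tendstoD) (use True \<gamma> in simp)
      then show ?thesis by eventually_elim simp
    next
      case False
      \<comment> \<open>Nothing is assumed on the sign of \<open>m\<close>: where it is not
        positive, the bound forces it and the coordinate to vanish on \<open>S\<close>.\<close>
      have zero: "f w k = 0 \<and> m k = 0" if "w \<in> S" for w
      proof -
        have "0 \<le> m k / c k" using bound[OF that, of k] norm_ge_zero order_trans by metis
        then have "m k = 0" using False c(2)[of k] by (simp add: zero_le_divide_iff)
        then show ?thesis using bound[OF that, of k] by simp
      qed
      from S show ?thesis by eventually_elim (use zero z in simp)
    qed
    then have "eventually (\<lambda>w. \<forall>k\<in>{..<N}. cmod (f w k - f z k) \<le> m k / \<gamma>) (at z within S)"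
      by (intro eventually_ball_finite) auto
    with S show "eventually (\<lambda>w. dist (nrm Y (\<lambda>k. f w k - f z k)) 0 < e) (at z within S)"
    proof eventually_elim
      fix w assume w: "w \<in> S" and small: "\<forall>k\<in>{..<N}. cmod (f w k - f z k) \<le> m k / \<gamma>"
      have "cmod (f w k - f z k) \<le> m k / c' k" for k
      proof (cases "k < N")
        case True then show ?thesis using small by (simp add: c'_def)
      next
        case False
        have "cmod (f w k - f z k) \<le> m k / c k + m k / c k"
          using norm_triangle_ineq4[of "f w k" "f z k"] bound[OF w, of k] bound[OF z, of k] by linarith
        then show ?thesis using False by (simp add: c'_def mult.commute)
      qed
      from Y[OF c'_top \<gamma>(1) c' this] \<gamma>(2) show "dist (nrm Y (\<lambda>k. f w k - f z k)) 0 < e" by simp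
    qed
  qed
  then show "bdd_continuous_into Y S f" using mem by (auto simp: bdd_continuous_into_def)
qed

lemma (in calibrated) bdd_continuous_into_line:
  fixes f :: "complex \<Rightarrow> cseq"
  assumes s: "\<And>k. 0 \<le> s k" "\<And>N. (\<Sum>k<N. s k) \<le> M" "1 \<le> M"
    and c: "filterlim c at_top sequentially" "\<And>k. 1 \<le> c k"
    and bound: "\<And>t k. cmod (f (Complex a t) k) \<le> i (s k) / c k"
    and cont: "\<And>t k. ((\<lambda>t. f (Complex a t) k) \<longlongrightarrow> f (Complex a t) k) (at t)"
  shows "bdd_continuous_into Y UNIV (\<lambda>t. f (Complex a t))" "nrm Y (f (Complex a t)) \<le> M"
proof -
  have Y: "y \<in> carr Y \<and> 0 \<le> nrm Y y \<and> nrm Y y \<le> M / \<gamma>"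
    if "filterlim c at_top sequentially" "0 < \<gamma>" "\<And>k. \<gamma> \<le> c k" "\<And>k. cmod (y k) \<le> i (s k) / c k" for c \<gamma> y
    using majorant_mem[OF s that] nrm_nonneg by blast
  have M0: "0 < M" using s(3) by simp
  show "bdd_continuous_into Y UNIV (\<lambda>t. f (Complex a t))"
    by (rule bdd_continuous_into_if_dominated(1)[OF Y M0 c bound cont])
  show "nrm Y (f (Complex a t)) \<le> M"
    by (rule bdd_continuous_into_if_dominated(2)[OF Y M0 c bound cont]) simp_all
qed

section \<open>The Calderon space and its values at \<theta>\<close>

context interpolation
begin

sublocale banach_couple X0 X1 ..

abbreviation \<Sigma>X :: seq_space where "\<Sigma>X \<equiv> sum_space X0 X1"
abbreviation \<F> :: "(complex \<Rightarrow> cseq) set" where "\<F> \<equiv> calderon X0 X1"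
abbreviation X\<theta> :: seq_space where "X\<theta> \<equiv> interp_space X0 X1 \<theta>"

text \<open>The passage from functions with values in the sum space to scalar functions.
  Differentiability in norm is used to get holomorphic coordinates; together with norm continuity
  these form \<open>holo_into\<close>, which gives access to all higher coefficients.\<close>

lemma
  assumes f: "f \<in> \<F>"
  shows calderon_coord_continuous: "continuous_on strip (\<lambda>z. f z k)"
    and calderon_coord_holomorphic: "(\<lambda>z. f z k) holomorphic_on interior strip"
    and calderon_coord_bounded: "bounded ((\<lambda>z. f z k) ` strip)"
    and calderon_holo_into: "sum.holo_into (interior strip) f"
    and calderon_mem: "z \<in> strip \<Longrightarrow> f z \<in> carr \<Sigma>X"
proof -
  have mem: "\<And>z. z \<in> strip \<Longrightarrow> f z \<in> carr \<Sigma>X"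
    and cont: "\<And>z. z \<in> strip \<Longrightarrow> ((\<lambda>w. nrm \<Sigma>X (\<lambda>k. f w k - f z k)) \<longlongrightarrow> 0) (at z within strip)"
    and diff: "\<And>z. z \<in> interior strip \<Longrightarrow> \<exists>d. has_deriv_in \<Sigma>X f d z"
    using f by (auto simp: calderon_def bdd_continuous_into_def)
  show "z \<in> strip \<Longrightarrow> f z \<in> carr \<Sigma>X" by (rule mem)
  show coord: "continuous_on strip (\<lambda>z. f z k)" for k
    unfolding continuous_on_def
  proof
    fix z assume z: "z \<in> strip"
    have "\<forall>\<^sub>F w in at z within strip. (\<lambda>k. f w k - f z k) \<in> carr \<Sigma>X"
      unfolding eventually_at_filter using sum.diff_mem[OF mem mem[OF z]] by simp
    from sum.coord_continuous[OF this cont[OF z]]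
    show "((\<lambda>z. f z k) \<longlongrightarrow> f z k) (at z within strip)" by (rule LIM_zero_cancel)
  qed
  show holo: "(\<lambda>z. f z k) holomorphic_on interior strip" for k
    unfolding holomorphic_on_open[OF open_interior]
  proof
    fix z assume z: "z \<in> interior strip"
    obtain d where "has_deriv_in \<Sigma>X f d z" using diff[OF z] ..
    from sum.has_deriv_in_coord[OF open_interior z mem[OF interior_strip_subset] this]
    show "\<exists>f'. ((\<lambda>z. f z k) has_field_derivative f') (at z)" by (intro exI)
  qed
  show "bounded ((\<lambda>z. f z k) ` strip)"
  proof -
    obtain M where M: "\<And>z. z \<in> strip \<Longrightarrow> nrm \<Sigma>X (f z) \<le> M"
      using f by (auto simp: calderon_def bdd_continuous_into_def)
    obtain C where C: "\<And>x. x \<in> carr \<Sigma>X \<Longrightarrow> cmod (x k) \<le> C * nrm \<Sigma>X x" using sum.coord_bound by blast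
    have "cmod (f z k) \<le> \<bar>C\<bar> * M" if z: "z \<in> strip" for z
    proof -
      have "cmod (f z k) \<le> C * nrm \<Sigma>X (f z)" by (rule C[OF mem[OF z]])
      also have "\<dots> \<le> \<bar>C\<bar> * nrm \<Sigma>X (f z)" using sum.nrm_nonneg[OF mem[OF z]] by (intro mult_right_mono) auto
      also have "\<dots> \<le> \<bar>C\<bar> * M" using M[OF z] by (intro mult_left_mono) auto
      finally show ?thesis .
    qed
    then show ?thesis by (auto simp: bounded_iff)
  qed
  show "sum.holo_into (interior strip) f"
    unfolding sum.holo_into_def
  proof (intro conjI ballI allI holo open_interior)
    fix z assume z: "z \<in> interior strip"
    show "f z \<in> carr \<Sigma>X" by (rule mem[OF interior_strip_subset[OF z]])
    show "((\<lambda>w. nrm \<Sigma>X (\<lambda>k. f w k - f z k)) \<longlongrightarrow> 0) (at z)"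
      using cont[OF interior_strip_subset[OF z]] at_within_interior[OF z] by simp
  qed
qed

lemma
  assumes f: "f \<in> \<F>"
  shows calderon_left: "f (Complex 0 t) \<in> carr X0 \<and> nrm X0 (f (Complex 0 t)) \<le> calderon_norm X0 X1 f"
    and calderon_right: "f (Complex 1 t) \<in> carr X1 \<and> nrm X1 (f (Complex 1 t)) \<le> calderon_norm X0 X1 f"
proof -
  obtain M0 M1 where M: "\<And>t. f (Complex 0 t) \<in> carr X0 \<and> nrm X0 (f (Complex 0 t)) \<le> M0"
    "\<And>t. f (Complex 1 t) \<in> carr X1 \<and> nrm X1 (f (Complex 1 t)) \<le> M1"
    using f by (auto simp: calderon_def bdd_continuous_into_def)
  then have "bdd_above (range (\<lambda>t. nrm X0 (f (Complex 0 t))) \<union> range (\<lambda>t. nrm X1 (f (Complex 1 t))))"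
    by (intro bdd_aboveI[of _ "max M0 M1"]) (auto intro: max.coboundedI1 max.coboundedI2)
  then show "f (Complex 0 t) \<in> carr X0 \<and> nrm X0 (f (Complex 0 t)) \<le> calderon_norm X0 X1 f"
    "f (Complex 1 t) \<in> carr X1 \<and> nrm X1 (f (Complex 1 t)) \<le> calderon_norm X0 X1 f"
    using M unfolding calderon_norm_def by (auto intro: cSup_upper)
qed

lemma calderon_boundary_less: "f \<in> \<F> \<Longrightarrow> calderon_norm X0 X1 f < R \<Longrightarrow> boundary_less f R"
  using calderon_left calderon_right unfolding boundary_less_def by (meson order_le_less_trans)

lemma calderon_norm_nonneg: "f \<in> \<F> \<Longrightarrow> 0 \<le> calderon_norm X0 X1 f"
  using calderon_left[of f 0] X0.nrm_nonneg[of "f (Complex 0 0)"] by simp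

lemma calderon_norm_le:
  assumes "\<And>t. nrm X0 (f (Complex 0 t)) \<le> M" "\<And>t. nrm X1 (f (Complex 1 t)) \<le> M"
  shows "calderon_norm X0 X1 f \<le> M"
  unfolding calderon_norm_def by (rule cSup_least) (use assms in auto)

lemma carr_X\<theta>: "x \<in> carr X\<theta> \<longleftrightarrow> (\<exists>f\<in>\<F>. x = f (of_real \<theta>))"
  by (auto simp: interp_space_def)

lemma nrm_X\<theta>: "nrm X\<theta> x = Inf {calderon_norm X0 X1 f | f. f \<in> \<F> \<and> f (of_real \<theta>) = x}"
  by (simp add: interp_space_def)

lemma nrm_X\<theta>_le: "f \<in> \<F> \<Longrightarrow> nrm X\<theta> (f (of_real \<theta>)) \<le> calderon_norm X0 X1 f"
  unfolding nrm_X\<theta> by (rule cInf_lower) (auto intro!: bdd_belowI[of _ 0] calderon_norm_nonneg)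

lemma X\<theta>_lift:
  assumes "x \<in> carr X\<theta>" "nrm X\<theta> x < R"
  obtains f where "f \<in> \<F>" "f (of_real \<theta>) = x" "calderon_norm X0 X1 f < R"
proof -
  have "{calderon_norm X0 X1 f | f. f \<in> \<F> \<and> f (of_real \<theta>) = x} \<noteq> {}"
    using assms(1) unfolding carr_X\<theta> by blast
  from cInf_lessD[OF this] assms(2) show ?thesis unfolding nrm_X\<theta> using that by blast
qed

lemma nrm_X\<theta>_nonneg: "x \<in> carr X\<theta> \<Longrightarrow> 0 \<le> nrm X\<theta> x"
  unfolding nrm_X\<theta> by (rule cInf_greatest) (auto simp: carr_X\<theta> calderon_norm_nonneg)

lemma X\<theta>_subset: "x \<in> carr X\<theta> \<Longrightarrow> x \<in> carr \<Sigma>X"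
  using calderon_mem interior_strip_subset[OF of_real_interior_strip[OF \<theta>]] unfolding carr_X\<theta> by blast

lemma bdd_continuous_into_scale:
  assumes "banach_seq Y" "bdd_continuous_into Y S f"
  shows "bdd_continuous_into Y S (\<lambda>z k. c * f z k)"
proof -
  interpret Y: banach_seq Y by fact
  obtain M where M: "\<And>z. z \<in> S \<Longrightarrow> f z \<in> carr Y \<and> nrm Y (f z) \<le> M"
    and cont: "\<And>z. z \<in> S \<Longrightarrow> ((\<lambda>w. nrm Y (\<lambda>k. f w k - f z k)) \<longlongrightarrow> 0) (at z within S)"
    using assms(2) by (auto simp: bdd_continuous_into_def)
  show ?thesis
    unfolding bdd_continuous_into_def
  proof (intro conjI ballI exI[of _ "cmod c * M"])
    fix z assume z: "z \<in> S"
    show "(\<lambda>k. c * f z k) \<in> carr Y" using M[OF z] by (intro Y.scale_mem) auto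
    show "nrm Y (\<lambda>k. c * f z k) \<le> cmod c * M" using M[OF z] by (simp add: Y.nrm_scale mult_left_mono)
    show "((\<lambda>w. nrm Y (\<lambda>k. c * f w k - c * f z k)) \<longlongrightarrow> 0) (at z within S)"
      using M cont[OF z] z by (intro Y.tendsto_scale) (auto simp: eventually_at_filter)
  qed
qed

lemma calderon_scale:
  assumes f: "f \<in> \<F>"
  shows "(\<lambda>z k. c * f z k) \<in> \<F>" "calderon_norm X0 X1 (\<lambda>z k. c * f z k) \<le> cmod c * calderon_norm X0 X1 f"
proof -
  have "\<exists>d. has_deriv_in \<Sigma>X (\<lambda>z k. c * f z k) d z" if z: "z \<in> interior strip" for z
  proof -
    have "bdd_continuous_into \<Sigma>X strip (\<lambda>z k. c * f z k)"
      using f sum.banach_seq_axioms by (intro bdd_continuous_into_scale) (auto simp: calderon_def)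
    then have "((\<lambda>w. nrm \<Sigma>X (\<lambda>k. c * f w k - c * f z k)) \<longlongrightarrow> 0) (at z)" if "z \<in> interior strip" for z
      using interior_strip_subset[OF that] at_within_interior[OF that] by (auto simp: bdd_continuous_into_def)
    then have "sum.holo_into (interior strip) (\<lambda>z k. c * f z k)"
      using calderon_holo_into[OF f] unfolding sum.holo_into_def
      by (auto intro!: sum.scale_mem holomorphic_intros)
    from sum.holo_into_has_deriv[OF this z] show ?thesis by blast
  qed
  then show "(\<lambda>z k. c * f z k) \<in> \<F>"
    using f bdd_continuous_into_scale[OF sum.banach_seq_axioms, of strip f c]
      bdd_continuous_into_scale[OF X0.banach_seq_axioms, of UNIV "\<lambda>t. f (Complex 0 t)" c]
      bdd_continuous_into_scale[OF X1.banach_seq_axioms, of UNIV "\<lambda>t. f (Complex 1 t)" c]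
    by (simp add: calderon_def)
  show "calderon_norm X0 X1 (\<lambda>z k. c * f z k) \<le> cmod c * calderon_norm X0 X1 f"
    using calderon_left[OF f] calderon_right[OF f]
    by (intro calderon_norm_le) (auto simp: X0.nrm_scale X1.nrm_scale intro!: mult_left_mono)
qed

lemma X\<theta>_scale:
  assumes x: "x \<in> carr X\<theta>"
  shows "(\<lambda>k. c * x k) \<in> carr X\<theta>" "nrm X\<theta> (\<lambda>k. c * x k) \<le> cmod c * nrm X\<theta> x"
proof -
  show "(\<lambda>k. c * x k) \<in> carr X\<theta>"
  proof -
    obtain f where f: "f \<in> \<F>" "x = f (of_real \<theta>)" using x unfolding carr_X\<theta> by blast
    show ?thesis unfolding carr_X\<theta> by (rule bexI[OF _ calderon_scale(1)[OF f(1), of c]]) (simp add: f(2))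
  qed
  have *: "nrm X\<theta> (\<lambda>k. c * x k) \<le> cmod c * R" if R: "nrm X\<theta> x < R" for R
  proof -
    obtain f where f: "f \<in> \<F>" "f (of_real \<theta>) = x" "calderon_norm X0 X1 f < R"
      by (rule X\<theta>_lift[OF x R])
    have "nrm X\<theta> (\<lambda>k. c * x k) \<le> calderon_norm X0 X1 (\<lambda>z k. c * f z k)"
      using nrm_X\<theta>_le[OF calderon_scale(1)[OF f(1)], of c] by (simp add: f(2))
    also have "\<dots> \<le> cmod c * R"
      by (rule order_trans[OF calderon_scale(2)[OF f(1)]]) (use f(3) in \<open>auto intro!: mult_left_mono\<close>)
    finally show ?thesis .
  qed
  show "nrm X\<theta> (\<lambda>k. c * x k) \<le> cmod c * nrm X\<theta> x"
  proof (cases "c = 0")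
    case True
    then show ?thesis using *[OF less_add_one] by simp
  next
    case False
    have "nrm X\<theta> (\<lambda>k. c * x k) / cmod c \<le> nrm X\<theta> x"
      by (rule dense_ge) (use * False in \<open>simp add: pos_divide_le_eq mult.commute\<close>)
    then show ?thesis using False by (simp add: pos_divide_le_eq mult.commute)
  qed
qed

text \<open>Each \<open>y k\<close> is split in the proportion \<open>i0 (s k)\<close> to
  \<open>i1 (s k)\<close>, so that each part is dominated by its own majorant over the same
  weights.\<close>

lemma sum_space_majorant_mem:
  assumes s: "\<And>k. 0 \<le> s k" "\<And>N. (\<Sum>k<N. s k) \<le> M" "1 \<le> M"
    and c: "filterlim c at_top sequentially" "0 < \<gamma>" "\<And>k. \<gamma> \<le> c k"
    and y: "\<And>k. cmod (y k) \<le> (i0 (s k) + i1 (s k)) / c k"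
  shows "y \<in> carr \<Sigma>X \<and> nrm \<Sigma>X y \<le> (2 * M) / \<gamma>"
proof -
  \<comment> \<open>If both values are 0, then \<open>w k\<close> is 0 by the convention on
    division, and \<open>y k\<close> is 0 by the bound.\<close>
  define w where "w = (\<lambda>k. complex_of_real (i0 (s k) / (i0 (s k) + i1 (s k))))"
  have nn: "0 \<le> i0 (s k)" "0 \<le> i1 (s k)" "0 < c k" for k
    using X0.i_nonneg X1.i_nonneg s c(2) c(3)[of k] by auto
  have *: "a / (a + b) * v \<le> a / c" if "v \<le> (a + b) / c" "0 \<le> a" "0 \<le> b" for a b v c :: real
  proof (cases "a + b = 0")
    case True
    then have "a = 0" using that by simp
    then show ?thesis by simp
  next
    case False
    have "a / (a + b) * v \<le> a / (a + b) * ((a + b) / c)" using that by (intro mult_left_mono) auto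
    then show ?thesis using False by simp
  qed
  define a where "a = (\<lambda>k. w k * y k)"
  define b where "b = (\<lambda>k. y k - w k * y k)"
  have ya: "cmod (a k) \<le> i0 (s k) / c k" for k
    using *[OF y nn(1,2), of k] nn[of k] by (simp add: a_def w_def norm_mult norm_divide flip: of_real_add)
  have yb: "cmod (b k) \<le> i1 (s k) / c k" for k
  proof (cases "i0 (s k) + i1 (s k) = 0")
    case True
    then have "y k = 0" using y[of k] by simp
    then show ?thesis using nn[of k] by (simp add: b_def)
  next
    case False
    then have "1 - i0 (s k) / (i0 (s k) + i1 (s k)) = i1 (s k) / (i1 (s k) + i0 (s k))"
      by (simp add: field_simps)
    then have "1 - w k = of_real (i1 (s k) / (i1 (s k) + i0 (s k)))"
      unfolding w_def by (metis of_real_1 of_real_diff)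
    moreover have "b k = (1 - w k) * y k" by (simp add: b_def left_diff_distrib)
    ultimately have "b k = of_real (i1 (s k) / (i1 (s k) + i0 (s k))) * y k" by (simp only:)
    then show ?thesis
      using *[of "cmod (y k)" "i1 (s k)" "i0 (s k)" "c k"] y[of k] nn[of k]
      by (simp add: norm_mult norm_divide add.commute flip: of_real_add)
  qed
  have a: "a \<in> carr X0 \<and> nrm X0 a \<le> M / \<gamma>" by (rule X0.majorant_mem[OF s c ya])
  have b: "b \<in> carr X1 \<and> nrm X1 b \<le> M / \<gamma>" by (rule X1.majorant_mem[OF s c yb])
  have yab: "y = (\<lambda>k. a k + b k)" by (simp add: a_def b_def)
  have "nrm \<Sigma>X y \<le> M / \<gamma> + M / \<gamma>" unfolding yab using nrm_sum_space_le[of a b] a b by simp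
  moreover have "y \<in> carr \<Sigma>X" unfolding carr_sum_space using a b by (intro bexI[of _ a] bexI[of _ b] yab) auto
  ultimately show ?thesis by simp
qed

text \<open>Dividing by slowly divergent weights makes the extremal family norm continuous on the
  boundary, and puts it into \<open>c\<^sub>0\<close> in that case.\<close>

lemma X\<theta>_mem_if_modular_bounded:
  obtains C where "\<And>x. (\<And>N. (\<Sum>k<N. p (x k)) \<le> M) \<Longrightarrow> x \<in> carr X\<theta> \<and> nrm X\<theta> x \<le> C"
proof -
  obtain K d where K: "1 < K" "1 < d" "\<And>n x. p (of_real (d ^ n) * x) \<le> K ^ n * p x"
    by (rule p_geometric_growth) blast
  \<comment> \<open>The total provided by \<open>exists_divergent_weights\<close>, raised to at
    least 1 as \<open>majorant_mem\<close> requires.\<close>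
  define M' where "M' = max 1 (M + 2 * sqrt (M + 1))"
  have "x \<in> carr X\<theta> \<and> nrm X\<theta> x \<le> M'" if x: "\<And>N. (\<Sum>k<N. p (x k)) \<le> M" for x
  proof -
    obtain L where L: "\<And>k. 1 \<le> L k" "filterlim L at_top sequentially"
      "\<And>N. (\<Sum>k<N. L k * p (x k)) \<le> M + 2 * sqrt (M + 1)"
      by (rule exists_divergent_weights[of "\<lambda>k. p (x k)" M]) (use p_nonneg x in auto)
    \<comment> \<open>\<open>m k\<close> is the largest exponent with
      \<open>K ^ m k \<le> L k\<close>. Dilating \<open>x k\<close> by \<open>c k = d ^ m k\<close>
      then costs at most the factor \<open>L k\<close> in the modular, while \<open>c\<close> still
      tends to infinity.\<close>
    define m where "m = (\<lambda>k. nat \<lfloor>log K (L k)\<rfloor>)"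
    define c where "c = (\<lambda>k. d ^ m k)"
    have Km: "K ^ m k \<le> L k" for k
    proof -
      have "0 \<le> log K (L k)" using K L(1)[of k] by simp
      then have "K powr real (m k) \<le> K powr (log K (L k))"
        using K by (intro powr_mono) (auto simp: m_def)
      then show ?thesis using K L(1)[of k] by (simp add: powr_realpow)
    qed
    have c1: "1 \<le> c k" for k using K by (simp add: c_def)
    have ctop: "filterlim c at_top sequentially"
    proof -
      have "filterlim (\<lambda>k. log K (L k)) at_top sequentially"
      proof -
        have "filterlim (\<lambda>k. ln (L k) * (1 / ln K)) at_top sequentially"
          using K by (intro filterlim_at_top_mult_tendsto_pos[OF tendsto_const] filterlim_compose[OF ln_at_top L(2)]) auto
        then show ?thesis by (simp add: log_def)
      qed
      then have "filterlim (\<lambda>k. \<lfloor>log K (L k)\<rfloor>) at_top sequentially"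
        by (rule filterlim_compose[OF filterlim_floor_sequentially])
      then have "filterlim m sequentially sequentially"
        unfolding m_def by (rule filterlim_compose[OF filterlim_nat_sequentially])
      moreover have "filterlim (\<lambda>n. d ^ n) at_top sequentially"
        using filterlim_realpow_sequentially_gt1[of d] K by (simp add: filterlim_at_infinity_imp_filterlim_at_top)
      ultimately show ?thesis unfolding c_def by (rule filterlim_compose[rotated])
    qed
    define s where "s = (\<lambda>k. p (of_real (c k) * x k))"
    have s0: "0 \<le> s k" for k by (simp add: s_def p_nonneg)
    have sM: "(\<Sum>k<N. s k) \<le> M'" for N
    proof -
      have "s k \<le> L k * p (x k)" for k
        unfolding s_def c_def using K(3)[of "m k" "x k"] mult_right_mono[OF Km p_nonneg[of "x k"], of k] by linarith
      then have "(\<Sum>k<N. s k) \<le> (\<Sum>k<N. L k * p (x k))" by (rule sum_mono)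
      then show ?thesis using L(3)[of N] by (simp add: M'_def)
    qed
    have M1: "1 \<le> M'" by (simp add: M'_def)
    \<comment> \<open>Dilating the argument by \<open>c k\<close> and dividing the function by
      \<open>c k\<close> leaves the value at \<theta> equal to \<open>x\<close>, but puts the
      weights under the boundary majorants.\<close>
    define f where "f = (\<lambda>z k. gs (of_real (c k) * x k) z / of_real (c k))"
    have cpos: "0 < c k" for k using c1[of k] by simp
    have cmodf: "cmod (f z k) = cmod (gs (of_real (c k) * x k) z) / c k" for z k
      using cpos[of k] by (simp add: f_def norm_divide)
    have contf: "((\<lambda>w. f w k) \<longlongrightarrow> f z k) (at z within A)" for z k A
      using continuous_gs[of UNIV "of_real (c k) * x k"] cpos[of k] unfolding f_def
      by (intro tendsto_divide tendsto_const)
         (auto simp: continuous_on_eq_continuous_at continuous_at_imp_continuous_at_within simp flip: continuous_within)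
    have contf': "((\<lambda>t. f (Complex a t) k) \<longlongrightarrow> f (Complex a t) k) (at t)" for a t k
    proof -
      have "isCont (\<lambda>z. f z k) (Complex a t)" using contf[of k "Complex a t" UNIV] by (simp add: isCont_def)
      moreover have "((\<lambda>t. Complex a t) \<longlongrightarrow> Complex a t) (at t)" by (intro tendsto_intros)
      ultimately show ?thesis by (rule isCont_tendsto_compose)
    qed
    have strip: "bdd_continuous_into \<Sigma>X strip f"
    proof (rule bdd_continuous_into_if_dominated[OF _ _ ctop c1])
      show "y \<in> carr \<Sigma>X \<and> 0 \<le> nrm \<Sigma>X y \<and> nrm \<Sigma>X y \<le> (2 * M') / \<gamma>"
        if "filterlim c at_top sequentially" "0 < \<gamma>" "\<And>k. \<gamma> \<le> c k" "\<And>k. cmod (y k) \<le> (i0 (s k) + i1 (s k)) / c k" for c \<gamma> y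
        using sum_space_majorant_mem[OF s0 sM M1 that] sum.nrm_nonneg by blast
      show "cmod (f z k) \<le> (i0 (s k) + i1 (s k)) / c k" if "z \<in> strip" for z k
        unfolding cmodf s_def using cmod_gs_le[OF that] cpos[of k] by (intro divide_right_mono) auto
    qed (use M1 contf in auto)
    have left: "bdd_continuous_into X0 UNIV (\<lambda>t::real. f (Complex 0 t))" "\<And>t. nrm X0 (f (Complex 0 t)) \<le> M'"
      using X0.bdd_continuous_into_line[OF s0 sM M1 ctop c1 _ contf', of 0]
        divide_right_mono[OF cmod_gs_left less_imp_le[OF cpos]] by (simp_all add: cmodf s_def)
    have right: "bdd_continuous_into X1 UNIV (\<lambda>t::real. f (Complex 1 t))" "\<And>t. nrm X1 (f (Complex 1 t)) \<le> M'"
      using X1.bdd_continuous_into_line[OF s0 sM M1 ctop c1 _ contf', of 1]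
        divide_right_mono[OF cmod_gs_right less_imp_le[OF cpos]] by (simp_all add: cmodf s_def)
    have "sum.holo_into (interior strip) f"
      unfolding sum.holo_into_def
    proof (intro conjI ballI allI open_interior)
      fix z assume z: "z \<in> interior strip"
      show "f z \<in> carr \<Sigma>X" "((\<lambda>w. nrm \<Sigma>X (\<lambda>k. f w k - f z k)) \<longlongrightarrow> 0) (at z)"
        using strip interior_strip_subset[OF z] at_within_interior[OF z] by (auto simp: bdd_continuous_into_def)
    next
      show "(\<lambda>z. f z k) holomorphic_on interior strip" for k
        unfolding f_def using cpos[of k] by (intro holomorphic_intros holomorphic_gs) auto
    qed
    then have f: "f \<in> \<F>"
      using strip left(1) right(1) sum.holo_into_has_deriv unfolding calderon_def by blast
    have "f (of_real \<theta>) = x" using cpos by (auto simp: f_def gs_\<theta> fun_eq_iff less_imp_neq[THEN not_sym])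
    then show ?thesis
      using nrm_X\<theta>_le[OF f] calderon_norm_le[of f M', OF left(2) right(2)] f carr_X\<theta> by (metis order_trans)
  qed
  then show ?thesis using that by blast
qed

end

section \<open>The derived spaces\<close>

lemma seq_of_tuples_Cons: "seq_of_tuples (w # y) k = w k # seq_of_tuples y k"
  by (simp add: seq_of_tuples_def)

lemma length_seq_of_tuples [simp]: "length (seq_of_tuples x k) = length x"
  by (simp add: seq_of_tuples_def)

definition scale_tuple :: "complex \<Rightarrow> cseq list \<Rightarrow> cseq list" where
  "scale_tuple c x = map (\<lambda>s k. c * s k) x"

lemma scale_tuple_Cons: "scale_tuple c (w # y) = (\<lambda>k. c * w k) # scale_tuple c y"
  by (simp add: scale_tuple_def)

lemma length_scale_tuple [simp]: "length (scale_tuple c x) = length x"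
  by (simp add: scale_tuple_def)

lemma scale_tuple_inverse: "c \<noteq> 0 \<Longrightarrow> scale_tuple c (scale_tuple (inverse c) x) = x"
  by (simp add: scale_tuple_def comp_def mult.assoc[symmetric] map_idI)

lemma seq_of_tuples_scale:
  "seq_of_tuples (scale_tuple (inverse (of_real \<rho>)) x) k = map (\<lambda>c. c / of_real \<rho>) (seq_of_tuples x k)"
  by (simp add: seq_of_tuples_def scale_tuple_def divide_inverse mult.commute)

lemma seq_of_tuples_surj:
  assumes "\<And>k. length (X k) = n"
  shows "\<exists>x. length x = n \<and> seq_of_tuples x = X"
proof (intro exI conjI)
  show "seq_of_tuples (map (\<lambda>j k. X k ! j) [0..<n]) = X"
    using assms by (auto simp: seq_of_tuples_def fun_eq_iff intro!: nth_equalityI)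
qed simp

context interpolation
begin

text \<open>The case \<open>n = 0\<close> of \<open>modular_coeff_difference\<close> with empty
  tuples: \<omega> and the modular of the tuples vanish, and the coefficient is the value at
  \<theta> itself.\<close>

lemma X\<theta>_modular_small:
  assumes \<delta>: "0 < \<delta>"
  obtains \<epsilon> where "0 < \<epsilon>" "\<And>x N. x \<in> carr X\<theta> \<Longrightarrow> nrm X\<theta> x < \<epsilon> \<Longrightarrow> (\<Sum>k<N. p (x k)) \<le> \<delta>"
proof -
  obtain K where K: "1 \<le> K"
    "\<And>F X \<epsilon> M N. lifts F 0 X \<Longrightarrow> 0 < \<epsilon> \<Longrightarrow> \<epsilon> \<le> 1 \<Longrightarrow> boundary_less F (1 * \<epsilon>) \<Longrightarrow> (\<Sum>k<N. P (X k)) \<le> M \<Longrightarrow>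
      (\<Sum>k<N. p (taylor_coeff (\<lambda>z. F z k) 0 (of_real \<theta>) - \<omega> (X k))) \<le> K * (\<epsilon> + M)"
    by (rule modular_coeff_difference[OF zero_less_one, of 0]) blast
  define \<epsilon> where "\<epsilon> = min 1 (\<delta> / K)"
  have \<epsilon>: "0 < \<epsilon>" "\<epsilon> \<le> 1" "K * \<epsilon> \<le> \<delta>"
    using \<delta> K(1) by (auto simp: \<epsilon>_def min_def field_simps)
  show ?thesis
  proof (rule that[OF \<epsilon>(1)])
    fix x N assume x: "x \<in> carr X\<theta>" and lt: "nrm X\<theta> x < \<epsilon>"
    obtain f where f: "f \<in> \<F>" "f (of_real \<theta>) = x" "calderon_norm X0 X1 f < \<epsilon>"
      by (rule X\<theta>_lift[OF x lt])
    have "lifts f 0 (\<lambda>_. [])"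
      using calderon_coord_continuous[OF f(1)] calderon_coord_holomorphic[OF f(1)] calderon_coord_bounded[OF f(1)]
      by (simp add: lifts_def)
    from K(2)[OF this \<epsilon>(1,2), of N 0] calderon_boundary_less[OF f(1,3)]
    show "(\<Sum>k<N. p (x k)) \<le> \<delta>" using \<epsilon>(3) f(2) by (simp add: taylor_coeff_0 \<omega>_Nil)
  qed
qed

lemma p_minus: "p (- x) = p x"
  by (simp add: p_eq)

end

locale lifted_interpolation = interpolation +
  fixes B :: lifting
  assumes admissible: "admissible_lifting X0 X1 \<theta> B"
begin

abbreviation D :: "nat \<Rightarrow> cseq list set" where "D \<equiv> derived_space X0 X1 \<theta> B"
abbreviation dn :: "cseq list \<Rightarrow> real" where "dn \<equiv> derived_norm X0 X1 \<theta> B"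
abbreviation \<Omega> :: "nat \<Rightarrow> cseq list \<Rightarrow> cseq" where "\<Omega> \<equiv> Omega X0 X1 \<theta> B"

lemma D_Suc: "0 < n \<Longrightarrow> x \<in> D (Suc n) \<longleftrightarrow>
    (\<exists>w y. x = w # y \<and> w \<in> carr \<Sigma>X \<and> y \<in> D n \<and> (\<lambda>k. w k - \<Omega> n y k) \<in> carr X\<theta>)"
  by (cases n) auto

lemma length_D: "x \<in> D n \<Longrightarrow> length x = n"
proof (induction n arbitrary: x)
  case (Suc n)
  then show ?case by (cases "n = 0") (auto simp: D_Suc)
qed simp

lemma dn_Cons: "y \<noteq> [] \<Longrightarrow> dn (w # y) = nrm X\<theta> (\<lambda>k. w k - \<Omega> (length y) y k) + dn y"
  by (cases y) auto

text \<open>Admissibility of the lifting in coordinates. An entry of the reversed list of sequences,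
  evaluated at \<open>k\<close>, is the same entry of the reversed tuple at
  \<open>k\<close>.\<close>

lemma
  assumes n: "0 < n" and x: "x \<in> D n"
  shows lift_mem: "B n x \<in> \<F>"
    and lift_coeff: "j < n \<Longrightarrow> taylor_coeff (\<lambda>z. B n x z k) j (of_real \<theta>) = rev (seq_of_tuples x k) ! j"
    and \<Omega>_eq: "\<Omega> n x = (\<lambda>k. taylor_coeff (\<lambda>z. B n x z k) n (of_real \<theta>))"
    and \<Omega>_mem: "\<Omega> n x \<in> carr \<Sigma>X"
    and lift_scale: "z \<in> strip \<Longrightarrow> B n (scale_tuple c x) z = (\<lambda>k. c * B n x z k)"
proof -
  have n1: "1 \<le> n" using n by simp
  show f: "B n x \<in> \<F>" using admissible n1 x by (auto simp: admissible_lifting_def)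
  have \<theta>i: "complex_of_real \<theta> \<in> interior strip" using of_real_interior_strip \<theta> by blast
  note tc = sum.taylor_coeff_in_eq[OF calderon_holo_into[OF f] \<theta>i]
  show "\<Omega> n x = (\<lambda>k. taylor_coeff (\<lambda>z. B n x z k) n (of_real \<theta>))" by (simp add: Omega_def tc)
  show "\<Omega> n x \<in> carr \<Sigma>X"
    unfolding Omega_def by (rule sum.taylor_coeff_in_mem[OF calderon_holo_into[OF f] \<theta>i])
  show "taylor_coeff (\<lambda>z. B n x z k) j (of_real \<theta>) = rev (seq_of_tuples x k) ! j" if j: "j < n" for j
  proof -
    have "taylor_coeff_in \<Sigma>X (B n x) j (of_real \<theta>) = rev x ! j"
      using admissible n1 x j by (auto simp: admissible_lifting_def)
    moreover have "rev (seq_of_tuples x k) ! j = (rev x ! j) k"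
      using j length_D[OF x] by (simp add: seq_of_tuples_def rev_map)
    ultimately show ?thesis unfolding tc by metis
  qed
  show "z \<in> strip \<Longrightarrow> B n (scale_tuple c x) z = (\<lambda>k. c * B n x z k)"
    using admissible n1 x by (simp add: admissible_lifting_def scale_tuple_def)
qed

lemma lift_bound:
  assumes n: "0 < n"
  obtains C where "0 < C" "\<And>x. x \<in> D n \<Longrightarrow> calderon_norm X0 X1 (B n x) \<le> C * dn x"
  using admissible n that unfolding admissible_lifting_def by (metis Suc_leI One_nat_def)

lemma dn_nonneg: "x \<in> D n \<Longrightarrow> 0 \<le> dn x"
proof (induction n arbitrary: x)
  case (Suc n)
  show ?case
  proof (cases "n = 0")
    case True
    then show ?thesis using Suc.prems nrm_X\<theta>_nonneg by auto
  next
    case False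
    then obtain w y where x: "x = w # y" "y \<in> D n" "(\<lambda>k. w k - \<Omega> n y k) \<in> carr X\<theta>"
      using Suc.prems D_Suc by blast
    then show ?thesis
      using Suc.IH[OF x(2)] nrm_X\<theta>_nonneg[OF x(3)] length_D[OF x(2)] False by (subst x(1), subst dn_Cons) auto
  qed
qed simp

text \<open>Homogeneity of the lifting on the strip passes to its Taylor coefficients and hence to
  \<Omega>, so scaling the head of a tuple scales its corrected head as well.\<close>

lemma
  assumes "0 < n" "x \<in> D n"
  shows D_scale: "scale_tuple c x \<in> D n" and dn_scale_le: "dn (scale_tuple c x) \<le> cmod c * dn x"
proof -
  have "scale_tuple c x \<in> D n \<and> dn (scale_tuple c x) \<le> cmod c * dn x"
    using assms
  proof (induction n arbitrary: x)
    case (Suc n)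
    show ?case
    proof (cases "n = 0")
      case True
      then show ?thesis using Suc.prems X\<theta>_scale by (auto simp: scale_tuple_def)
    next
      case False
      then have n: "0 < n" by simp
      obtain w y where x: "x = w # y" "w \<in> carr \<Sigma>X" "y \<in> D n" "(\<lambda>k. w k - \<Omega> n y k) \<in> carr X\<theta>"
        using Suc.prems D_Suc[OF n] by blast
      have IH: "scale_tuple c y \<in> D n" "dn (scale_tuple c y) \<le> cmod c * dn y"
        using Suc.IH[OF n x(3)] by auto
      have \<theta>i: "complex_of_real \<theta> \<in> interior strip" using of_real_interior_strip \<theta> by blast
      have \<Omega>c: "\<Omega> n (scale_tuple c y) k = c * \<Omega> n y k" for k
      proof -
        note holo = calderon_coord_holomorphic[OF lift_mem[OF n x(3)]]
        have "taylor_coeff (\<lambda>z. B n (scale_tuple c y) z k) n (of_real \<theta>) = taylor_coeff (\<lambda>z. c * B n y z k) n (of_real \<theta>)"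
          by (rule taylor_coeff_cong[OF calderon_coord_holomorphic[OF lift_mem[OF n IH(1)]] open_interior \<theta>i])
             (simp add: lift_scale[OF n x(3)] interior_strip_subset)
        also have "\<dots> = c * taylor_coeff (\<lambda>z. B n y z k) n (of_real \<theta>)"
          unfolding taylor_coeff_def using higher_deriv_cmult[OF holo \<theta>i open_interior] by simp
        finally show ?thesis by (simp add: \<Omega>_eq[OF n] IH(1) x(3))
      qed
      have eq: "(\<lambda>k. c * w k - \<Omega> n (scale_tuple c y) k) = (\<lambda>k. c * (w k - \<Omega> n y k))"
        by (simp add: \<Omega>c right_diff_distrib)
      have mem: "scale_tuple c x \<in> D (Suc n)"
        unfolding D_Suc[OF n] x(1) scale_tuple_Cons
        using sum.scale_mem[OF x(2), of c] IH(1) X\<theta>_scale(1)[OF x(4), of c] by (simp add: eq)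
      have len: "length y = n" "y \<noteq> []" using length_D[OF x(3)] n by auto
      have "dn (scale_tuple c x) = nrm X\<theta> (\<lambda>k. c * (w k - \<Omega> n y k)) + dn (scale_tuple c y)"
        unfolding x(1) scale_tuple_Cons using len length_scale_tuple[of c y]
        by (subst dn_Cons) (auto simp: eq simp del: length_scale_tuple)
      also have "\<dots> \<le> cmod c * nrm X\<theta> (\<lambda>k. w k - \<Omega> n y k) + cmod c * dn y"
        by (intro add_mono X\<theta>_scale IH x)
      also have "\<dots> = cmod c * dn x" unfolding x(1) by (simp add: dn_Cons len distrib_left)
      finally show ?thesis using mem by blast
    qed
  qed simp
  then show "scale_tuple c x \<in> D n" "dn (scale_tuple c x) \<le> cmod c * dn x" by auto
qed

lemma \<Omega>_difference_modular:
  assumes n: "0 < n" and \<rho>: "0 < \<rho>"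
  obtains K where "1 \<le> K"
    "\<And>y \<epsilon> M N. y \<in> D n \<Longrightarrow> 0 < \<epsilon> \<Longrightarrow> \<epsilon> \<le> 1 \<Longrightarrow> calderon_norm X0 X1 (B n y) < \<rho> * \<epsilon> \<Longrightarrow>
      (\<Sum>k<N. P (seq_of_tuples y k)) \<le> M \<Longrightarrow> (\<Sum>k<N. p (\<Omega> n y k - \<omega> (seq_of_tuples y k))) \<le> K * (\<epsilon> + M)"
proof (rule modular_coeff_difference[OF \<rho>, of n])
  fix K assume K: "1 \<le> K"
    "\<And>F X \<epsilon> M N. lifts F n X \<Longrightarrow> 0 < \<epsilon> \<Longrightarrow> \<epsilon> \<le> 1 \<Longrightarrow> boundary_less F (\<rho> * \<epsilon>) \<Longrightarrow> (\<Sum>k<N. P (X k)) \<le> M \<Longrightarrow>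
      (\<Sum>k<N. p (taylor_coeff (\<lambda>z. F z k) n (of_real \<theta>) - \<omega> (X k))) \<le> K * (\<epsilon> + M)"
  show ?thesis
  proof (rule that[OF K(1)])
    fix y \<epsilon> M N assume y: "y \<in> D n" and \<epsilon>: "0 < \<epsilon>" "\<epsilon> \<le> 1" and norm: "calderon_norm X0 X1 (B n y) < \<rho> * \<epsilon>"
      and M: "(\<Sum>k<N. P (seq_of_tuples y k)) \<le> M"
    note f = lift_mem[OF n y]
    have "lifts (B n y) n (seq_of_tuples y)"
      using calderon_coord_continuous[OF f] calderon_coord_holomorphic[OF f] calderon_coord_bounded[OF f]
        lift_coeff[OF n y] length_D[OF y] by (simp add: lifts_def)
    from K(2)[OF this \<epsilon> calderon_boundary_less[OF f norm] M]
    show "(\<Sum>k<N. p (\<Omega> n y k - \<omega> (seq_of_tuples y k))) \<le> K * (\<epsilon> + M)"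
      by (simp only: \<Omega>_eq[OF n y])
  qed
qed

lemma P_seq_of_tuples_Cons:
  "P (seq_of_tuples (w # y) k) = P (seq_of_tuples y k) + p (w k - \<omega> (seq_of_tuples y k))"
  by (simp add: seq_of_tuples_Cons P_Cons)

section \<open>Induction along the derived spaces\<close>

text \<open>Additivity of \<open>P\<close> bounds the modulars of the tail \<open>y\<close> and of
  \<open>w - \<omega>\<close>. By induction \<open>y\<close> has bounded quasinorm, hence its lift
  bounded norm, which bounds the modular of \<open>\<Omega> - \<omega>\<close>. The quasi-triangle
  inequality bounds that of \<open>w - \<Omega>\<close>, and finite modular puts this into the
  interpolation space.\<close>

lemma D_mem_if_modular_bounded:
  assumes "0 < n"
  shows "\<exists>C. \<forall>x. length x = n \<longrightarrow> (\<forall>N. (\<Sum>k<N. P (seq_of_tuples x k)) \<le> M) \<longrightarrow> x \<in> D n \<and> dn x \<le> C"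
  using assms
proof (induction n arbitrary: M)
  case (Suc n)
  show ?case
  proof (cases "n = 0")
    case True
    obtain C where C: "\<And>x. (\<And>N. (\<Sum>k<N. p (x k)) \<le> M) \<Longrightarrow> x \<in> carr X\<theta> \<and> nrm X\<theta> x \<le> C"
      by (rule X\<theta>_mem_if_modular_bounded) blast
    show ?thesis
    proof (intro exI allI impI)
      fix x :: "cseq list" assume "length x = Suc n" and M: "\<forall>N. (\<Sum>k<N. P (seq_of_tuples x k)) \<le> M"
      then obtain s where x: "x = [s]" using True by (cases x) auto
      have "P (seq_of_tuples x k) = p (s k)" for k by (simp add: x seq_of_tuples_def P_Cons \<omega>_Nil)
      then have "s \<in> carr X\<theta> \<and> nrm X\<theta> s \<le> C" using M by (intro C) simp
      then show "x \<in> D (Suc n) \<and> dn x \<le> C" using True by (simp add: x)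
    qed
  next
    case False
    then have n: "0 < n" by simp
    obtain C where C: "\<And>y. length y = n \<Longrightarrow> (\<And>N. (\<Sum>k<N. P (seq_of_tuples y k)) \<le> M) \<Longrightarrow> y \<in> D n \<and> dn y \<le> C"
      using Suc.IH[OF n, of M] by blast
    obtain CB where CB: "0 < CB" "\<And>x. x \<in> D n \<Longrightarrow> calderon_norm X0 X1 (B n x) \<le> CB * dn x"
      by (rule lift_bound[OF n]) blast
    \<comment> \<open>\<rho> exceeds the norm of every lift that occurs, so the comparison may be
      applied with \<epsilon> equal to 1; only boundedness matters here.\<close>
    define \<rho> where "\<rho> = \<bar>CB * C\<bar> + 1"
    obtain K where K: "1 \<le> K"
      "\<And>y \<epsilon> M N. y \<in> D n \<Longrightarrow> 0 < \<epsilon> \<Longrightarrow> \<epsilon> \<le> 1 \<Longrightarrow> calderon_norm X0 X1 (B n y) < \<rho> * \<epsilon> \<Longrightarrow>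
        (\<Sum>k<N. P (seq_of_tuples y k)) \<le> M \<Longrightarrow>
        (\<Sum>k<N. p (\<Omega> n y k - \<omega> (seq_of_tuples y k))) \<le> K * (\<epsilon> + M)"
      by (rule \<Omega>_difference_modular[OF n, of \<rho>]) (auto simp: \<rho>_def)
    obtain K' where K': "1 \<le> K'" "\<And>x y. p (x + y) \<le> K' * (p x + p y)" by (rule p_quasi_triangle) blast
    obtain C2 where C2: "\<And>x. (\<And>N. (\<Sum>k<N. p (x k)) \<le> K' * (M + K * (1 + M))) \<Longrightarrow> x \<in> carr X\<theta> \<and> nrm X\<theta> x \<le> C2"
      by (rule X\<theta>_mem_if_modular_bounded) blast
    show ?thesis
    proof (intro exI allI impI)
      fix x :: "cseq list" assume "length x = Suc n" and M: "\<forall>N. (\<Sum>k<N. P (seq_of_tuples x k)) \<le> M"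
      then obtain w y where x: "x = w # y" and len: "length y = n" by (cases x) auto
      define g where "g = (\<lambda>k. \<omega> (seq_of_tuples y k))"
      have Px: "P (seq_of_tuples x k) = P (seq_of_tuples y k) + p (w k - g k)" for k
        by (simp add: x P_seq_of_tuples_Cons len g_def)
      have sums: "(\<Sum>k<N. P (seq_of_tuples y k)) \<le> M" "(\<Sum>k<N. p (w k - g k)) \<le> M" for N
      proof -
        have "0 \<le> (\<Sum>k<N. P (seq_of_tuples y k))" "0 \<le> (\<Sum>k<N. p (w k - g k))"
          by (intro sum_nonneg P_nonneg p_nonneg)+
        then show "(\<Sum>k<N. P (seq_of_tuples y k)) \<le> M" "(\<Sum>k<N. p (w k - g k)) \<le> M"
          using M[rule_format, of N] by (simp_all add: Px sum.distrib)
      qed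
      have y: "y \<in> D n" "dn y \<le> C" using C[OF len sums(1)] by auto
      have "calderon_norm X0 X1 (B n y) \<le> CB * C"
        using CB(2)[OF y(1)] mult_left_mono[OF y(2), of CB] CB(1) by linarith
      then have "calderon_norm X0 X1 (B n y) < \<rho> * 1" by (simp add: \<rho>_def)
      then have \<Delta>: "(\<Sum>k<N. p (\<Omega> n y k - g k)) \<le> K * (1 + M)" for N
        unfolding g_def by (intro K(2)[OF y(1)] sums) auto
      have "(\<Sum>k<N. p (w k - \<Omega> n y k)) \<le> K' * (M + K * (1 + M))" for N
      proof -
        have "p (w k - \<Omega> n y k) \<le> K' * (p (w k - g k) + p (\<Omega> n y k - g k))" for k
          using K'(2)[of "w k - g k" "- (\<Omega> n y k - g k)"] unfolding p_minus by simp
        then have "(\<Sum>k<N. p (w k - \<Omega> n y k)) \<le> (\<Sum>k<N. K' * (p (w k - g k) + p (\<Omega> n y k - g k)))"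
          by (rule sum_mono)
        also have "\<dots> = K' * ((\<Sum>k<N. p (w k - g k)) + (\<Sum>k<N. p (\<Omega> n y k - g k)))"
          by (simp add: sum_distrib_left sum.distrib distrib_left)
        also have "\<dots> \<le> K' * (M + K * (1 + M))"
          using K'(1) by (intro mult_left_mono add_mono sums \<Delta>) auto
        finally show ?thesis .
      qed
      then have v: "(\<lambda>k. w k - \<Omega> n y k) \<in> carr X\<theta>" "nrm X\<theta> (\<lambda>k. w k - \<Omega> n y k) \<le> C2"
        using C2[of "\<lambda>k. w k - \<Omega> n y k"] by auto
      have "w \<in> carr \<Sigma>X" using sum.add_mem[OF X\<theta>_subset[OF v(1)] \<Omega>_mem[OF n y(1)]] by simp
      then have "x \<in> D (Suc n)" unfolding D_Suc[OF n] x using v(1) y(1) by blast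
      moreover have "dn x \<le> C2 + C" unfolding x using v(2) y(2) len n by (subst dn_Cons) auto
      ultimately show "x \<in> D (Suc n) \<and> dn x \<le> C2 + C" by blast
    qed
  qed
qed simp

text \<open>The converse direction, with \<Omega> and \<omega> exchanged:
  \<open>w - \<omega>\<close> is the sum of \<open>w - \<Omega>\<close> and
  \<open>\<Omega> - \<omega>\<close>. A small quasinorm makes the lift small, so \<rho> is 1 and
  \<epsilon> carries the smallness.\<close>

lemma D_modular_small:
  assumes "0 < n" "0 < \<delta>"
  shows "\<exists>\<epsilon>>0. \<forall>x\<in>D n. dn x < \<epsilon> \<longrightarrow> (\<forall>N. (\<Sum>k<N. P (seq_of_tuples x k)) \<le> \<delta>)"
  using assms
proof (induction n arbitrary: \<delta>)
  case (Suc n)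
  show ?case
  proof (cases "n = 0")
    case True
    obtain \<epsilon> where \<epsilon>: "0 < \<epsilon>" "\<And>x N. x \<in> carr X\<theta> \<Longrightarrow> nrm X\<theta> x < \<epsilon> \<Longrightarrow> (\<Sum>k<N. p (x k)) \<le> \<delta>"
      by (rule X\<theta>_modular_small[OF Suc.prems(2)]) blast
    show ?thesis
    proof (intro exI[of _ \<epsilon>] conjI ballI impI allI \<epsilon>(1))
      fix x N assume "x \<in> D (Suc n)" "dn x < \<epsilon>"
      then obtain s where x: "x = [s]" "s \<in> carr X\<theta>" "nrm X\<theta> s < \<epsilon>" using True by auto
      have "P (seq_of_tuples x k) = p (s k)" for k by (simp add: x seq_of_tuples_def P_Cons \<omega>_Nil)
      then show "(\<Sum>k<N. P (seq_of_tuples x k)) \<le> \<delta>" using \<epsilon>(2)[OF x(2,3)] by simp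
    qed
  next
    case False
    then have n: "0 < n" by simp
    obtain CB where CB: "0 < CB" "\<And>x. x \<in> D n \<Longrightarrow> calderon_norm X0 X1 (B n x) \<le> CB * dn x"
      by (rule lift_bound[OF n]) blast
    obtain K where K: "1 \<le> K"
      "\<And>y \<epsilon> M N. y \<in> D n \<Longrightarrow> 0 < \<epsilon> \<Longrightarrow> \<epsilon> \<le> 1 \<Longrightarrow> calderon_norm X0 X1 (B n y) < 1 * \<epsilon> \<Longrightarrow>
        (\<Sum>k<N. P (seq_of_tuples y k)) \<le> M \<Longrightarrow>
        (\<Sum>k<N. p (\<Omega> n y k - \<omega> (seq_of_tuples y k))) \<le> K * (\<epsilon> + M)"
      by (rule \<Omega>_difference_modular[OF n zero_less_one]) blast
    obtain K' where K': "1 \<le> K'" "\<And>x y. p (x + y) \<le> K' * (p x + p y)" by (rule p_quasi_triangle) blast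
    \<comment> \<open>Chosen so that the tail, at most \<delta>', and the corrected head, at most
      \<open>K' * (\<delta>' + K * (\<delta>' + \<delta>'))\<close>, add up to \<delta>.\<close>
    define \<delta>' where "\<delta>' = \<delta> / (1 + K' * (1 + 2 * K))"
    have den: "0 < 1 + K' * (1 + 2 * K)" using K(1) K'(1) by (intro add_pos_pos mult_pos_pos) auto
    have \<delta>': "0 < \<delta>'" "\<delta>' + K' * (\<delta>' + K * (\<delta>' + \<delta>')) = \<delta>"
    proof -
      show "0 < \<delta>'" using den Suc.prems(2) by (simp add: \<delta>'_def)
      have "\<delta>' + K' * (\<delta>' + K * (\<delta>' + \<delta>')) = (1 + K' * (1 + 2 * K)) * \<delta>'" by (simp add: algebra_simps)
      also have "\<dots> = \<delta>" using den unfolding \<delta>'_def by simp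
      finally show "\<delta>' + K' * (\<delta>' + K * (\<delta>' + \<delta>')) = \<delta>" .
    qed
    obtain \<epsilon>1 where \<epsilon>1: "0 < \<epsilon>1" "\<And>y N. y \<in> D n \<Longrightarrow> dn y < \<epsilon>1 \<Longrightarrow> (\<Sum>k<N. P (seq_of_tuples y k)) \<le> \<delta>'"
      using Suc.IH[OF n \<delta>'(1)] by blast
    obtain \<epsilon>2 where \<epsilon>2: "0 < \<epsilon>2" "\<And>x N. x \<in> carr X\<theta> \<Longrightarrow> nrm X\<theta> x < \<epsilon>2 \<Longrightarrow> (\<Sum>k<N. p (x k)) \<le> \<delta>'"
      by (rule X\<theta>_modular_small[OF \<delta>'(1)]) blast
    \<comment> \<open>The comparison of the two liftings asks for a parameter of at most 1; dividing
      by \<open>CB\<close> below keeps the norm of the lift under it.\<close>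
    define \<epsilon>3 where "\<epsilon>3 = min 1 \<delta>'"
    have \<epsilon>3: "0 < \<epsilon>3" "\<epsilon>3 \<le> 1" "\<epsilon>3 \<le> \<delta>'" using \<delta>' by (auto simp: \<epsilon>3_def)
    define \<epsilon> where "\<epsilon> = min (min \<epsilon>1 \<epsilon>2) (\<epsilon>3 / CB)"
    show ?thesis
    proof (intro exI[of _ \<epsilon>] conjI ballI impI allI)
      show "0 < \<epsilon>" using \<epsilon>1(1) \<epsilon>2(1) \<epsilon>3(1) CB(1) by (simp add: \<epsilon>_def)
      fix x N assume xD: "x \<in> D (Suc n)" and small: "dn x < \<epsilon>"
      obtain w y where x: "x = w # y" "y \<in> D n" "(\<lambda>k. w k - \<Omega> n y k) \<in> carr X\<theta>"
        using xD D_Suc[OF n] by blast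
      have len: "length y = n" "y \<noteq> []" using length_D[OF x(2)] n by auto
      have dnx: "dn x = nrm X\<theta> (\<lambda>k. w k - \<Omega> n y k) + dn y" unfolding x(1) by (simp add: dn_Cons len)
      have lt: "nrm X\<theta> (\<lambda>k. w k - \<Omega> n y k) < \<epsilon>" "dn y < \<epsilon>"
        using small dnx nrm_X\<theta>_nonneg[OF x(3)] dn_nonneg[OF x(2)] by auto
      define g where "g = (\<lambda>k. \<omega> (seq_of_tuples y k))"
      have Py: "(\<Sum>k<N. P (seq_of_tuples y k)) \<le> \<delta>'" using lt(2) by (intro \<epsilon>1(2)[OF x(2)]) (simp add: \<epsilon>_def)
      have pv: "(\<Sum>k<N. p (w k - \<Omega> n y k)) \<le> \<delta>'" using lt(1) by (intro \<epsilon>2(2)[OF x(3)]) (simp add: \<epsilon>_def)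
      have "calderon_norm X0 X1 (B n y) \<le> CB * dn y" by (rule CB(2)[OF x(2)])
      also have "\<dots> < CB * (\<epsilon>3 / CB)" using lt(2) CB(1) by (intro mult_strict_left_mono) (auto simp: \<epsilon>_def)
      also have "\<dots> = 1 * \<epsilon>3" using CB(1) by simp
      finally have "(\<Sum>k<N. p (\<Omega> n y k - g k)) \<le> K * (\<epsilon>3 + \<delta>')"
        unfolding g_def by (intro K(2)[OF x(2) \<epsilon>3(1,2)] Py)
      also have "\<dots> \<le> K * (\<delta>' + \<delta>')" using \<epsilon>3(3) K(1) by (intro mult_left_mono add_mono) auto
      finally have p\<Delta>: "(\<Sum>k<N. p (\<Omega> n y k - g k)) \<le> K * (\<delta>' + \<delta>')" .
      have "p (w k - g k) \<le> K' * (p (w k - \<Omega> n y k) + p (\<Omega> n y k - g k))" for k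
        using K'(2)[of "w k - \<Omega> n y k" "\<Omega> n y k - g k"] by simp
      then have "(\<Sum>k<N. p (w k - g k)) \<le> (\<Sum>k<N. K' * (p (w k - \<Omega> n y k) + p (\<Omega> n y k - g k)))"
        by (rule sum_mono)
      also have "\<dots> = K' * ((\<Sum>k<N. p (w k - \<Omega> n y k)) + (\<Sum>k<N. p (\<Omega> n y k - g k)))"
        by (simp add: sum_distrib_left sum.distrib distrib_left)
      also have "\<dots> \<le> K' * (\<delta>' + K * (\<delta>' + \<delta>'))" using K'(1) by (intro mult_left_mono add_mono pv p\<Delta>) auto
      finally have "(\<Sum>k<N. P (seq_of_tuples y k)) + (\<Sum>k<N. p (w k - g k)) \<le> \<delta>"
        using Py \<delta>'(2) by linarith
      then show "(\<Sum>k<N. P (seq_of_tuples x k)) \<le> \<delta>"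
        by (simp add: x(1) P_seq_of_tuples_Cons len g_def sum.distrib)
    qed
  qed
qed simp

text \<open>Both one-sided statements are applied to \<open>x\<close> divided by \<rho>. Smallness
  at level 1 makes every \<rho> above \<open>dn x / \<epsilon>\<close> admissible in the
  Fenchel-Orlicz quasinorm; boundedness at level 1 bounds \<open>dn x\<close> by a multiple of every
  admissible \<rho>.\<close>

theorem derived_space_eq_fo_space:
  assumes n: "0 < n"
  shows "seq_of_tuples ` D n = fo_space n P"
    and "\<exists>c>0. \<exists>C>0. \<forall>x\<in>D n. c * dn x \<le> fo_norm P (seq_of_tuples x) \<and> fo_norm P (seq_of_tuples x) \<le> C * dn x"
proof -
  obtain \<epsilon> where \<epsilon>: "0 < \<epsilon>" "\<And>x N. x \<in> D n \<Longrightarrow> dn x < \<epsilon> \<Longrightarrow> (\<Sum>k<N. P (seq_of_tuples x k)) \<le> 1"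
    using D_modular_small[OF n zero_less_one] by blast
  define admissible where "admissible = (\<lambda>x \<rho>. 0 < \<rho> \<and>
     summable (\<lambda>k. P (map (\<lambda>c. c / of_real \<rho>) (seq_of_tuples x k))) \<and>
     (\<Sum>k. P (map (\<lambda>c. c / of_real \<rho>) (seq_of_tuples x k))) \<le> 1)"
  have fo_norm: "fo_norm P (seq_of_tuples x) = Inf {\<rho>. admissible x \<rho>}" for x
    by (simp add: fo_norm_def admissible_def)
  have large: "admissible x \<rho>" if x: "x \<in> D n" and \<rho>: "dn x / \<epsilon> < \<rho>" for x \<rho>
  proof -
    have "0 \<le> dn x / \<epsilon>" using dn_nonneg[OF x] \<epsilon>(1) by simp
    then have \<rho>0: "0 < \<rho>" using \<rho> by linarith
    have "dn (scale_tuple (inverse (of_real \<rho>)) x) \<le> inverse \<rho> * dn x"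
      using dn_scale_le[OF n x, of "inverse (of_real \<rho>)"] \<rho>0 by (simp add: norm_inverse)
    also have "\<dots> < \<epsilon>" using \<rho> \<rho>0 \<epsilon>(1) by (simp add: field_simps)
    finally have small: "dn (scale_tuple (inverse (of_real \<rho>)) x) < \<epsilon>" .
    have le: "(\<Sum>k<N. P (map (\<lambda>c. c / of_real \<rho>) (seq_of_tuples x k))) \<le> 1" for N
      using \<epsilon>(2)[OF D_scale[OF n x] small, of N] by (simp add: seq_of_tuples_scale)
    then have "summable (\<lambda>k. P (map (\<lambda>c. c / of_real \<rho>) (seq_of_tuples x k)))"
      by (intro summableI_nonneg_bounded[of _ 1] P_nonneg)
    then show ?thesis using \<rho>0 le suminf_le_const unfolding admissible_def by blast
  qed
  \<comment> \<open>The level \<open>M\<close> stays general: membership in the Fenchel-Orlicz space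
    only says that the modular at some \<rho> is finite, whereas the quasinorm estimate uses level
    1.\<close>
  have finite_scale: "x \<in> D n \<and> dn x \<le> \<rho> * C"
    if C: "\<forall>x. length x = n \<longrightarrow> (\<forall>N. (\<Sum>k<N. P (seq_of_tuples x k)) \<le> M) \<longrightarrow> x \<in> D n \<and> dn x \<le> C"
      and len: "length x = n" and \<rho>: "0 < \<rho>" and s: "summable (\<lambda>k. P (map (\<lambda>c. c / of_real \<rho>) (seq_of_tuples x k)))"
      and M: "(\<Sum>k. P (map (\<lambda>c. c / of_real \<rho>) (seq_of_tuples x k))) \<le> M" for x \<rho> C M
  proof -
    define y where "y = scale_tuple (inverse (of_real \<rho>)) x"
    have "(\<Sum>k<N. P (seq_of_tuples y k)) \<le> M" for N
      using order_trans[OF sum_le_suminf[OF s] M, of "{..<N}"] P_nonneg by (simp add: y_def seq_of_tuples_scale)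
    then have y: "y \<in> D n" "dn y \<le> C" using C len by (auto simp: y_def)
    have x: "x = scale_tuple (of_real \<rho>) y" using \<rho> by (simp add: y_def scale_tuple_inverse)
    have "dn x \<le> \<rho> * dn y" using dn_scale_le[OF n y(1), of "of_real \<rho>"] \<rho> by (simp add: x)
    also have "\<dots> \<le> \<rho> * C" using y(2) \<rho> by (intro mult_left_mono) auto
    finally show ?thesis using D_scale[OF n y(1), of "of_real \<rho>"] by (simp add: x)
  qed
  show "seq_of_tuples ` D n = fo_space n P"
  proof
    show "seq_of_tuples ` D n \<subseteq> fo_space n P"
    proof
      fix X assume "X \<in> seq_of_tuples ` D n"
      then obtain x where x: "x \<in> D n" "X = seq_of_tuples x" by blast
      have "admissible x (dn x / \<epsilon> + 1)" by (rule large[OF x(1)]) simp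
      then show "X \<in> fo_space n P"
        unfolding x(2) using length_D[OF x(1)] by (auto simp: fo_space_def admissible_def)
    qed
    show "fo_space n P \<subseteq> seq_of_tuples ` D n"
    proof
      fix X assume "X \<in> fo_space n P"
      then obtain \<rho> where len: "\<And>k. length (X k) = n" and \<rho>: "0 < \<rho>" "summable (\<lambda>k. P (map (\<lambda>c. c / of_real \<rho>) (X k)))"
        by (auto simp: fo_space_def)
      obtain x where x: "length x = n" "seq_of_tuples x = X" using seq_of_tuples_surj[of X n] len by blast
      obtain C where C: "\<forall>x. length x = n \<longrightarrow>
          (\<forall>N. (\<Sum>k<N. P (seq_of_tuples x k)) \<le> (\<Sum>k. P (map (\<lambda>c. c / of_real \<rho>) (X k)))) \<longrightarrow> x \<in> D n \<and> dn x \<le> C"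
        using D_mem_if_modular_bounded[OF n] by blast
      have "x \<in> D n" using finite_scale[OF C x(1) \<rho>(1)] \<rho>(2) by (simp add: x(2))
      then show "X \<in> seq_of_tuples ` D n" using x(2) by blast
    qed
  qed
  obtain C0 where C0: "\<forall>x. length x = n \<longrightarrow> (\<forall>N. (\<Sum>k<N. P (seq_of_tuples x k)) \<le> 1) \<longrightarrow> x \<in> D n \<and> dn x \<le> C0"
    using D_mem_if_modular_bounded[OF n] by blast
  define C where "C = max 1 C0"
  have C: "0 < C" "C0 \<le> C" by (auto simp: C_def)
  have "1 / C * dn x \<le> fo_norm P (seq_of_tuples x) \<and> fo_norm P (seq_of_tuples x) \<le> 1 / \<epsilon> * dn x"
    if x: "x \<in> D n" for x
  proof
    have "dn x / C \<le> Inf {\<rho>. admissible x \<rho>}"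
    proof (rule cInf_greatest)
      show "{\<rho>. admissible x \<rho>} \<noteq> {}" using large[OF x less_add_one] by blast
      fix \<rho> assume "\<rho> \<in> {\<rho>. admissible x \<rho>}"
      then have \<rho>: "0 < \<rho>" "dn x \<le> \<rho> * C0"
        using finite_scale[OF C0 length_D[OF x], of \<rho>] by (auto simp: admissible_def)
      then have "dn x \<le> \<rho> * C" using mult_left_mono[OF C(2), of \<rho>] by linarith
      then show "dn x / C \<le> \<rho>" using C(1) by (simp add: pos_divide_le_eq)
    qed
    then show "1 / C * dn x \<le> fo_norm P (seq_of_tuples x)" by (simp add: fo_norm)
    have "Inf {\<rho>. admissible x \<rho>} \<le> dn x / \<epsilon>"
    proof (rule dense_ge)
      fix \<rho> assume "dn x / \<epsilon> < \<rho>"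
      then show "Inf {\<rho>. admissible x \<rho>} \<le> \<rho>"
        using large[OF x] by (intro cInf_lower bdd_belowI[of _ 0]) (auto simp: admissible_def)
    qed
    then show "fo_norm P (seq_of_tuples x) \<le> 1 / \<epsilon> * dn x" by (simp add: fo_norm)
  qed
  moreover have "0 < 1 / C" "0 < 1 / \<epsilon>" using C(1) \<epsilon>(1) by auto
  ultimately show "\<exists>c>0. \<exists>C>0. \<forall>x\<in>D n. c * dn x \<le> fo_norm P (seq_of_tuples x) \<and> fo_norm P (seq_of_tuples x) \<le> C * dn x"
    by blast
qed

end

lemma calibrated_endpoint:
  assumes "endpoint_ok E0"
  shows "calibrated (endpoint_space E0) (endpoint_inv E0)"
proof (cases E0)
  case (Orlicz_Space \<phi>)
  then interpret orlicz_function \<phi> using assms by unfold_locales auto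
  show ?thesis using calibrated_axioms by (simp add: Orlicz_Space)
qed (simp_all add: calibrated_ell_infty calibrated_c_zero)

theorem theorem4p6:
  fixes E0 :: endpoint and \<phi>1 :: "complex \<Rightarrow> real" and \<theta> :: real
    and h :: "complex \<Rightarrow> complex" and B :: lifting and n :: nat
  defines "X0 \<equiv> endpoint_space E0" and "X1 \<equiv> ell_orlicz \<phi>1"
    and "\<phi> \<equiv> phi_theta_tuple (endpoint_inv E0) (orlicz_inv \<phi>1) \<theta> h"
  assumes "endpoint_ok E0"
    and "orlicz \<phi>1" and "nondegenerate \<phi>1" and "delta2 \<phi>1"
    and "0 < \<theta>" and "\<theta> < 1"
    and "strip_conformal \<theta> h"
    and "admissible_lifting X0 X1 \<theta> B"
    and "1 \<le> n"
  shows "seq_of_tuples ` derived_space X0 X1 \<theta> B n = fo_space n \<phi> \<and>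
    (\<exists>c>0. \<exists>C>0. \<forall>x\<in>derived_space X0 X1 \<theta> B n.
       c * derived_norm X0 X1 \<theta> B x \<le> fo_norm \<phi> (seq_of_tuples x) \<and>
       fo_norm \<phi> (seq_of_tuples x) \<le> C * derived_norm X0 X1 \<theta> B x)"
proof -
  interpret \<phi>1: orlicz_function \<phi>1 using assms by unfold_locales
  interpret E0: calibrated "endpoint_space E0" "endpoint_inv E0"
    using assms by (intro calibrated_endpoint)
  interpret lifted_interpolation "endpoint_space E0" "endpoint_inv E0" "ell_orlicz \<phi>1" "orlicz_inv \<phi>1" \<theta> h B
  proof
    show "0 < \<theta>" "\<theta> < 1" "strip_conformal \<theta> h" by fact+
    show "admissible_lifting (endpoint_space E0) (ell_orlicz \<phi>1) \<theta> B" using assms by simp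
    show "orlicz_inv \<phi>1 0 = 0" by (rule \<phi>1.inv_0)
    show "orlicz_inv \<phi>1 s < orlicz_inv \<phi>1 t" if "0 \<le> s" "s < t" for s t
      using that by (rule \<phi>1.inv_strict_mono)
    \<comment> \<open>The inverse takes the value \<open>e\<close> exactly at
      \<open>\<phi>1 e\<close>; the same witness gives the large values below.\<close>
    show "\<exists>s>0. orlicz_inv \<phi>1 s \<le> e" if "0 < e" for e
      using that \<phi>1.pos[of "of_real e"] \<phi>1.inv_apply[of e] by (intro exI[of _ "\<phi>1 (of_real e)"]) auto
    show "\<exists>s>0. R \<le> orlicz_inv \<phi>1 s" for R
      using \<phi>1.pos[of "of_real (max R 1)"] \<phi>1.inv_apply[of "max R 1"]
      by (intro exI[of _ "\<phi>1 (of_real (max R 1))"]) auto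
    show "\<exists>K\<ge>1. \<forall>s\<ge>0. 2 * orlicz_inv \<phi>1 s \<le> orlicz_inv \<phi>1 (K * s)"
      using \<phi>1.inv_delta2[OF \<open>delta2 \<phi>1\<close>] by blast
  qed
  show ?thesis
    using derived_space_eq_fo_space[of n] \<open>1 \<le> n\<close> unfolding X0_def X1_def \<phi>_def by simp
qed

end
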